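(* Let $n=3$, $\lambda>0$ and $b,c,d\in\mathbb{R}$ such that $b^2+4(c+1)<0$ and $d$ is sufficiently small. Let $q_d(y,z)=-y^3+by^2z+cyz^2+dz^3$ and $$Q_N(x,d)=(q_d(x_1,x_3),\,q_d(x_2,x_1),\,q_d(x_3,x_2)),\qquad x\in\mathbb{R}^3,$$ and suppose that $Q_N(\cdot,0)$ is contracting as a consequence of the coefficient condition stated in the context. Consider the system $\dot x=\lambda x+Q_N(x,d)$ on its invariant sphere, the flow there being identified with that of $\dot u=\mathcal{P}_N(u,d)=Q_N(u,d)-\langle Q_N(u,d),u\rangle u$ on $S^2$. For $d=0$ this system has a heteroclinic network with connections from $e_{i+1}$ to $\pm e_i$ and from $-e_{i+1}$ to $\pm e_i$, $i=1,2,3$ (indices modulo $3$). Define $\alpha=-(c+1)>0$. Assume that the system $\dot u=\mathcal{P}_N(u,d)$ is topologically equivalent, in a neighbourhood of the heteroclinic connections around the equilibrium $e_1$, to the linear system $$\dot p_2=\alpha d-\alpha p_2,\qquad \dot p_3=p_3,$$ with the cross sections and identifications described in the context. Then the dynamics around the destroyed heteroclinic network is as follows: - If $\alpha>1$ and $d>0$, then there are three attracting periodic orbits, passing nearby the poles $e_1,e_3,e_2,e_1$; $-e_1,-e_3,-e_2,-e_1$; and $e_1,-e_3,e_2,-e_1,e_3,-e_2,e_1$, respectively. - If $\alpha>1$ and $d<0$, then there is one attracting periodic orbit, passing nearby the poles $e_1,-e_3,-e_2,e_1,e_3,-e_2,-e_1,e_3,e_2,-e_1,-e_3,e_2,e_1$.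 - If $\alpha<1$ and $d>0$, then there is one repelling periodic orbit, passing nearby the poles $e_1,-e_3,e_2,-e_1,e_3,-e_2,e_1$. - If $\alpha<1$ and $d<0$, then there are two repelling periodic orbits, passing nearby the poles $e_1,e_3,e_2,e_1$ and $-e_1,-e_3,-e_2,-e_1$, respectively.
   Context: Notation. $\langle\cdot,\cdot\rangle$ is the Euclidean inner product, $S^2$ the unit sphere of $\mathbb{R}^3$, $e_1,e_2,e_3$ the standard basis vectors, and $\pm e_1,\pm e_2,\pm e_3$ the poles. A homogeneous polynomial map $Q$ is contracting if $\langle Q(u),u\rangle<0$ for all $u\in S^2$. When $Q_N(\cdot,d)$ is contracting, for every $\lambda>0$ the system $\dot x=\lambda x+Q_N(x,d)$ has a unique invariant topological $2$-sphere in $\mathbb{R}^3\setminus\{0\}$; it attracts all nonzero trajectories, and the flow on it is topologically equivalent to that of $\dot u=\mathcal{P}_N(u,d)$ on $S^2$. Coefficient condition (guaranteeing that $Q_N(\cdot,0)$ is contracting). With $a=-1$ and $d=0$ there is $k$ with $a<k<0$ such that $(\Delta(k)>0\wedge(P(k)>0\vee D(k)>0))\vee(\Delta(k)=D(k)=R(k)=0\wedge P(k)>0)$, where $$\begin{aligned} \Delta(k)={}&256(a-k)^{3}k^{3}-192(a-k)^{2}bdk^{2}-128(a-k)^{2}c^{2}k^{2}+144(a-k)^{2}cd^{2}k-27(a-k)^{2}d^{4}\\ &+144(a-k)b^{2}ck^{2}-6(a-k)b^{2}d^{2}k-80(a-k)bc^{2}dk+18(a-k)bcd^{3}+16(a-k)c^{4}k\\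 &-4(a-k)c^{3}d^{2}-27b^{4}k^{2}+18b^{3}cdk-4b^{3}d^{3}-4b^{2}c^{3}k+b^{2}c^{2}d^{2},\\ P(k)={}&8(a-k)c-3b^{2},\\ D(k)={}&64(a-k)^{3}k-16(a-k)^{2}c^{2}+16(a-k)b^{2}c-16(a-k)^{2}bd-3b^{4},\\ R(k)={}&b^{3}+8d(a-k)^{2}-4(a-k)bc. \end{aligned}$$ For small $d$, $Q_N(\cdot,d)$ is then taken to be contracting as well. Symmetry. The system on $S^2$ is equivariant under $Z(u_1,u_2,u_3)=(u_2,u_3,u_1)$ and $S(u)=-u$. The poles form a single group orbit. For small $d$ each pole $\pm e_i$ persists as a nearby equilibrium; these six equilibria are images of each other under the group generated by $Z$ and $S$, and they are the only equilibria in a suitable neighbourhood of the ($d=0$) heteroclinic network. Local coordinates and cross sections. On the half-sphere $\{u\in S^2:u_1>0\}$ use the coordinates $(p_2,p_3)=(u_2/u_1,u_3/u_1)$ centred at $e_1$. For a small $\epsilon>0$, $\delta=1/\epsilon$, and small $\mu,\nu>0$, the incoming cross sections are $$I_A=\{\epsilon\}\times]0,\nu[,\quad I_B=\{\epsilon\}\times]-\nu,0[,\quad I_C=\{-\epsilon\}\times]0,\nu[,\quad I_D=\{-\epsilon\}\times]-\nu,0[,$$ and the outgoing cross sections are $$O_A=]0,\mu[\times\{\delta\},\quad O_B=]-\mu,0[\times\{\delta\},\quad O_C=]-\mu,0[\times\{-\delta\},\quad O_D=]0,\mu[\times\{-\delta\}.$$ On the quotient of the sphere by the group generated by $Z$ and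 $S$, incoming and outgoing sections with the same label are identified: the outgoing sections at $p_3=\delta$ ($O_A,O_B$) are glued to $I_A,I_B$ via $Z$ (preserving orientation), and the outgoing sections at $p_3=-\delta$ ($O_C,O_D$) are glued to $I_C,I_D$ via $S\circ Z$ (reversing orientation). The dynamics near the destroyed network is described by the resulting Poincaré map on $I_A\cup I_B\cup I_C\cup I_D$. Terminology. "Around the destroyed heteroclinic network" means in a neighbourhood of the heteroclinic network present at $d=0$. A periodic orbit "passes nearby the poles $p_0,p_1,\dots,p_m=p_0$" if over one period it passes successively close to $p_0,p_1,\dots,p_m$ in this order, closing up after the last one. Attracting and repelling refer to the flow on the sphere. *)

theory Defs
  imports "HOL-Analysis.Analysis"
begin

section \<open>The vector field\<close>

definition q :: "real \<Rightarrow> real \<Rightarrow> real \<Rightarrow> real \<Rightarrow> real \<Rightarrow> real" where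
  "q b c d y z = - (y ^ 3) + b * y\<^sup>2 * z + c * y * z\<^sup>2 + d * z ^ 3"

definition QN :: "real \<Rightarrow> real \<Rightarrow> real \<Rightarrow> real^3 \<Rightarrow> real^3" where
  "QN b c d x = vector [q b c d (x$1) (x$3), q b c d (x$2) (x$1), q b c d (x$3) (x$2)]"

definition system :: "real \<Rightarrow> real \<Rightarrow> real \<Rightarrow> real \<Rightarrow> real^3 \<Rightarrow> real^3" where
  "system lam b c d x = lam *\<^sub>R x + QN b c d x"

definition PN :: "real \<Rightarrow> real \<Rightarrow> real \<Rightarrow> real^3 \<Rightarrow> real^3" where
  "PN b c d u = QN b c d u - (QN b c d u \<bullet> u) *\<^sub>R u"

abbreviation S2 :: "(real^3) set" where
  "S2 \<equiv> sphere 0 1"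

definition contracting :: "(real^3 \<Rightarrow> real^3) \<Rightarrow> bool" where
  "contracting Q \<longleftrightarrow> (\<forall>u\<in>S2. Q u \<bullet> u < 0)"

lemma QN_scaleR: "QN b c d (r *\<^sub>R x) = r ^ 3 *\<^sub>R QN b c d x"
  by (simp add: QN_def q_def vec_eq_iff forall_3 algebra_simps power2_eq_square power3_eq_cube)

text \<open>
  The flow of \<^const>\<open>system\<close> on its invariant sphere is identified with the flow of
  \<^const>\<open>PN\<close> on \<^term>\<open>S2\<close>: the radial projection of a trajectory solves the equation of
  \<^const>\<open>PN\<close> up to the positive time change with speed \<open>(norm x)\<^sup>2\<close>, whatever the value of
  the parameter \<open>lam\<close>.
\<close>

lemma radial_projection_system:
  assumes deriv: "(x has_vector_derivative system lam b c d (x t)) (at t)"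
    and nz: "x t \<noteq> 0"
  shows "((\<lambda>s. x s /\<^sub>R norm (x s)) has_vector_derivative
           (norm (x t))\<^sup>2 *\<^sub>R PN b c d (x t /\<^sub>R norm (x t))) (at t)"
proof -
  let ?F = "system lam b c d (x t)" and ?n = "norm (x t)"
  have n0: "?n > 0" using nz by simp
  have dx: "(x has_derivative (\<lambda>h. h *\<^sub>R ?F)) (at t)"
    using deriv by (simp add: has_vector_derivative_def)
  have dn: "(norm has_derivative (\<lambda>h. h \<bullet> sgn (x t))) (at (x t))"
    using has_derivative_norm[OF nz] by (simp add: inner_commute)
  have "((\<lambda>s. norm (x s)) has_derivative (\<lambda>h. (h *\<^sub>R ?F) \<bullet> sgn (x t))) (at t)"
    using has_derivative_compose[OF dx dn] .
  then have "((\<lambda>s. norm (x s)) has_real_derivative (?F \<bullet> sgn (x t))) (at t)"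
    by (simp add: has_field_derivative_def mult_commute_abs)
  then have di: "((\<lambda>s. inverse (norm (x s))) has_real_derivative
      - (inverse ?n * (?F \<bullet> sgn (x t)) * inverse ?n)) (at t)"
    using n0 by (intro DERIV_inverse') auto
  have "((\<lambda>s. inverse (norm (x s)) *\<^sub>R x s) has_vector_derivative
      (inverse ?n *\<^sub>R ?F + (- (inverse ?n * (?F \<bullet> sgn (x t)) * inverse ?n)) *\<^sub>R x t)) (at t)"
    using has_vector_derivative_scaleR[OF di deriv] by simp
  moreover have "inverse ?n *\<^sub>R ?F + (- (inverse ?n * (?F \<bullet> sgn (x t)) * inverse ?n)) *\<^sub>R x t
      = ?n\<^sup>2 *\<^sub>R PN b c d (x t /\<^sub>R ?n)"
  proof -
    define u where "u = x t /\<^sub>R ?n"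
    have xu: "x t = ?n *\<^sub>R u" using n0 by (simp add: u_def)
    have su: "sgn (x t) = u" by (simp add: u_def sgn_div_norm)
    have uu: "u \<bullet> u = 1" using n0
      by (simp add: u_def power2_norm_eq_inner[symmetric] power2_eq_square)
    define m where "m = ?n"
    have m0: "m > 0" using n0 by (simp add: m_def)
    have F: "?F = (lam * m) *\<^sub>R u + m ^ 3 *\<^sub>R QN b c d u"
      unfolding system_def
      by (subst (1 2) xu) (simp add: QN_scaleR m_def)
    have Fu: "?F \<bullet> u = lam * m + m ^ 3 * (QN b c d u \<bullet> u)"
      unfolding F by (simp add: inner_left_distrib uu)
    have 1: "inverse m *\<^sub>R ?F = lam *\<^sub>R u + m\<^sup>2 *\<^sub>R QN b c d u"
    proof -
      have "inverse m * (lam * m) = lam" "inverse m * m ^ 3 = m\<^sup>2"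
        using m0 by (simp_all add: field_simps power2_eq_square power3_eq_cube)
      then show ?thesis unfolding F by (simp add: scaleR_right_distrib)
    qed
    have 2: "(inverse m * (?F \<bullet> u) * inverse m) * m = lam + m\<^sup>2 * (QN b c d u \<bullet> u)"
      unfolding Fu using m0 by (simp add: field_simps power2_eq_square power3_eq_cube)
    have "inverse m *\<^sub>R ?F + (- (inverse m * (?F \<bullet> u) * inverse m)) *\<^sub>R (m *\<^sub>R u)
        = inverse m *\<^sub>R ?F - ((inverse m * (?F \<bullet> u) * inverse m) * m) *\<^sub>R u"
      by simp
    also have "\<dots> = m\<^sup>2 *\<^sub>R (QN b c d u - (QN b c d u \<bullet> u) *\<^sub>R u)"
      unfolding 1 2 by (simp add: algebra_simps)
    finally have "inverse m *\<^sub>R ?F + (- (inverse m * (?F \<bullet> u) * inverse m)) *\<^sub>R (m *\<^sub>R u)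
        = m\<^sup>2 *\<^sub>R (QN b c d u - (QN b c d u \<bullet> u) *\<^sub>R u)" .
    then show ?thesis
      unfolding PN_def u_def[symmetric] su
      by (subst (3) xu) (simp add: m_def)
  qed
  ultimately show ?thesis by simp
qed

subsection \<open>The coefficient condition\<close>

definition \<Delta>_cc :: "real \<Rightarrow> real \<Rightarrow> real \<Rightarrow> real \<Rightarrow> real \<Rightarrow> real" where
  "\<Delta>_cc a b c d k =
     256*(a-k)^3*k^3 - 192*(a-k)^2*b*d*k^2 - 128*(a-k)^2*c^2*k^2 + 144*(a-k)^2*c*d^2*k
     - 27*(a-k)^2*d^4
     + 144*(a-k)*b^2*c*k^2 - 6*(a-k)*b^2*d^2*k - 80*(a-k)*b*c^2*d*k + 18*(a-k)*b*c*d^3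
     + 16*(a-k)*c^4*k
     - 4*(a-k)*c^3*d^2 - 27*b^4*k^2 + 18*b^3*c*d*k - 4*b^3*d^3 - 4*b^2*c^3*k + b^2*c^2*d^2"

definition P_cc :: "real \<Rightarrow> real \<Rightarrow> real \<Rightarrow> real \<Rightarrow> real" where
  "P_cc a b c k = 8*(a-k)*c - 3*b^2"

definition D_cc :: "real \<Rightarrow> real \<Rightarrow> real \<Rightarrow> real \<Rightarrow> real \<Rightarrow> real" where
  "D_cc a b c d k =
     64*(a-k)^3*k - 16*(a-k)^2*c^2 + 16*(a-k)*b^2*c - 16*(a-k)^2*b*d - 3*b^4"

definition R_cc :: "real \<Rightarrow> real \<Rightarrow> real \<Rightarrow> real \<Rightarrow> real \<Rightarrow> real" where
  "R_cc a b c d k = b^3 + 8*d*(a-k)^2 - 4*(a-k)*b*c"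

definition coefficient_condition :: "real \<Rightarrow> real \<Rightarrow> real \<Rightarrow> real \<Rightarrow> bool" where
  "coefficient_condition a b c d \<longleftrightarrow>
     (\<exists>k. a < k \<and> k < 0 \<and>
        ((\<Delta>_cc a b c d k > 0 \<and> (P_cc a b c k > 0 \<or> D_cc a b c d k > 0)) \<or>
         (\<Delta>_cc a b c d k = 0 \<and> D_cc a b c d k = 0 \<and> R_cc a b c d k = 0 \<and> P_cc a b c k > 0)))"


section \<open>Flows and periodic orbits\<close>

definition flow_of :: "('a::real_normed_vector \<Rightarrow> 'a) \<Rightarrow> 'a set \<Rightarrow> (real \<Rightarrow> 'a \<Rightarrow> 'a) \<Rightarrow> bool" where
  "flow_of F M \<phi> \<longleftrightarrow>
     continuous_on (UNIV \<times> M) (\<lambda>(t, u). \<phi> t u) \<and>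
     (\<forall>u\<in>M. \<phi> 0 u = u) \<and>
     (\<forall>u\<in>M. \<forall>t. \<phi> t u \<in> M) \<and>
     (\<forall>u\<in>M. \<forall>s t. \<phi> (s + t) u = \<phi> s (\<phi> t u)) \<and>
     (\<forall>u\<in>M. \<forall>t. ((\<lambda>t. \<phi> t u) has_vector_derivative F (\<phi> t u)) (at t))"

definition orbit :: "(real \<Rightarrow> 'a \<Rightarrow> 'a) \<Rightarrow> 'a \<Rightarrow> 'a set" where
  "orbit \<phi> u = range (\<lambda>t. \<phi> t u)"

text \<open>\<open>T\<close> is the minimal period; in particular \<open>u\<close> is not an equilibrium.\<close>

definition has_period :: "(real \<Rightarrow> 'a \<Rightarrow> 'a) \<Rightarrow> 'a \<Rightarrow> real \<Rightarrow> bool" where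
  "has_period \<phi> u T \<longleftrightarrow> T > 0 \<and> \<phi> T u = u \<and> (\<forall>t. 0 < t \<and> t < T \<longrightarrow> \<phi> t u \<noteq> u)"

definition periodic_orbit :: "(real \<Rightarrow> real^3 \<Rightarrow> real^3) \<Rightarrow> (real^3) set \<Rightarrow> bool" where
  "periodic_orbit \<phi> \<gamma> \<longleftrightarrow> (\<exists>u\<in>S2. \<exists>T. has_period \<phi> u T \<and> \<gamma> = orbit \<phi> u)"

definition attracting :: "(real \<Rightarrow> real^3 \<Rightarrow> real^3) \<Rightarrow> (real^3) set \<Rightarrow> bool" where
  "attracting \<phi> \<gamma> \<longleftrightarrow>
     (\<forall>V. openin (top_of_set S2) V \<and> \<gamma> \<subseteq> V \<longrightarrow>
        (\<exists>N. openin (top_of_set S2) N \<and> \<gamma> \<subseteq> N \<and> (\<forall>u\<in>N. \<forall>t\<ge>0. \<phi> t u \<in> V))) \<and>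
     (\<exists>N. openin (top_of_set S2) N \<and> \<gamma> \<subseteq> N \<and>
        (\<forall>u\<in>N. ((\<lambda>t. infdist (\<phi> t u) \<gamma>) \<longlongrightarrow> 0) at_top))"

definition repelling :: "(real \<Rightarrow> real^3 \<Rightarrow> real^3) \<Rightarrow> (real^3) set \<Rightarrow> bool" where
  "repelling \<phi> \<gamma> \<longleftrightarrow> attracting (\<lambda>t. \<phi> (- t)) \<gamma>"


section \<open>Poles, symmetries and the heteroclinic network\<close>

text \<open>Arithmetic in the index type \<open>3\<close> is modulo 3, so \<open>e (i + 1)\<close> is cyclic.\<close>

definition e :: "3 \<Rightarrow> real^3" where
  "e i = axis i 1"

definition poles :: "(real^3) set" where
  "poles = range e \<union> range (\<lambda>i. - e i)"

definition Z :: "real^3 \<Rightarrow> real^3" where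
  "Z u = vector [u$2, u$3, u$1]"

definition S :: "real^3 \<Rightarrow> real^3" where
  "S u = - u"

text \<open>The saturation of a set under the group generated by \<open>Z\<close> and \<open>S\<close>.\<close>

definition saturate :: "(real^3) set \<Rightarrow> (real^3) set" where
  "saturate U = (\<Union>k<3. (Z ^^ k) ` U \<union> S ` (Z ^^ k) ` U)"

definition quarter_circle :: "real^3 \<Rightarrow> real^3 \<Rightarrow> (real^3) set" where
  "quarter_circle p p' = {u \<in> S2. \<exists>s>0. \<exists>t>0. u = s *\<^sub>R p + t *\<^sub>R p'}"

definition heteroclinic_connection ::
  "(real \<Rightarrow> real^3 \<Rightarrow> real^3) \<Rightarrow> real^3 \<Rightarrow> real^3 \<Rightarrow> (real^3) set \<Rightarrow> bool" where
  "heteroclinic_connection \<phi> p p' \<gamma> \<longleftrightarrow>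
     p \<in> S2 \<and> p' \<in> S2 \<and> (\<forall>t. \<phi> t p = p) \<and> (\<forall>t. \<phi> t p' = p') \<and>
     (\<exists>u\<in>S2. \<gamma> = orbit \<phi> u \<and>
        ((\<lambda>t. \<phi> t u) \<longlongrightarrow> p) at_bot \<and> ((\<lambda>t. \<phi> t u) \<longlongrightarrow> p') at_top)"

text \<open>For \<open>d = 0\<close> the coordinate planes are invariant and the connections are open quarter
  circles in them.\<close>

definition network :: "(real^3) set" where
  "network = poles \<union> (\<Union>i. \<Union>s\<in>{1,-1}. \<Union>s'\<in>{1,-1}. quarter_circle (s *\<^sub>R e (i + 1)) (s' *\<^sub>R e i))"

text \<open>Over one period the orbit passes \<open>\<eta>\<close>-close to the listed poles, in the given order and
  closing up after the last one; between two successive entries it is not \<open>\<eta>\<close>-close to any other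
  pole.\<close>

definition passes_nearby ::
  "(real \<Rightarrow> real^3 \<Rightarrow> real^3) \<Rightarrow> real \<Rightarrow> (real^3) list \<Rightarrow> (real^3) set \<Rightarrow> bool" where
  "passes_nearby \<phi> \<eta> ps \<gamma> \<longleftrightarrow>
     (\<exists>u\<in>S2. \<exists>T. \<exists>ts :: nat \<Rightarrow> real.
        has_period \<phi> u T \<and> \<gamma> = orbit \<phi> u \<and> ts 0 = 0 \<and> ts (length ps - 1) = T \<and>
        (\<forall>i<length ps. dist (\<phi> (ts i) u) (ps ! i) < \<eta>) \<and>
        (\<forall>i. Suc i < length ps \<longrightarrow> ts i < ts (Suc i) \<and>
           (\<forall>t\<in>{ts i..ts (Suc i)}. \<forall>p\<in>poles - {ps ! i, ps ! Suc i}. \<eta> \<le> dist (\<phi> t u) p)))"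

text \<open>The periodic orbits in \<open>V\<close> with property \<open>P\<close> (attracting or repelling) are exactly one
  for each listed itinerary.\<close>

definition periodic_orbits_are ::
  "(real \<Rightarrow> real^3 \<Rightarrow> real^3) \<Rightarrow> (real^3) set \<Rightarrow> real \<Rightarrow>
   ((real \<Rightarrow> real^3 \<Rightarrow> real^3) \<Rightarrow> (real^3) set \<Rightarrow> bool) \<Rightarrow> (real^3) list list \<Rightarrow> bool" where
  "periodic_orbits_are \<phi> V \<eta> P pss \<longleftrightarrow>
     (\<exists>\<gamma>s. distinct \<gamma>s \<and> set \<gamma>s = {\<gamma>. periodic_orbit \<phi> \<gamma> \<and> \<gamma> \<subseteq> V \<and> P \<phi> \<gamma>} \<and>
        list_all2 (passes_nearby \<phi> \<eta>) pss \<gamma>s)"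


section \<open>Topological equivalence\<close>

text \<open>\<open>h\<close> maps pieces of \<open>\<phi>\<close>-orbits in \<open>U\<close> to pieces of \<open>\<psi>\<close>-orbits, preserving the direction
  of time.\<close>

definition maps_orbits ::
  "(real \<Rightarrow> 'a \<Rightarrow> 'a) \<Rightarrow> (real \<Rightarrow> 'b \<Rightarrow> 'b) \<Rightarrow> 'a set \<Rightarrow> ('a \<Rightarrow> 'b) \<Rightarrow> bool" where
  "maps_orbits \<phi> \<psi> U h \<longleftrightarrow>
     (\<forall>u\<in>U. \<forall>T\<ge>0. (\<forall>t\<in>{0..T}. \<phi> t u \<in> U) \<longrightarrow>
        (\<exists>\<tau> :: real \<Rightarrow> real. continuous_on {0..T} \<tau> \<and> strict_mono_on {0..T} \<tau> \<and> \<tau> 0 = 0 \<and>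
           (\<forall>t\<in>{0..T}. h (\<phi> t u) = \<psi> (\<tau> t) (h u))))"

definition topologically_equivalent_via ::
  "(real \<Rightarrow> 'a::topological_space \<Rightarrow> 'a) \<Rightarrow> 'a set \<Rightarrow>
   (real \<Rightarrow> 'b::topological_space \<Rightarrow> 'b) \<Rightarrow> 'b set \<Rightarrow> ('a \<Rightarrow> 'b) \<Rightarrow> ('b \<Rightarrow> 'a) \<Rightarrow> bool" where
  "topologically_equivalent_via \<phi> U \<psi> W h h' \<longleftrightarrow>
     homeomorphism U W h h' \<and> maps_orbits \<phi> \<psi> U h \<and> maps_orbits \<psi> \<phi> W h'"


section \<open>The linear model near the first pole\<close>

definition lin_field :: "real \<Rightarrow> real \<Rightarrow> real \<times> real \<Rightarrow> real \<times> real" where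
  "lin_field \<alpha> d = (\<lambda>(p2, p3). (\<alpha> * d - \<alpha> * p2, p3))"

definition lin_flow :: "real \<Rightarrow> real \<Rightarrow> real \<Rightarrow> real \<times> real \<Rightarrow> real \<times> real" where
  "lin_flow \<alpha> d t = (\<lambda>(p2, p3). (d + (p2 - d) * exp (- \<alpha> * t), p3 * exp t))"

lemma flow_of_lin_flow: "flow_of (lin_field \<alpha> d) UNIV (lin_flow \<alpha> d)"
  unfolding flow_of_def
proof (intro conjI ballI allI)
  show "continuous_on (UNIV \<times> UNIV) (\<lambda>(t, u). lin_flow \<alpha> d t u)"
    unfolding lin_flow_def case_prod_unfold by (intro continuous_intros)
next
  fix u :: "real \<times> real" and t :: real
  have "((\<lambda>t. (d + (fst u - d) * exp (- \<alpha> * t), snd u * exp t)) has_vector_derivative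
      ((fst u - d) * (exp (- \<alpha> * t) * (- \<alpha>)), snd u * exp t)) (at t)"
    by (intro has_vector_derivative_Pair)
      (auto intro!: derivative_eq_intros simp: has_real_derivative_iff_has_vector_derivative[symmetric])
  then show "((\<lambda>t. lin_flow \<alpha> d t u) has_vector_derivative lin_field \<alpha> d (lin_flow \<alpha> d t u)) (at t)"
    by (simp add: lin_flow_def lin_field_def case_prod_unfold algebra_simps)
qed (auto simp: lin_flow_def exp_add algebra_simps exp_diff exp_minus divide_simps)

text \<open>The coordinates \<open>(p\<^sub>2, p\<^sub>3)\<close> on the half-sphere \<open>u $ 1 > 0\<close>.\<close>

definition chart :: "real^3 \<Rightarrow> real \<times> real" where
  "chart u = (u$2 / u$1, u$3 / u$1)"

text \<open>In these coordinates both \<open>Z\<close> and \<open>S \<circ> Z\<close> read \<open>(p\<^sub>2, p\<^sub>3) \<mapsto> (p\<^sub>3 / p\<^sub>2, 1 / p\<^sub>2)\<close>.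
  Thus \<open>Z\<close> takes the line \<open>p\<^sub>2 = \<epsilon>\<close> to the line \<open>p\<^sub>3 = 1 / \<epsilon>\<close> and \<open>S \<circ> Z\<close> takes
  \<open>p\<^sub>2 = - \<epsilon>\<close> to \<open>p\<^sub>3 = - 1 / \<epsilon>\<close>; the former is increasing and the latter decreasing in the
  remaining coordinate, which is multiplied by \<open>\<plusminus> 1 / \<epsilon>\<close>.\<close>

definition glue :: "real \<times> real \<Rightarrow> real \<times> real" where
  "glue = (\<lambda>(p2, p3). (p3 / p2, 1 / p2))"

lemma chart_Z: "u$1 \<noteq> 0 \<Longrightarrow> chart (Z u) = glue (chart u)"
  by (simp add: chart_def Z_def glue_def)

lemma chart_S: "chart (S u) = chart u"
  by (simp add: chart_def S_def)

definition I_A :: "real \<Rightarrow> real \<Rightarrow> (real \<times> real) set" where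
  "I_A \<epsilon> \<nu> = {\<epsilon>} \<times> {0<..<\<nu>}"
definition I_B :: "real \<Rightarrow> real \<Rightarrow> (real \<times> real) set" where
  "I_B \<epsilon> \<nu> = {\<epsilon>} \<times> {-\<nu><..<0}"
definition I_C :: "real \<Rightarrow> real \<Rightarrow> (real \<times> real) set" where
  "I_C \<epsilon> \<nu> = {-\<epsilon>} \<times> {0<..<\<nu>}"
definition I_D :: "real \<Rightarrow> real \<Rightarrow> (real \<times> real) set" where
  "I_D \<epsilon> \<nu> = {-\<epsilon>} \<times> {-\<nu><..<0}"

definition O_A :: "real \<Rightarrow> real \<Rightarrow> (real \<times> real) set" where
  "O_A \<delta> \<mu> = {0<..<\<mu>} \<times> {\<delta>}"
definition O_B :: "real \<Rightarrow> real \<Rightarrow> (real \<times> real) set" where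
  "O_B \<delta> \<mu> = {-\<mu><..<0} \<times> {\<delta>}"
definition O_C :: "real \<Rightarrow> real \<Rightarrow> (real \<times> real) set" where
  "O_C \<delta> \<mu> = {-\<mu><..<0} \<times> {-\<delta>}"
definition O_D :: "real \<Rightarrow> real \<Rightarrow> (real \<times> real) set" where
  "O_D \<delta> \<mu> = {0<..<\<mu>} \<times> {-\<delta>}"

text \<open>The identification of outgoing and incoming sections with the same label by \<^const>\<open>glue\<close>
  requires \<open>\<nu> = \<epsilon> * \<mu>\<close>.\<close>

lemma glue_sections:
  assumes "\<epsilon> > 0" and "\<nu> = \<epsilon> * \<mu>"
  shows "glue ` I_A \<epsilon> \<nu> = O_A (1 / \<epsilon>) \<mu>" and "glue ` I_B \<epsilon> \<nu> = O_B (1 / \<epsilon>) \<mu>"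
    and "glue ` I_C \<epsilon> \<nu> = O_C (1 / \<epsilon>) \<mu>" and "glue ` I_D \<epsilon> \<nu> = O_D (1 / \<epsilon>) \<mu>"
proof -
  have scale: "(\<lambda>v. v / k) ` {l<..<r} = {l / k<..<r / k}" if "k > 0" for k l r :: real
  proof
    show "{l / k<..<r / k} \<subseteq> (\<lambda>v. v / k) ` {l<..<r}"
    proof
      fix x assume "x \<in> {l / k<..<r / k}"
      with that have "k * x \<in> {l<..<r}" "x = k * x / k" by (auto simp: field_simps)
      then show "x \<in> (\<lambda>v. v / k) ` {l<..<r}" by blast
    qed
  qed (use that in \<open>auto simp: divide_strict_right_mono\<close>)
  have neg: "(\<lambda>v. v / - k) ` {l<..<r} = {- r / k<..<- l / k}" if "k > 0" for k l r :: real
  proof -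
    have "(\<lambda>v. v / - k) ` {l<..<r} = (\<lambda>v. v / k) ` uminus ` {l<..<r}"
      unfolding image_image by (rule image_cong) simp_all
    then show ?thesis by (simp only: image_uminus_greaterThanLessThan scale[OF that])
  qed
  have img: "glue ` ({k} \<times> B) = (\<lambda>v. v / k) ` B \<times> {1 / k}" for k B
    by (auto simp: glue_def)
  show "glue ` I_A \<epsilon> \<nu> = O_A (1 / \<epsilon>) \<mu>" "glue ` I_B \<epsilon> \<nu> = O_B (1 / \<epsilon>) \<mu>"
    using assms by (simp_all add: I_A_def I_B_def O_A_def O_B_def img scale)
  show "glue ` I_C \<epsilon> \<nu> = O_C (1 / \<epsilon>) \<mu>" "glue ` I_D \<epsilon> \<nu> = O_D (1 / \<epsilon>) \<mu>"
    using assms by (simp_all add: I_C_def I_D_def O_C_def O_D_def img neg minus_divide_right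
        del: divide_minus_right)
qed

text \<open>The part of the sphere around the first pole bounded by the cross sections. Its images under
  the group generated by \<open>Z\<close> and \<open>S\<close> meet each other only along cross sections.\<close>

definition cell :: "real \<Rightarrow> (real^3) set" where
  "cell \<epsilon> = {u \<in> S2. u$1 > 0 \<and> chart u \<in> {-\<epsilon>..\<epsilon>} \<times> {-1/\<epsilon>..1/\<epsilon>}}"

text \<open>A neighbourhood, between the cross sections, of the invariant axes in the linear model.\<close>

definition cross_nbhd :: "real \<Rightarrow> real \<Rightarrow> real \<Rightarrow> (real \<times> real) set" where
  "cross_nbhd \<epsilon> \<mu> \<nu> =
     ({-\<epsilon>..\<epsilon>} \<times> {-\<nu><..<\<nu>}) \<union> ({-\<mu><..<\<mu>} \<times> {-1/\<epsilon>..1/\<epsilon>})"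

text \<open>
  Topological equivalence with the linear system, by \<open>h\<close>, in a neighbourhood \<open>U\<close> of the
  heteroclinic connections around the first pole between the cross sections. The map \<open>h\<close> respects
  the cross sections and their identifications. The points \<open>(\<plusminus>\<epsilon>, 0)\<close>, where the stable manifold
  of the linear saddle meets the incoming sections, separate \<open>I_A\<close> from \<open>I_B\<close> and \<open>I_C\<close> from
  \<open>I_D\<close>; they are identified with \<open>(0, \<plusminus>1/\<epsilon>)\<close>.
\<close>

definition locally_linear ::
  "(real \<Rightarrow> real^3 \<Rightarrow> real^3) \<Rightarrow> real \<Rightarrow> real \<Rightarrow> real \<Rightarrow> real \<Rightarrow> real \<Rightarrow>
   (real^3) set \<Rightarrow> (real^3 \<Rightarrow> real \<times> real) \<Rightarrow> (real \<times> real \<Rightarrow> real^3) \<Rightarrow> bool" where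
  "locally_linear \<phi> \<alpha> d \<epsilon> \<mu> \<nu> U h h' \<longleftrightarrow>
     openin (top_of_set (cell \<epsilon>)) U \<and> network \<inter> cell \<epsilon> \<subseteq> U \<and> chart ` U \<subseteq> cross_nbhd \<epsilon> \<mu> \<nu> \<and>
     topologically_equivalent_via \<phi> U (lin_flow \<alpha> d) (cross_nbhd \<epsilon> \<mu> \<nu>) h h' \<and>
     h ` {u \<in> U. fst (chart u) = \<epsilon>} = I_A \<epsilon> \<nu> \<union> {(\<epsilon>, 0)} \<union> I_B \<epsilon> \<nu> \<and>
     h ` {u \<in> U. fst (chart u) = - \<epsilon>} = I_C \<epsilon> \<nu> \<union> {(- \<epsilon>, 0)} \<union> I_D \<epsilon> \<nu> \<and>
     h ` {u \<in> U. snd (chart u) = 1 / \<epsilon>} = O_A (1 / \<epsilon>) \<mu> \<union> {(0, 1 / \<epsilon>)} \<union> O_B (1 / \<epsilon>) \<mu> \<and>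
     h ` {u \<in> U. snd (chart u) = - 1 / \<epsilon>} = O_C (1 / \<epsilon>) \<mu> \<union> {(0, - 1 / \<epsilon>)} \<union> O_D (1 / \<epsilon>) \<mu> \<and>
     (\<forall>u\<in>U. fst (chart u) = \<epsilon> \<longrightarrow> Z u \<in> U \<and> h (Z u) = glue (h u)) \<and>
     (\<forall>u\<in>U. fst (chart u) = - \<epsilon> \<longrightarrow> S (Z u) \<in> U \<and> h (S (Z u)) = glue (h u))"

end

theory Submission
  imports Defs
begin

text \<open>
  Modulo the group generated by \<open>Z\<close> and \<open>S\<close>, the dynamics near the network is a succession of
  passages through one cell. In the linear coordinates an orbit that enters at
  \<open>(\<sigma> * \<epsilon>, \<sigma> * \<epsilon> * x)\<close> with \<open>\<sigma> = \<plusminus>1\<close> leaves at \<open>(x', \<sigma>' / \<epsilon>)\<close>, where \<open>\<sigma>' = \<sigma> * sgn x\<close> and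
  \<open>x' = d + (\<sigma> * \<epsilon> - d) * (\<epsilon>\<^sup>2 * \<bar>x\<bar>) powr \<alpha>\<close>, and the gluing turns the exit point into the entry point
  of the next cell with data \<open>(\<sigma>', x')\<close>.

  If \<open>\<alpha> > 1\<close>, then \<open>\<bar>x' - d\<bar> \<le> \<bar>x\<bar> / 4\<close>, so \<open>x\<close> eventually has the sign of \<open>d\<close>; thus \<open>\<sigma>\<close> becomes
  constant for \<open>d > 0\<close> and alternates for \<open>d < 0\<close>, and the contraction \<open>x \<mapsto> x'\<close> drives every orbit to a
  fixed point or a 2-cycle. If \<open>\<alpha> < 1\<close>, then \<open>\<bar>x\<bar> \<ge> \<bar>d\<bar>\<close> implies \<open>\<bar>x'\<bar> \<ge> 3 * \<bar>x\<bar>\<close>, so an orbit that stays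
  near the network has \<open>\<bar>x\<bar> < \<bar>d\<bar>\<close> throughout; this forces \<open>\<sigma> = - sgn d\<close> and \<open>x > 0\<close>, where the map
  is expanding and has a single fixed point. The transition with sign \<open>\<sigma>'\<close> lifts to \<open>\<sigma>' *\<^sub>R Z\<close> on the
  sphere: \<open>Z\<close> has order 3, \<open>S \<circ> Z\<close> order 6, and for alternating signs the cycle closes after 12
  transitions.
\<close>

section \<open>Flows of the projected field\<close>

text \<open>The hypothesis is purely topological: \<open>h\<close> carries orbit arcs inside
  \<open>U\<close> to arcs of the linear flow with an uncontrolled change of time, and
  \<open>U\<close> is open only relative to a closed cell. Hence stability cannot be read off a
  derivative of a return map. It is obtained from nested families of orbit tubes, and the
  contraction or expansion enters only through the scalar exit map. The cross-shaped domain of the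
  equivalence has corners at which linear orbits may leave it. Passages that enter with |x| < 2|d|
  turn the corner inside the domain once d is small relative to \<mu>, so the cycles can be built.
  Conversely, a periodic orbit in \<open>saturate U\<close> leaves \<open>U\<close> only through an
  outgoing section, because its first exit point still lies in the closed cell and therefore in
  \<open>U\<close>. Its itinerary is then a trajectory of the exit map, and completeness of the
  lists becomes a question about trajectories of a scalar map with two branches. For \<alpha> > 1
  such a trajectory merely converges to the expected cycle, and compactness of the orbit puts the
  limit on it; for \<alpha> < 1 expansion forces equality at once.\<close>

lemma gronwall_zero:
  fixes f f' :: "real \<Rightarrow> real"
  assumes der: "\<And>t. (f has_real_derivative f' t) (at t)"
    and bd: "\<And>t. \<bar>f' t\<bar> \<le> K * f t" and f0: "f 0 = 0" and nn: "\<And>t. 0 \<le> f t"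
  shows "f t = 0"
proof -
  \<comment> \<open>The bound on f' is two-sided, so one exponential weight settles positive times
    and the opposite weight negative times.\<close>
  have "f t * exp (- K * t) \<le> f 0 * exp (- K * 0)" if "0 \<le> t"
  proof (rule DERIV_nonpos_imp_nonincreasing[OF that])
    fix x
    have "((\<lambda>t. f t * exp (- K * t)) has_real_derivative (f' x - K * f x) * exp (- K * x)) (at x)"
      by (auto intro!: derivative_eq_intros der simp: algebra_simps)
    moreover have "(f' x - K * f x) * exp (- K * x) \<le> 0"
      using bd[of x] by (intro mult_nonpos_nonneg) auto
    ultimately show "\<exists>y. ((\<lambda>t. f t * exp (- K * t)) has_real_derivative y) (at x) \<and> y \<le> 0"
      by blast
  qed
  moreover have "f t * exp (K * t) \<le> f 0 * exp (K * 0)" if "t \<le> 0"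
  proof (rule DERIV_nonneg_imp_nondecreasing[OF that])
    fix x
    have "((\<lambda>t. f t * exp (K * t)) has_real_derivative (f' x + K * f x) * exp (K * x)) (at x)"
      by (auto intro!: derivative_eq_intros der simp: algebra_simps)
    moreover have "(f' x + K * f x) * exp (K * x) \<ge> 0"
      using bd[of x] by (intro mult_nonneg_nonneg) auto
    ultimately show "\<exists>y. ((\<lambda>t. f t * exp (K * t)) has_real_derivative y) (at x) \<and> 0 \<le> y"
      by blast
  qed
  ultimately have "f t * exp (K * t) \<le> 0 \<or> f t * exp (- K * t) \<le> 0"
    using f0 by (cases "t \<ge> 0") auto
  then have "f t \<le> 0"
    by (auto simp: mult_le_0_iff not_le)
  then show ?thesis using nn[of t] by simp
qed

text \<open>Gronwall is applied to the square of x, which is nonnegative and differentiable, with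
  time shifted so that the known zero sits at 0.\<close>

lemma linear_ode_zero:
  fixes x g :: "real \<Rightarrow> real"
  assumes der: "\<And>t. (x has_real_derivative x t * g t) (at t)"
    and bd: "\<And>t. \<bar>g t\<bar> \<le> K" and x0: "x t0 = 0"
  shows "x t = 0"
proof -
  have "(x (t0 + (t - t0)))\<^sup>2 = 0"
  proof (rule gronwall_zero[where f = "\<lambda>t. (x (t0 + t))\<^sup>2"
        and f' = "\<lambda>t. 2 * (x (t0 + t))\<^sup>2 * g (t0 + t)" and K = "2 * K"])
    fix t
    have "((\<lambda>t. x (t0 + t)) has_real_derivative x (t0 + t) * g (t0 + t)) (at t)"
      using DERIV_shift[of x _ t t0] der[of "t0 + t"] by (simp add: add.commute)
    then show "((\<lambda>t. (x (t0 + t))\<^sup>2) has_real_derivative 2 * (x (t0 + t))\<^sup>2 * g (t0 + t)) (at t)"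
      by (auto intro!: derivative_eq_intros simp: power2_eq_square)
    have "2 * (x (t0 + t))\<^sup>2 * \<bar>g (t0 + t)\<bar> \<le> 2 * (x (t0 + t))\<^sup>2 * K"
      by (intro mult_left_mono bd) auto
    then show "\<bar>2 * (x (t0 + t))\<^sup>2 * g (t0 + t)\<bar> \<le> 2 * K * (x (t0 + t))\<^sup>2"
      by (simp add: abs_mult algebra_simps)
  qed (use x0 in auto)
  then show ?thesis by simp
qed

text \<open>A change of sign would produce a zero by connectedness of the range, and a single zero
  forces x to vanish at all times, including t0.\<close>

lemma linear_ode_pos:
  fixes x g :: "real \<Rightarrow> real"
  assumes der: "\<And>t. (x has_real_derivative x t * g t) (at t)"
    and bd: "\<And>t. \<bar>g t\<bar> \<le> K" and x0: "x t0 > 0"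
  shows "x t > 0"
proof (rule ccontr)
  assume "\<not> x t > 0"
  have "continuous_on UNIV x"
    using der by (meson DERIV_isCont continuous_at_imp_continuous_on)
  then have "connected (x ` UNIV)" by (intro connected_continuous_image) auto
  then have "0 \<in> range x"
    using \<open>\<not> x t > 0\<close> x0 connectedD_interval[of "range x" "x t" "x t0" 0] by auto
  then obtain s where "x s = 0" by auto
  with linear_ode_zero[OF der bd this, of t0] x0 show False by simp
qed

text \<open>The bound is recorded next to the Lipschitz constant because the estimate for products
  needs it. The class is then closed under the ring operations, so it contains every component of
  the polynomial field.\<close>

definition Lip_S2 :: "(real^3 \<Rightarrow> real) \<Rightarrow> bool" where
  "Lip_S2 f \<longleftrightarrow> (\<exists>B\<ge>0. \<exists>L\<ge>0. (\<forall>u\<in>S2. \<bar>f u\<bar> \<le> B) \<and> (\<forall>u\<in>S2. \<forall>v\<in>S2. \<bar>f u - f v\<bar> \<le> L * norm (u - v)))"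

lemma Lip_S2_const: "Lip_S2 (\<lambda>u. k)"
  unfolding Lip_S2_def by (intro exI[of _ "\<bar>k\<bar>"] conjI exI[of _ 0]) auto

lemma Lip_S2_component: "Lip_S2 (\<lambda>u. u $ i)"
proof -
  have "\<bar>u $ i\<bar> \<le> 1" if "u \<in> S2" for u :: "real^3"
    using component_le_norm_cart[of u i] that by simp
  moreover have "\<bar>u $ i - v $ i\<bar> \<le> 1 * norm (u - v)" for u v :: "real^3"
    using component_le_norm_cart[of "u - v" i] by simp
  ultimately show ?thesis
    unfolding Lip_S2_def by (intro exI[of _ 1] conjI ballI) auto
qed

lemma Lip_S2_add: "Lip_S2 f \<Longrightarrow> Lip_S2 g \<Longrightarrow> Lip_S2 (\<lambda>u. f u + g u)"
proof -
  assume "Lip_S2 f" "Lip_S2 g"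
  then obtain B L B' L' where *: "B \<ge> 0" "L \<ge> 0" "B' \<ge> 0" "L' \<ge> 0" "\<And>u. u \<in> S2 \<Longrightarrow> \<bar>f u\<bar> \<le> B"
    "\<And>u v. u \<in> S2 \<Longrightarrow> v \<in> S2 \<Longrightarrow> \<bar>f u - f v\<bar> \<le> L * norm (u - v)" "\<And>u. u \<in> S2 \<Longrightarrow> \<bar>g u\<bar> \<le> B'"
    "\<And>u v. u \<in> S2 \<Longrightarrow> v \<in> S2 \<Longrightarrow> \<bar>g u - g v\<bar> \<le> L' * norm (u - v)"
    unfolding Lip_S2_def by metis
  have "\<bar>f u + g u\<bar> \<le> B + B'" if "u \<in> S2" for u using *(5,7)[OF that] by linarith
  moreover have "\<bar>f u + g u - (f v + g v)\<bar> \<le> (L + L') * norm (u - v)" if "u \<in> S2" "v \<in> S2" for u v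
    using *(6,8)[OF that] unfolding distrib_right by linarith
  ultimately show ?thesis unfolding Lip_S2_def using *(1-4) by (metis add_nonneg_nonneg)
qed

lemma Lip_S2_mult: "Lip_S2 f \<Longrightarrow> Lip_S2 g \<Longrightarrow> Lip_S2 (\<lambda>u. f u * g u)"
proof -
  assume "Lip_S2 f" "Lip_S2 g"
  then obtain B L B' L' where *: "B \<ge> 0" "L \<ge> 0" "B' \<ge> 0" "L' \<ge> 0" "\<And>u. u \<in> S2 \<Longrightarrow> \<bar>f u\<bar> \<le> B"
    "\<And>u v. u \<in> S2 \<Longrightarrow> v \<in> S2 \<Longrightarrow> \<bar>f u - f v\<bar> \<le> L * norm (u - v)" "\<And>u. u \<in> S2 \<Longrightarrow> \<bar>g u\<bar> \<le> B'"
    "\<And>u v. u \<in> S2 \<Longrightarrow> v \<in> S2 \<Longrightarrow> \<bar>g u - g v\<bar> \<le> L' * norm (u - v)"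
    unfolding Lip_S2_def by metis
  have "\<bar>f u * g u\<bar> \<le> B * B'" if "u \<in> S2" for u
    unfolding abs_mult using * that by (intro mult_mono) auto
  moreover have "\<bar>f u * g u - (f v * g v)\<bar> \<le> (B * L' + L * B') * norm (u - v)"
    if "u \<in> S2" "v \<in> S2" for u v
  proof -
    have "f u * g u - f v * g v = f u * (g u - g v) + (f u - f v) * g v"
      by (simp add: algebra_simps)
    then have "\<bar>f u * g u - f v * g v\<bar> \<le> \<bar>f u\<bar> * \<bar>g u - g v\<bar> + \<bar>f u - f v\<bar> * \<bar>g v\<bar>"
      by (metis abs_mult abs_triangle_ineq)
    also have "\<dots> \<le> B * (L' * norm (u - v)) + (L * norm (u - v)) * B'"
      using * that by (intro add_mono mult_mono) auto
    finally show ?thesis by (simp add: algebra_simps)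
  qed
  ultimately show ?thesis unfolding Lip_S2_def using *(1-4)
    by (metis add_nonneg_nonneg mult_nonneg_nonneg)
qed

lemma Lip_S2_uminus: "Lip_S2 f \<Longrightarrow> Lip_S2 (\<lambda>u. - f u)"
  using Lip_S2_mult[OF Lip_S2_const[of "-1"]] by simp

lemma Lip_S2_diff: "Lip_S2 f \<Longrightarrow> Lip_S2 g \<Longrightarrow> Lip_S2 (\<lambda>u. f u - g u)"
  using Lip_S2_add[OF _ Lip_S2_uminus] by simp

lemma Lip_S2_power: "Lip_S2 f \<Longrightarrow> Lip_S2 (\<lambda>u. f u ^ n)"
  by (induction n) (auto intro: Lip_S2_const Lip_S2_mult)

lemmas Lip_S2_intros = Lip_S2_const Lip_S2_component Lip_S2_add Lip_S2_diff Lip_S2_uminus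
  Lip_S2_mult Lip_S2_power

lemma inner_3: "(x::real^3) \<bullet> y = x$1 * y$1 + x$2 * y$2 + x$3 * y$3"
  by (simp add: inner_vec_def sum_3)

lemma PN_component:
  "PN b c d u $ 1 = q b c d (u$1) (u$3) - (QN b c d u \<bullet> u) * u$1"
  "PN b c d u $ 2 = q b c d (u$2) (u$1) - (QN b c d u \<bullet> u) * u$2"
  "PN b c d u $ 3 = q b c d (u$3) (u$2) - (QN b c d u \<bullet> u) * u$3"
  by (simp_all add: PN_def QN_def)

lemma QN_inner: "QN b c d u \<bullet> u =
    q b c d (u$1) (u$3) * u$1 + q b c d (u$2) (u$1) * u$2 + q b c d (u$3) (u$2) * u$3"
  by (simp add: inner_3 QN_def)

lemma Lip_S2_PN: "Lip_S2 (\<lambda>u. PN b c d u $ i)"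
proof -
  have "i = 1 \<or> i = 2 \<or> i = 3" by (rule exhaust_3)
  then show ?thesis
    by (elim disjE) (simp_all add: PN_component QN_inner q_def Lip_S2_intros)
qed

lemma PN_lipschitz:
  "\<exists>L\<ge>0. \<forall>u\<in>S2. \<forall>v\<in>S2. norm (PN b c d u - PN b c d v) \<le> L * norm (u - v)"
proof -
  have "\<forall>i. \<exists>L\<ge>0. \<forall>u\<in>S2. \<forall>v\<in>S2. \<bar>PN b c d u $ i - PN b c d v $ i\<bar> \<le> L * norm (u - v)"
    using Lip_S2_PN[of b c d] unfolding Lip_S2_def by blast
  then obtain L where L: "\<And>i. L i \<ge> 0"
    "\<And>i u v. u \<in> S2 \<Longrightarrow> v \<in> S2 \<Longrightarrow> \<bar>PN b c d u $ i - PN b c d v $ i\<bar> \<le> L i * norm (u - v)"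
    by metis
  have "norm (PN b c d u - PN b c d v) \<le> sum L UNIV * norm (u - v)" if "u \<in> S2" "v \<in> S2" for u v
  proof -
    have "norm (PN b c d u - PN b c d v) \<le> (\<Sum>i\<in>UNIV. \<bar>(PN b c d u - PN b c d v) $ i\<bar>)"
      by (rule norm_le_l1_cart)
    also have "\<dots> \<le> (\<Sum>i\<in>UNIV. L i * norm (u - v))"
      by (intro sum_mono) (use L(2)[OF that] in simp)
    finally show ?thesis by (simp add: sum_distrib_right)
  qed
  then show ?thesis
    by (intro exI[of _ "sum L UNIV"] conjI ballI sum_nonneg L(1)) auto
qed

text \<open>\<open>flow_of\<close> posits a flow but says nothing about uniqueness of solutions.
  Uniqueness is what makes the flow commute with the symmetries and fix the zeros of the field; it
  is Gronwall for the squared distance of two solutions.\<close>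

lemma PN_solution_unique:
  assumes x: "\<And>t. x t \<in> S2" "\<And>t. (x has_vector_derivative PN b c d (x t)) (at t)"
    and y: "\<And>t. y t \<in> S2" "\<And>t. (y has_vector_derivative PN b c d (y t)) (at t)"
    and eq: "x 0 = y 0"
  shows "x t = y t"
proof -
  obtain L where L: "L \<ge> 0"
    "\<And>u v. u \<in> S2 \<Longrightarrow> v \<in> S2 \<Longrightarrow> norm (PN b c d u - PN b c d v) \<le> L * norm (u - v)"
    using PN_lipschitz[of b c d] by blast
  define f where "f t = (x t - y t) \<bullet> (x t - y t)" for t
  define f' where "f' t = 2 * ((x t - y t) \<bullet> (PN b c d (x t) - PN b c d (y t)))" for t
  have "f t = 0"
  proof (rule gronwall_zero[where f = f and f' = f' and K = "2 * L"])
    fix t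
    have "((\<lambda>t. x t - y t) has_derivative (\<lambda>h. h *\<^sub>R (PN b c d (x t) - PN b c d (y t)))) (at t)"
      using has_vector_derivative_diff[OF x(2) y(2)] by (simp add: has_vector_derivative_def)
    from has_derivative_inner[OF this this]
    show "(f has_real_derivative f' t) (at t)"
      unfolding f_def f'_def has_field_derivative_def
      by (rule has_derivative_eq_rhs) (auto simp: fun_eq_iff inner_commute algebra_simps)
    have "\<bar>f' t\<bar> \<le> 2 * (norm (x t - y t) * norm (PN b c d (x t) - PN b c d (y t)))"
      unfolding f'_def using Cauchy_Schwarz_ineq2[of "x t - y t" "PN b c d (x t) - PN b c d (y t)"]
      by (simp add: abs_mult)
    also have "\<dots> \<le> 2 * (norm (x t - y t) * (L * norm (x t - y t)))"
      by (intro mult_left_mono L(2) x y) auto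
    also have "\<dots> = 2 * L * f t"
      by (simp add: f_def power2_norm_eq_inner[symmetric] power2_eq_square)
    finally show "\<bar>f' t\<bar> \<le> 2 * L * f t" .
  qed (auto simp: f_def eq)
  then show ?thesis by (simp add: f_def)
qed

text \<open>One formula for all six elements of the group generated by \<open>Z\<close> and
  \<open>S\<close>. The sign is a real number so that it multiplies directly with the signs \<sigma>
  of the sections, and the exponent counts modulo 3. Since \<open>Z\<close> has order 3 and \<tau>^2
  = 1, the inverse of \<open>act \<tau> k\<close> is \<open>act \<tau> (2 * k)\<close>, and natural
  exponents suffice.\<close>

definition act :: "real \<Rightarrow> nat \<Rightarrow> real^3 \<Rightarrow> real^3" where
  "act \<tau> k u = \<tau> *\<^sub>R (Z ^^ k) u"

lemma Z_nth [simp]: "Z u $ 1 = u $ 2" "Z u $ 2 = u $ 3" "Z u $ 3 = u $ 1"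
  by (simp_all add: Z_def)

lemma linear_Z: "linear Z"
  by (rule linearI) (simp_all add: vec_eq_iff forall_3)

lemma Z_scaleR: "Z (r *\<^sub>R u) = r *\<^sub>R Z u"
  by (rule linear_scale[OF linear_Z])

lemma Z_Z_Z: "Z (Z (Z u)) = u"
  by (simp add: vec_eq_iff forall_3)

lemma norm_Z [simp]: "norm (Z u) = norm u"
  by (simp add: norm_eq_sqrt_inner inner_3)

lemma dist_Z [simp]: "dist (Z u) (Z v) = dist u v"
  using norm_Z[of "u - v"] by (simp add: dist_norm linear_diff[OF linear_Z])

lemma linear_Z_funpow: "linear (Z ^^ k)"
  by (induction k) (auto simp: linear_id[unfolded id_def] id_def comp_def linear_Z
      intro: linear_compose[unfolded comp_def])

lemma Z_funpow_scaleR: "(Z ^^ k) (r *\<^sub>R u) = r *\<^sub>R (Z ^^ k) u"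
  by (rule linear_scale[OF linear_Z_funpow])

lemma Z_funpow_3: "(Z ^^ (k + 3)) u = (Z ^^ k) u"
  by (simp add: numeral_3_eq_3 funpow_swap1 Z_Z_Z)

lemma Z_funpow_mod: "(Z ^^ k) u = (Z ^^ (k mod 3)) u"
proof (induction k rule: less_induct)
  case (less k)
  show ?case
  proof (cases "k < 3")
    case False
    then have "(Z ^^ k) u = (Z ^^ (k - 3)) u" using Z_funpow_3[of "k - 3" u] by simp
    also have "\<dots> = (Z ^^ (k mod 3)) u" using less[of "k - 3"] False by (simp add: le_mod_geq)
    finally show ?thesis .
  qed simp
qed

lemma act_mod: "act \<tau> k = act \<tau> (k mod 3)"
  unfolding act_def by (subst Z_funpow_mod) simp

lemma act_act: "act \<tau> k (act \<sigma> j u) = act (\<tau> * \<sigma>) (k + j) u"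
  by (simp add: act_def Z_funpow_scaleR funpow_add)

lemma act_1_0 [simp]: "act 1 0 u = u"
  by (simp add: act_def)

lemma act_inverse: "\<bar>\<tau>\<bar> = 1 \<Longrightarrow> act \<tau> (2 * k) (act \<tau> k u) = u"
  by (simp only: act_act act_mod[of _ "2 * k + k"]) (simp add: act_def abs_if split: if_splits)

lemma act_inverse': "\<bar>\<tau>\<bar> = 1 \<Longrightarrow> act \<tau> k (act \<tau> (2 * k) u) = u"
  by (simp only: act_act act_mod[of _ "k + 2 * k"]) (simp add: act_def abs_if split: if_splits)

lemma unit_square [simp]: "\<bar>\<tau>\<bar> = 1 \<Longrightarrow> \<tau> * \<tau> = 1"
  for \<tau> :: real by (auto simp: abs_if split: if_splits)

lemma dist_Z_funpow: "dist ((Z ^^ k) u) ((Z ^^ k) v) = dist u v"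
  by (induction k) auto

lemma dist_act: "\<bar>\<tau>\<bar> = 1 \<Longrightarrow> dist (act \<tau> k u) (act \<tau> k v) = dist u v"
  using dist_Z_funpow[of k u v] by (simp add: act_def dist_norm flip: scaleR_diff_right)

lemma act_0: "act \<tau> k 0 = 0"
  by (simp add: act_def linear_0[OF linear_Z_funpow])

lemma act_S2: "\<bar>\<tau>\<bar> = 1 \<Longrightarrow> act \<tau> k u \<in> S2 \<longleftrightarrow> u \<in> S2"
  using dist_act[of \<tau> k 0 u] by (simp add: act_0)

lemma continuous_on_act: "continuous_on A (act \<tau> k)"
  unfolding act_def
  by (intro continuous_intros linear_continuous_on linear_conv_bounded_linear[THEN iffD1] linear_Z_funpow)

lemma saturate_act: "saturate U = (\<Union>k<3. \<Union>\<tau>\<in>{1,-1}. act \<tau> k ` U)"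
proof -
  have "act 1 k ` U = (Z ^^ k) ` U" "act (-1) k ` U = S ` (Z ^^ k) ` U" for k
    by (auto simp: act_def S_def image_image)
  then show ?thesis by (auto simp: saturate_def)
qed

lemma mem_saturate: "x \<in> saturate U \<longleftrightarrow> (\<exists>\<tau> k. \<bar>\<tau>\<bar> = 1 \<and> x \<in> act \<tau> k ` U)"
proof
  assume "\<exists>\<tau> k. \<bar>\<tau>\<bar> = 1 \<and> x \<in> act \<tau> k ` U"
  then obtain \<tau> k where "\<bar>\<tau>\<bar> = 1" "x \<in> act \<tau> (k mod 3) ` U" using act_mod by metis
  then show "x \<in> saturate U"
    unfolding saturate_act by (auto simp: abs_if split: if_splits intro!: bexI[of _ "k mod 3"])
next
  assume "x \<in> saturate U"
  then obtain k \<tau> where "\<tau> \<in> {1, -1}" "x \<in> act \<tau> k ` U" unfolding saturate_act by blast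
  then show "\<exists>\<tau> k. \<bar>\<tau>\<bar> = 1 \<and> x \<in> act \<tau> k ` U" by (intro exI[of _ \<tau>]) auto
qed

lemma PN_Z: "PN b c d (Z u) = Z (PN b c d u)"
  by (simp add: vec_eq_iff forall_3 PN_component QN_inner algebra_simps)

lemma PN_minus: "PN b c d (- u) = - PN b c d u"
  using QN_scaleR[of b c d "-1" u] by (simp add: PN_def)

lemma PN_act: "\<bar>\<tau>\<bar> = 1 \<Longrightarrow> PN b c d (act \<tau> k u) = act \<tau> k (PN b c d u)"
proof -
  have "PN b c d ((Z ^^ k) u) = (Z ^^ k) (PN b c d u)" by (induction k) (auto simp: PN_Z)
  then show "\<bar>\<tau>\<bar> = 1 \<Longrightarrow> ?thesis"
    by (auto simp: act_def PN_minus abs_if split: if_splits)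
qed

lemma linear_act: "linear (act \<tau> k)"
  unfolding act_def using linear_Z_funpow by (intro linear_compose_scale_right)

section \<open>Equivariance and continuity of the flow on the sphere\<close>

locale PN_flow =
  fixes b c d :: real and \<phi> :: "real \<Rightarrow> real^3 \<Rightarrow> real^3"
  assumes flow: "flow_of (PN b c d) S2 \<phi>"
begin

lemma flow_0 [simp]: "u \<in> S2 \<Longrightarrow> \<phi> 0 u = u"
  and flow_S2 [simp]: "u \<in> S2 \<Longrightarrow> \<phi> t u \<in> S2"
  and flow_add: "u \<in> S2 \<Longrightarrow> \<phi> (s + t) u = \<phi> s (\<phi> t u)"
  and flow_deriv: "u \<in> S2 \<Longrightarrow> ((\<lambda>t. \<phi> t u) has_vector_derivative PN b c d (\<phi> t u)) (at t)"
  and flow_cont: "continuous_on (UNIV \<times> S2) (\<lambda>(t, u). \<phi> t u)"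
  using flow unfolding flow_of_def by blast+

lemma flow_norm [simp]: "norm u = 1 \<Longrightarrow> norm (\<phi> t u) = 1"
  using flow_S2[of u t] by simp

lemma flow_neg [simp]: "u \<in> S2 \<Longrightarrow> \<phi> (- t) (\<phi> t u) = u" "u \<in> S2 \<Longrightarrow> \<phi> t (\<phi> (- t) u) = u"
  using flow_add[of u "- t" t] flow_add[of u t "- t"] by simp_all

lemma flow_cont_compose:
  assumes "continuous_on A f" "continuous_on A g" "g ` A \<subseteq> S2"
  shows "continuous_on A (\<lambda>x. \<phi> (f x) (g x))"
proof -
  have "continuous_on A (\<lambda>x. (f x, g x))" using assms by (intro continuous_intros)
  moreover have "(\<lambda>x. (f x, g x)) ` A \<subseteq> UNIV \<times> S2" using assms(3) by blast
  ultimately show ?thesis using continuous_on_compose2[OF flow_cont] by fastforce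
qed

lemma flow_cont_time: "u \<in> S2 \<Longrightarrow> continuous_on A (\<lambda>t. \<phi> t u)"
  by (rule flow_cont_compose) (auto intro: continuous_intros)

lemma flow_component_deriv:
  "u \<in> S2 \<Longrightarrow> ((\<lambda>t. \<phi> t u $ i) has_real_derivative PN b c d (\<phi> t u) $ i) (at t)"
  using bounded_linear.has_vector_derivative[OF bounded_linear_vec_nth flow_deriv]
  by (simp add: has_real_derivative_iff_has_vector_derivative)

text \<open>Both sides solve the same initial value problem, so uniqueness turns equivariance of the
  field into equivariance of the flow.\<close>

lemma flow_act:
  assumes "\<bar>\<tau>\<bar> = 1" "u \<in> S2"
  shows "\<phi> t (act \<tau> k u) = act \<tau> k (\<phi> t u)"
proof (rule PN_solution_unique[of "\<lambda>t. \<phi> t (act \<tau> k u)" b c d "\<lambda>t. act \<tau> k (\<phi> t u)"])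
  fix t
  have "bounded_linear (act \<tau> k)" using linear_act linear_conv_bounded_linear by blast
  from bounded_linear.has_vector_derivative[OF this flow_deriv[OF assms(2)]]
  show "((\<lambda>t. act \<tau> k (\<phi> t u)) has_vector_derivative PN b c d (act \<tau> k (\<phi> t u))) (at t)"
    by (simp add: PN_act assms(1))
  show "((\<lambda>t. \<phi> t (act \<tau> k u)) has_vector_derivative PN b c d (\<phi> t (act \<tau> k u))) (at t)"
    by (intro flow_deriv) (use assms act_S2 in blast)
qed (use assms in \<open>simp_all only: act_S2 flow_S2 flow_0\<close>)

lemma orbit_mem_S2: "u \<in> S2 \<Longrightarrow> v \<in> orbit \<phi> u \<Longrightarrow> v \<in> S2"
  by (auto simp: orbit_def)

lemma orbit_self: "u \<in> S2 \<Longrightarrow> u \<in> orbit \<phi> u"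
  unfolding orbit_def using flow_0 by (metis rangeI)

lemma orbit_flow: "u \<in> S2 \<Longrightarrow> v \<in> orbit \<phi> u \<Longrightarrow> \<phi> t v \<in> orbit \<phi> u"
  unfolding orbit_def by (auto simp: flow_add[symmetric])

lemma orbit_eq: "u \<in> S2 \<Longrightarrow> v \<in> orbit \<phi> u \<Longrightarrow> orbit \<phi> v = orbit \<phi> u"
proof -
  assume u: "u \<in> S2" and "v \<in> orbit \<phi> u"
  then obtain s where v: "v = \<phi> s u" by (auto simp: orbit_def)
  have "\<phi> t u = \<phi> (t - s) v" for t unfolding v using flow_add[OF u, of "t - s" s] by simp
  then show ?thesis using orbit_flow[OF u \<open>v \<in> orbit \<phi> u\<close>] by (auto simp: orbit_def)
qed

lemma orbit_act: "\<bar>\<tau>\<bar> = 1 \<Longrightarrow> u \<in> S2 \<Longrightarrow> orbit \<phi> (act \<tau> k u) = act \<tau> k ` orbit \<phi> u"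
  by (auto simp: orbit_def flow_act image_image)

text \<open>Continuous dependence on the starting point, uniform over a compact set of times. The
  times may be negative, so the result also serves the reversed flow.\<close>

lemma flow_tube:
  assumes u: "u \<in> S2" and K: "compact K" and V: "openin (top_of_set S2) V" and sub: "\<And>t. t \<in> K \<Longrightarrow> \<phi> t u \<in> V"
  obtains O' where "openin (top_of_set S2) O'" "u \<in> O'" "\<And>v t. v \<in> O' \<Longrightarrow> t \<in> K \<Longrightarrow> \<phi> t v \<in> V"
proof -
  obtain W where W: "open W" "V = S2 \<inter> W" using V by (auto simp: openin_open)
  have "compact ((\<lambda>t. \<phi> t u) ` K)" by (intro compact_continuous_image flow_cont_time u K)
  moreover have "(\<lambda>t. \<phi> t u) ` K \<subseteq> W" using sub W by auto
  ultimately obtain e where e: "e > 0" "(\<Union>x\<in>(\<lambda>t. \<phi> t u) ` K. ball x e) \<subseteq> W"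
    using compact_subset_open_imp_ball_epsilon_subset W(1) by blast
  have "continuous_on (S2 \<times> K) (\<lambda>(v, t). \<phi> t v)"
    unfolding case_prod_unfold
  proof (rule flow_cont_compose)
    show "continuous_on (S2 \<times> K) fst" "continuous_on (S2 \<times> K) snd"
      by (rule continuous_on_fst[OF continuous_on_id] continuous_on_snd[OF continuous_on_id])+
    show "fst ` (S2 \<times> K) \<subseteq> S2" by force
  qed
  then obtain X0 where X0: "u \<in> X0" "open X0" "\<forall>v\<in>X0 \<inter> S2. \<forall>t\<in>K. dist (\<phi> t v) (\<phi> t u) \<le> e/2"
    by (rule continuous_on_prod_compactE[OF _ K u, of _ "e/2"]) (use e(1) in auto)
  show thesis
  proof
    show "openin (top_of_set S2) (S2 \<inter> X0)" using X0 by auto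
    show "u \<in> S2 \<inter> X0" using X0 u by auto
    fix v t assume "v \<in> S2 \<inter> X0" "t \<in> K"
    then have "\<phi> t v \<in> ball (\<phi> t u) e" using X0(3) e(1) by (force simp: dist_commute)
    then have "\<phi> t v \<in> W" using e(2) \<open>t \<in> K\<close> by blast
    then show "\<phi> t v \<in> V" using W \<open>v \<in> S2 \<inter> X0\<close> flow_S2[of v t] by blast
  qed
qed

end

section \<open>The heteroclinic network\<close>

text \<open>The quadratic form on the right is positive definite because its discriminant is the
  negative number in the hypothesis. The constant \<kappa> is determinant over trace of its matrix,
  a lower bound for the smaller eigenvalue.\<close>

lemma discriminant_negative_form:
  fixes b c :: real
  assumes "b\<^sup>2 + 4 * (c + 1) < 0"
  obtains \<kappa> where "\<kappa> > 0" "\<And>x y. \<kappa> * (x\<^sup>2 + y\<^sup>2) \<le> y\<^sup>2 - b * x * y - (c + 1) * x\<^sup>2"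
proof -
  define \<kappa> where "\<kappa> = - (b\<^sup>2 + 4 * (c + 1)) / (4 * (1 - (c + 1)))"
  have c: "c + 1 < 0" using assms by (smt (verit) zero_le_power2)
  then have pos: "\<kappa> > 0" unfolding \<kappa>_def using assms by (intro divide_pos_pos) auto
  have k4: "\<kappa> * (4 * (1 - (c + 1))) = - (b\<^sup>2 + 4 * (c + 1))"
    unfolding \<kappa>_def using c by simp
  have k1: "\<kappa> < 1"
  proof -
    have "- (b\<^sup>2 + 4 * (c + 1)) < 4 * (1 - (c + 1))" 
      using zero_le_power2[of b] by (simp add: algebra_simps) (smt (verit) zero_le_power2)
    then show ?thesis unfolding \<kappa>_def using c by (subst divide_less_eq_1_pos) auto
  qed
  have "\<kappa> * (x\<^sup>2 + y\<^sup>2) \<le> y\<^sup>2 - b * x * y - (c + 1) * x\<^sup>2" for x y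
  proof -
    \<comment> \<open>Completing the square in y. The choice of \<kappa> makes the remaining
      coefficient of x^2 vanish, and \<kappa> < 1 permits division by 1 - \<kappa> at the
      end.\<close>
    have "0 \<le> (2 * (1 - \<kappa>) * y - b * x)\<^sup>2 + 4 * \<kappa>\<^sup>2 * x\<^sup>2" by simp
    also have "\<dots> = 4 * (1 - \<kappa>) * (y\<^sup>2 - b * x * y - (c + 1) * x\<^sup>2 - \<kappa> * (x\<^sup>2 + y\<^sup>2))
      + (b\<^sup>2 + 4 * (c + 1) + \<kappa> * (4 * (1 - (c + 1)))) * x\<^sup>2"
      by (simp add: algebra_simps power2_eq_square)
    also have "\<dots> = 4 * (1 - \<kappa>) * (y\<^sup>2 - b * x * y - (c + 1) * x\<^sup>2 - \<kappa> * (x\<^sup>2 + y\<^sup>2))"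
      using k4 by simp
    finally show ?thesis using k1 by (simp add: zero_le_mult_iff)
  qed
  with pos show thesis using that by blast
qed

lemma four_3: "(4 :: 3) = 1"
  by simp

locale PN_flow_zero = PN_flow b c 0 \<phi> for b c \<phi> +
  assumes disc: "b\<^sup>2 + 4 * (c + 1) < 0"
begin

text \<open>For d = 0 the polynomial \<open>q\<close> is divisible by its first argument, so each
  component solves a linear homogeneous equation whose coefficient is bounded along the orbit.
  Consequently the coordinate planes are invariant and no component changes sign.\<close>

lemma zero_component_ode:
  assumes "u \<in> S2"
  shows "\<exists>g K. (\<forall>t. ((\<lambda>t. \<phi> t u $ i) has_real_derivative \<phi> t u $ i * g t) (at t)) \<and> (\<forall>t. \<bar>g t\<bar> \<le> K)"
proof -
  define G where "G i v = (if i = 1 then - (v$1)\<^sup>2 + b * v$1 * v$3 + c * (v$3)\<^sup>2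
      else if i = 2 then - (v$2)\<^sup>2 + b * v$2 * v$1 + c * (v$1)\<^sup>2
      else - (v$3)\<^sup>2 + b * v$3 * v$2 + c * (v$2)\<^sup>2) - QN b c 0 v \<bullet> v" for i :: 3 and v :: "real^3"
  have "i = 1 \<or> i = 2 \<or> i = 3" by (rule exhaust_3)
  then have eq: "PN b c 0 v $ i = v $ i * G i v" for v
    by (elim disjE) (simp_all add: PN_component G_def q_def algebra_simps power2_eq_square power3_eq_cube)
  have "Lip_S2 (\<lambda>v. G i v)"
    using \<open>i = 1 \<or> i = 2 \<or> i = 3\<close> by (elim disjE) (simp_all add: G_def QN_inner q_def Lip_S2_intros)
  then obtain K where "\<And>v. v \<in> S2 \<Longrightarrow> \<bar>G i v\<bar> \<le> K" unfolding Lip_S2_def by blast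
  then show ?thesis
    using flow_component_deriv[OF assms, of i] assms
    by (intro exI[of _ "\<lambda>t. G i (\<phi> t u)"] exI[of _ K]) (auto simp: eq)
qed

lemma zero_component_invariant:
  assumes "u \<in> S2" "u $ i = 0" shows "\<phi> t u $ i = 0"
proof -
  obtain g K where "\<And>t. ((\<lambda>t. \<phi> t u $ i) has_real_derivative \<phi> t u $ i * g t) (at t)" "\<And>t. \<bar>g t\<bar> \<le> K"
    using zero_component_ode[OF assms(1)] by blast
  then show ?thesis
    by (rule linear_ode_zero[of "\<lambda>t. \<phi> t u $ i" g K 0 t]) (use assms flow_0 in auto)
qed

lemma zero_component_pos:
  assumes "u \<in> S2" "u $ i > 0" shows "\<phi> t u $ i > 0"
proof -
  obtain g K where "\<And>t. ((\<lambda>t. \<phi> t u $ i) has_real_derivative \<phi> t u $ i * g t) (at t)" "\<And>t. \<bar>g t\<bar> \<le> K"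
    using zero_component_ode[OF assms(1)] by blast
  then show ?thesis
    by (rule linear_ode_pos[of "\<lambda>t. \<phi> t u $ i" g K 0 t]) (use assms flow_0 in auto)
qed

lemma zero_component_neg: "u \<in> S2 \<Longrightarrow> u $ i < 0 \<Longrightarrow> \<phi> t u $ i < 0"
  using zero_component_pos[of "act (-1) 0 u" i t] act_S2[of "-1" 0 u] flow_act[of "-1" u t 0]
  by (simp add: act_def)

lemma zero_component_sgn: "u \<in> S2 \<Longrightarrow> sgn (\<phi> t u $ i) = sgn (u $ i)"
  using zero_component_invariant[of u i t] zero_component_pos[of u i t] zero_component_neg[of u i t]
  by (cases "u $ i" "0::real" rule: linorder_cases) auto

text \<open>On the invariant quarter circle the slope p = |u2| / |u1| satisfies p' = - p N, where N
  is the positive definite form evaluated on the unit circle. So p decreases from infinity to 0,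
  which yields both limits and shows that the arc is a single orbit.\<close>

lemma connection_in_plane:
  assumes s: "s \<in> {1, -1}" and s': "s' \<in> {1, -1}"
  shows "heteroclinic_connection \<phi> (s *\<^sub>R e 2) (s' *\<^sub>R e 1) (quarter_circle (s *\<^sub>R e 2) (s' *\<^sub>R e 1))"
proof -
  have e: "e 1 $ 1 = 1" "e 1 $ 2 = 0" "e 1 $ 3 = 0" "e 2 $ 1 = 0" "e 2 $ 2 = 1" "e 2 $ 3 = 0"
    by (simp_all add: e_def axis_def)
  have norm3: "(norm x)\<^sup>2 = (x$1)\<^sup>2 + (x$2)\<^sup>2 + (x$3)\<^sup>2" for x :: "real^3"
    unfolding power2_norm_eq_inner inner_3 by (simp add: power2_eq_square)
  have S2: "x \<in> S2 \<longleftrightarrow> (x$1)\<^sup>2 + (x$2)\<^sup>2 + (x$3)\<^sup>2 = 1" for x :: "real^3"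
    unfolding norm3[symmetric] by (simp add: abs_square_eq_1)
  have ss: "s * s = 1" "s' * s' = 1" "\<bar>s\<bar> = 1" "\<bar>s'\<bar> = 1" using s s' by auto
  define QC where "QC = quarter_circle (s *\<^sub>R e 2) (s' *\<^sub>R e 1)"
  have QC: "x \<in> QC \<longleftrightarrow> x \<in> S2 \<and> x$3 = 0 \<and> s * x$2 > 0 \<and> s' * x$1 > 0" for x
  proof
    assume "x \<in> QC"
    then show "x \<in> S2 \<and> x$3 = 0 \<and> s * x$2 > 0 \<and> s' * x$1 > 0"
      using s s' unfolding QC_def quarter_circle_def by (auto simp: e)
  next
    assume *: "x \<in> S2 \<and> x$3 = 0 \<and> s * x$2 > 0 \<and> s' * x$1 > 0"
    then have "x = (s * x$2) *\<^sub>R (s *\<^sub>R e 2) + (s' * x$1) *\<^sub>R (s' *\<^sub>R e 1)"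
      using ss by (simp add: vec_eq_iff forall_3 e algebra_simps)
    with * show "x \<in> QC" unfolding QC_def quarter_circle_def by blast
  qed
  define u where "u = ((1 / sqrt 2) *\<^sub>R (s *\<^sub>R e 2 + s' *\<^sub>R e 1))"
  have u: "u \<in> QC"
    unfolding QC S2 using ss by (auto simp: u_def e power_mult_distrib power_divide power2_eq_square)
  then have uS: "u \<in> S2" using QC by blast
  have inQC: "\<phi> t u \<in> QC" for t
    using u zero_component_sgn[OF uS, of t 1] zero_component_sgn[OF uS, of t 2]
      zero_component_sgn[OF uS, of t 3] flow_S2[OF uS, of t] s s'
    unfolding QC by (auto simp: sgn_if split: if_splits)
  define N where "N v = (v$2)\<^sup>2 - b * v$1 * v$2 - (c + 1) * (v$1)\<^sup>2" for v :: "real^3"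
  obtain \<kappa> where \<kappa>: "\<kappa> > 0" "\<And>x y. \<kappa> * (x\<^sup>2 + y\<^sup>2) \<le> y\<^sup>2 - b * x * y - (c + 1) * x\<^sup>2"
    using discriminant_negative_form[OF disc] by blast
  have N: "N v \<ge> \<kappa>" if "v \<in> QC" for v
  proof -
    have "(v$1)\<^sup>2 + (v$2)\<^sup>2 = 1" using that unfolding QC S2 by auto
    then show ?thesis using \<kappa>(2)[of "v$1" "v$2"] by (simp add: N_def)
  qed
  define p where "p t = (s * \<phi> t u $ 2) / (s' * \<phi> t u $ 1)" for t
  have p0: "p t > 0" for t using inQC[of t] unfolding p_def QC by simp
  have dp: "(p has_real_derivative - (p t * N (\<phi> t u))) (at t)" for t
  proof -
    define v where "v = \<phi> t u"
    have v: "v$3 = 0" "(v$1)\<^sup>2 + (v$2)\<^sup>2 = 1" "v$1 \<noteq> 0" "v \<in> QC"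
      using inQC[of t] unfolding v_def QC S2 by auto
    have "(p has_real_derivative ((s * PN b c 0 v $ 2) * (s' * v $ 1) - (s * v $ 2) * (s' * PN b c 0 v $ 1))
        / ((s' * v $ 1) * (s' * v $ 1))) (at t)"
      unfolding p_def v_def using v(3) s'
      by (intro DERIV_divide DERIV_cmult flow_component_deriv uS) (auto simp: v_def)
    moreover have "((s * PN b c 0 v $ 2) * (s' * v $ 1) - (s * v $ 2) * (s' * PN b c 0 v $ 1))
        / ((s' * v $ 1) * (s' * v $ 1)) = - (p t * N v)"
    proof -
      have A: "q b c 0 (v$2) (v$1) * v$1 - v$2 * q b c 0 (v$1) (v$3) = - (v$1 * v$2) * N v"
        by (simp add: q_def N_def v(1) algebra_simps power2_eq_square power3_eq_cube)
      \<comment> \<open>The radial part of the projected field cancels in the derivative of a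
        quotient of components.\<close>
      have B: "(s * PN b c 0 v $ 2) * (s' * v $ 1) - (s * v $ 2) * (s' * PN b c 0 v $ 1)
          = (s * s') * (q b c 0 (v$2) (v$1) * v$1 - v$2 * q b c 0 (v$1) (v$3))"
        unfolding PN_component by (simp add: algebra_simps)
      have C: "(s * PN b c 0 v $ 2) * (s' * v $ 1) - (s * v $ 2) * (s' * PN b c 0 v $ 1)
          = - (s * v $ 2) * (s' * v $ 1) * N v"
        unfolding B A by simp
      show ?thesis unfolding C p_def v_def[symmetric] using v(3) s' by (auto simp: divide_simps)
    qed
    ultimately show ?thesis by (simp add: v_def)
  qed
  \<comment> \<open>One monotone quantity serves both ends: it bounds p from above for positive
    times and from below for negative times.\<close>
  have mono: "p y * exp (\<kappa> * y) \<le> p x * exp (\<kappa> * x)" if "x \<le> y" for x y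
  proof (rule DERIV_nonpos_imp_nonincreasing[OF that])
    fix t
    have "((\<lambda>t. p t * exp (\<kappa> * t)) has_real_derivative p t * (\<kappa> - N (\<phi> t u)) * exp (\<kappa> * t)) (at t)"
      by (auto intro!: derivative_eq_intros dp simp: algebra_simps)
    moreover have "p t * (\<kappa> - N (\<phi> t u)) * exp (\<kappa> * t) \<le> 0"
      using p0[of t] N[OF inQC[of t]] by (intro mult_nonpos_nonneg mult_nonneg_nonpos) auto
    ultimately show "\<exists>y. ((\<lambda>t. p t * exp (\<kappa> * t)) has_real_derivative y) (at t) \<and> y \<le> 0" by blast
  qed
  have pt: "p t \<le> p 0 * exp (- \<kappa> * t)" if "t \<ge> 0" for t
    using mono[OF that] by (simp add: exp_minus field_simps)
  have pb: "p t \<ge> p 0 * exp (- \<kappa> * t)" if "t \<le> 0" for t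
    using mono[OF that] by (simp add: exp_minus field_simps)
  have lim0: "(p \<longlongrightarrow> 0) at_top"
  proof (rule tendsto_sandwich[of "\<lambda>_. 0"])
    show "((\<lambda>t. p 0 * exp (- \<kappa> * t)) \<longlongrightarrow> 0) at_top"
    proof -
      have "filterlim (\<lambda>t. \<kappa> * t) at_top at_top"
        using \<kappa>(1) by (intro filterlim_tendsto_pos_mult_at_top[OF tendsto_const]) (auto simp: filterlim_ident)
      then have "((\<lambda>t. exp (- (\<kappa> * t))) \<longlongrightarrow> 0) at_top"
        by (intro filterlim_compose[OF exp_at_bot]) (simp add: filterlim_uminus_at_top)
      then show ?thesis by (auto intro: tendsto_mult_right_zero)
    qed
    show "\<forall>\<^sub>F t in at_top. 0 \<le> p t" using p0 by (simp add: less_imp_le)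
    show "\<forall>\<^sub>F t in at_top. p t \<le> p 0 * exp (- \<kappa> * t)"
      using eventually_ge_at_top[of 0] by eventually_elim (rule pt)
  qed simp
  have limi: "filterlim p at_top at_bot"
  proof (rule filterlim_at_top_mono)
    have "filterlim (\<lambda>t. \<kappa> * t) at_bot at_bot"
      using \<kappa>(1) by (intro filterlim_tendsto_pos_mult_at_bot[OF tendsto_const]) (auto simp: filterlim_ident)
    then have "filterlim (\<lambda>t. exp (- (\<kappa> * t))) at_top at_bot"
      by (intro filterlim_compose[OF exp_at_top]) (simp add: filterlim_uminus_at_bot)
    then show "filterlim (\<lambda>t. p 0 * exp (- \<kappa> * t)) at_top at_bot"
      using p0[of 0] by (auto intro: filterlim_tendsto_pos_mult_at_top)
    show "eventually (\<lambda>t. p 0 * exp (- \<kappa> * t) \<le> p t) at_bot"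
      using eventually_le_at_bot[of 0] by eventually_elim (rule pb)
  qed
  have form: "x = (1 / sqrt (1 + r\<^sup>2)) *\<^sub>R (s' *\<^sub>R e 1) + (r / sqrt (1 + r\<^sup>2)) *\<^sub>R (s *\<^sub>R e 2)"
    if "x \<in> QC" "r = (s * x$2) / (s' * x$1)" for x r
  proof -
    have x: "x$3 = 0" "(x$1)\<^sup>2 + (x$2)\<^sup>2 = 1" "s' * x$1 > 0" using that(1) unfolding QC S2 by auto
    have "(s * x$2)\<^sup>2 = (x$2)\<^sup>2" "(s' * x$1)\<^sup>2 = (x$1)\<^sup>2" using ss by (simp_all add: power_mult_distrib power2_eq_square)
    then have "1 + r\<^sup>2 = 1 / (s' * x$1)\<^sup>2"
      using x(2,3) unfolding that(2) power_divide by (auto simp: divide_simps)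
    then have sq: "sqrt (1 + r\<^sup>2) = 1 / (s' * x$1)"
      using x(3) by (simp add: real_sqrt_divide)
    then have "1 / sqrt (1 + r\<^sup>2) = s' * x$1" "r / sqrt (1 + r\<^sup>2) = s * x$2"
      using x(3) that(2) by auto
    then show ?thesis using ss x(1) by (simp add: vec_eq_iff forall_3 e algebra_simps)
  qed
  have phi: "\<phi> t u = (1 / sqrt (1 + (p t)\<^sup>2)) *\<^sub>R (s' *\<^sub>R e 1) + (p t / sqrt (1 + (p t)\<^sup>2)) *\<^sub>R (s *\<^sub>R e 2)" for t
    by (rule form[OF inQC]) (simp add: p_def)
  have top: "((\<lambda>t. \<phi> t u) \<longlongrightarrow> s' *\<^sub>R e 1) at_top"
  proof -
    have "((\<lambda>t. \<phi> t u) \<longlongrightarrow> (1 / sqrt (1 + 0\<^sup>2)) *\<^sub>R (s' *\<^sub>R e 1) + (0 / sqrt (1 + 0\<^sup>2)) *\<^sub>R (s *\<^sub>R e 2)) at_top"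
      unfolding phi by (intro tendsto_intros lim0) auto
    then show ?thesis by simp
  qed
  have bot: "((\<lambda>t. \<phi> t u) \<longlongrightarrow> s *\<^sub>R e 2) at_bot"
  proof -
    \<comment> \<open>Backwards in time p tends to infinity, so the limit is taken in the reciprocal
      slope.\<close>
    define w where "w t = inverse (p t)" for t
    have w0: "(w \<longlongrightarrow> 0) at_bot"
      unfolding w_def using limi by (intro tendsto_inverse_0_at_top) 
    have "1 / sqrt (1 + (p t)\<^sup>2) = w t / sqrt (1 + (w t)\<^sup>2)" "p t / sqrt (1 + (p t)\<^sup>2) = 1 / sqrt (1 + (w t)\<^sup>2)" for t
    proof -
      have "1 + (w t)\<^sup>2 = (1 + (p t)\<^sup>2) / (p t)\<^sup>2" using p0[of t] by (simp add: w_def field_simps)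
      then have "sqrt (1 + (w t)\<^sup>2) = sqrt (1 + (p t)\<^sup>2) / p t" using p0[of t] by (simp add: real_sqrt_divide)
      from this[symmetric] show "1 / sqrt (1 + (p t)\<^sup>2) = w t / sqrt (1 + (w t)\<^sup>2)" "p t / sqrt (1 + (p t)\<^sup>2) = 1 / sqrt (1 + (w t)\<^sup>2)"
        unfolding \<open>sqrt (1 + (w t)\<^sup>2) = sqrt (1 + (p t)\<^sup>2) / p t\<close> using p0[of t] by (simp_all add: w_def)
    qed
    note w = this
    have "((\<lambda>t. \<phi> t u) \<longlongrightarrow> (0 / sqrt (1 + 0\<^sup>2)) *\<^sub>R (s' *\<^sub>R e 1) + (1 / sqrt (1 + 0\<^sup>2)) *\<^sub>R (s *\<^sub>R e 2)) at_bot"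
      unfolding phi w by (intro tendsto_intros w0) auto
    then show ?thesis by simp
  qed
  have "QC = orbit \<phi> u"
  proof
    show "orbit \<phi> u \<subseteq> QC" using inQC by (auto simp: orbit_def)
    \<comment> \<open>The slope determines the point of the arc, and along the orbit it takes every
      positive value by the intermediate value theorem.\<close>
    show "QC \<subseteq> orbit \<phi> u"
    proof
      fix x assume x: "x \<in> QC"
      define r where "r = (s * x$2) / (s' * x$1)"
      have r: "r > 0" using x unfolding r_def QC by simp
      have "continuous_on UNIV p" using dp by (meson DERIV_isCont continuous_at_imp_continuous_on)
      then have conn: "connected (range p)" by (intro connected_continuous_image) auto
      obtain t1 where "p t1 < r"
        using order_tendstoD(2)[OF lim0 r] by (auto simp: eventually_at_top_linorder)
      moreover obtain t2 where "p t2 \<ge> r"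
        using limi unfolding filterlim_at_top eventually_at_bot_linorder by blast
      ultimately have "r \<in> range p" using connectedD_interval[OF conn, of "p t1" "p t2" r] by auto
      then obtain t where "r = p t" by blast
      then have "x = \<phi> t u" using form[OF x r_def] phi[of t] by simp
      then show "x \<in> orbit \<phi> u" by (auto simp: orbit_def)
    qed
  qed
  moreover have "\<phi> t v = v" if "v = s *\<^sub>R e 2 \<or> v = s' *\<^sub>R e 1" for v t
  proof (rule sym, rule PN_solution_unique[of "\<lambda>_. v" b c 0 "\<lambda>t. \<phi> t v"])
    have vS: "v \<in> S2" using that ss unfolding S2 by (auto simp: e power2_eq_square)
    then show "v \<in> S2" "\<phi> t v \<in> S2" "((\<lambda>t. \<phi> t v) has_vector_derivative PN b c 0 (\<phi> t v)) (at t)" "v = \<phi> 0 v" for t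
      by (simp_all add: flow_deriv)
    have "PN b c 0 v = 0"
      using that ss by (auto simp: vec_eq_iff forall_3 PN_component QN_inner q_def e power3_eq_cube)
    then show "((\<lambda>_. v) has_vector_derivative PN b c 0 v) (at t)" for t by simp
  qed
  moreover have "s *\<^sub>R e 2 \<in> S2" "s' *\<^sub>R e 1 \<in> S2" using ss unfolding S2 by (auto simp: e power2_eq_square)
  ultimately show ?thesis
    unfolding heteroclinic_connection_def QC_def[symmetric] using uS top bot by blast
qed

text \<open>Transports the computation made in the plane of \<open>e 1\<close> and
  \<open>e 2\<close> to the other two coordinate planes.\<close>

lemma connection_Z:
  assumes "heteroclinic_connection \<phi> p p' \<gamma>"
  shows "heteroclinic_connection \<phi> (Z p) (Z p') (Z ` \<gamma>)"
proof -
  have Z: "Z v = act 1 1 v" for v by (simp add: act_def)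
  have Zf: "\<phi> t (Z v) = Z (\<phi> t v)" if "v \<in> S2" for t v using flow_act[of 1 v t 1] that by (simp add: Z)
  have cZ: "isCont Z v" for v
    using linear_Z linear_conv_bounded_linear linear_continuous_at by blast
  obtain u where u: "u \<in> S2" "\<gamma> = orbit \<phi> u" "((\<lambda>t. \<phi> t u) \<longlongrightarrow> p) at_bot" "((\<lambda>t. \<phi> t u) \<longlongrightarrow> p') at_top"
    using assms unfolding heteroclinic_connection_def by blast
  have "p \<in> S2" "p' \<in> S2" "\<forall>t. \<phi> t p = p" "\<forall>t. \<phi> t p' = p'"
    using assms unfolding heteroclinic_connection_def by blast+
  moreover have "Z ` \<gamma> = orbit \<phi> (Z u)" using orbit_act[of 1 u 1] u by (simp add: Z[abs_def])
  ultimately show ?thesis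
    unfolding heteroclinic_connection_def using u
    by (auto simp: Zf intro!: bexI[of _ "Z u"] isCont_tendsto_compose[OF cZ])
qed

lemma Z_quarter_circle: "Z ` quarter_circle p p' = quarter_circle (Z p) (Z p')"
proof -
  have *: "Z u \<in> quarter_circle (Z p) (Z p')" if "u \<in> quarter_circle p p'" for u p p'
    using that unfolding quarter_circle_def
    by (simp add: linear_add[OF linear_Z] Z_scaleR) (metis Z_scaleR linear_Z linear_add)
  have "v \<in> Z ` quarter_circle p p'" if "v \<in> quarter_circle (Z p) (Z p')" for v
    using *[OF *[OF that]] Z_Z_Z by (metis image_eqI)
  then show ?thesis using * by blast
qed

lemma Z_e: "Z (e 1) = e 3" "Z (e 2) = e 1" "Z (e 3) = e 2"
  by (simp_all add: vec_eq_iff forall_3 e_def axis_def)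

lemma connections:
  assumes s: "s \<in> {1, -1}" and s': "s' \<in> {1, -1}"
  shows "heteroclinic_connection \<phi> (s *\<^sub>R e (i + 1)) (s' *\<^sub>R e i) (quarter_circle (s *\<^sub>R e (i + 1)) (s' *\<^sub>R e i))"
proof -
  note 1 = connection_in_plane[OF s s']
  note 2 = connection_Z[OF 1, unfolded Z_quarter_circle Z_scaleR Z_e]
  note 3 = connection_Z[OF 2, unfolded Z_quarter_circle Z_scaleR Z_e]
  have "i = 1 \<or> i = 2 \<or> i = 3" by (rule exhaust_3)
  then show ?thesis using 1 2 3 by (elim disjE) (simp_all add: four_3)
qed

end

section \<open>Cells\<close>

text \<open>Clearing denominators turns the quotients of \<open>chart\<close> into closed
  conditions. The strict inequality on the first component may be weakened because a zero there
  would force the whole vector to vanish.\<close>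

lemma cell_iff:
  assumes "\<epsilon> > 0"
  shows "u \<in> cell \<epsilon> \<longleftrightarrow> u \<in> S2 \<and> 0 \<le> u$1 \<and> \<bar>u$2\<bar> \<le> \<epsilon> * u$1 \<and> \<epsilon> * \<bar>u$3\<bar> \<le> u$1"
proof -
  have "u$1 \<noteq> 0" if "u \<in> S2" "\<bar>u$2\<bar> \<le> \<epsilon> * u$1" "\<epsilon> * \<bar>u$3\<bar> \<le> u$1"
  proof
    assume "u$1 = 0"
    with that(2,3) assms have "u$2 = 0" "u$3 = 0" by (auto simp: mult_le_0_iff)
    with \<open>u$1 = 0\<close> have "u = 0" by (simp add: vec_eq_iff forall_3)
    with that(1) show False by simp
  qed
  moreover have "\<epsilon> * \<bar>u$3\<bar> = \<bar>\<epsilon> * u$3\<bar>" using assms by (simp add: abs_mult)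
  ultimately show ?thesis
    using assms unfolding cell_def chart_def by (auto simp: field_simps abs_le_iff)
qed

lemma closed_cell: "\<epsilon> > 0 \<Longrightarrow> closed (cell \<epsilon>)"
proof -
  assume "\<epsilon> > 0"
  then have "cell \<epsilon> = S2 \<inter> ({u. 0 \<le> u$1} \<inter> {u. \<bar>u$2\<bar> \<le> \<epsilon> * u$1} \<inter> {u. \<epsilon> * \<bar>u$3\<bar> \<le> u$1})"
    by (auto simp: cell_iff)
  also have "closed \<dots>"
    by (intro closed_Int closed_Collect_le continuous_intros) auto
  finally show ?thesis .
qed

lemma mod_3_cases: "k mod 3 = 0 \<or> k mod 3 = 1 \<or> k mod 3 = (2::nat)"
  by linarith

lemma act_components:
  "k mod 3 = 0 \<Longrightarrow> act \<tau> k u $ 1 = \<tau> * u$1 \<and> act \<tau> k u $ 2 = \<tau> * u$2 \<and> act \<tau> k u $ 3 = \<tau> * u$3"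
  "k mod 3 = 1 \<Longrightarrow> act \<tau> k u $ 1 = \<tau> * u$2 \<and> act \<tau> k u $ 2 = \<tau> * u$3 \<and> act \<tau> k u $ 3 = \<tau> * u$1"
  "k mod 3 = 2 \<Longrightarrow> act \<tau> k u $ 1 = \<tau> * u$3 \<and> act \<tau> k u $ 2 = \<tau> * u$1 \<and> act \<tau> k u $ 3 = \<tau> * u$2"
  by (subst (1 2 3) act_mod, simp add: act_def numeral_2_eq_2)+

text \<open>A rotated copy of the cell satisfies one of the defining inequalities in the opposite
  direction: membership in both gives |v2| \<le> \<epsilon> v1 and \<epsilon> v1 \<le> \<tau> v2, or
  the analogous pair for v3. Copies therefore meet only along the sides carrying the cross
  sections.\<close>

lemma cell_act_cell:
  assumes e: "0 < \<epsilon>" "\<epsilon> < 1" and v: "v \<in> cell \<epsilon>" and av: "act \<tau> k v \<in> cell \<epsilon>" and t: "\<bar>\<tau>\<bar> = 1"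
  shows "k mod 3 = 0 \<and> \<tau> = 1 \<or> k mod 3 = 1 \<and> fst (chart v) = \<tau> * \<epsilon> \<or> k mod 3 = 2 \<and> snd (chart v) = \<tau> / \<epsilon>"
proof -
  have v1: "v$1 > 0" using v unfolding cell_def by auto
  have t': "\<tau> = 1 \<or> \<tau> = -1" using t by linarith
  note vc = v[unfolded cell_iff[OF e(1)]]
  note ac = av[unfolded cell_iff[OF e(1)]]
  consider "k mod 3 = 0" | "k mod 3 = 1" | "k mod 3 = 2" by linarith
  then show ?thesis
  proof cases
    case 1
    then show ?thesis using t' ac v1 act_components(1)[OF 1, of \<tau> v] by auto
  next
    case 2
    then have "\<tau> * v$2 = \<epsilon> * v$1" using t' ac vc v1 act_components(2)[OF 2, of \<tau> v] by auto
    then have "v$2 = \<tau> * \<epsilon> * v$1" using t' by auto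
    then show ?thesis using 2 v1 by (simp add: chart_def)
  next
    case 3
    then have "\<epsilon> * (\<tau> * v$3) = v$1" using t' ac vc v1 act_components(3)[OF 3, of \<tau> v] by auto
    then have "v$3 = \<tau> / \<epsilon> * v$1" using t' e by (auto simp: field_simps)
    then show ?thesis using 3 v1 by (simp add: chart_def)
  qed
qed

text \<open>The poles and quarter circles together are the three great circles in the coordinate
  planes. For the converse the two nonzero coordinates are split into modulus and sign; if one of
  them vanishes, the point is a pole.\<close>

lemma network_iff: "u \<in> network \<longleftrightarrow> u \<in> S2 \<and> (\<exists>i. u $ i = 0)"
proof
  assume "u \<in> network"
  then consider i s where "s \<in> {1, -1}" "u = s *\<^sub>R e i" | i s s' where "s \<in> {1, -1}" "s' \<in> {1, -1}"
    "u \<in> quarter_circle (s *\<^sub>R e (i + 1)) (s' *\<^sub>R e i)"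
    unfolding network_def poles_def by fastforce
  then show "u \<in> S2 \<and> (\<exists>i. u $ i = 0)"
  proof cases
    case 1
    have "norm u = 1" using 1 by (auto simp: e_def)
    moreover have "u $ (i + 1) = 0" using exhaust_3[of i] 1(2) by (auto simp: e_def axis_def four_3)
    ultimately show ?thesis by auto
  next
    case 2
    then have "u $ (i + 2) = 0" using exhaust_3[of i]
      unfolding quarter_circle_def by (auto simp: e_def axis_def)
    then show ?thesis using 2 unfolding quarter_circle_def by blast
  qed
next
  assume u: "u \<in> S2 \<and> (\<exists>i. u $ i = 0)"
  have in_net: "u \<in> network" if uS: "u \<in> S2" and eq: "u = x *\<^sub>R e (i + 1) + y *\<^sub>R e i" for x y i
  proof (cases "x = 0 \<or> y = 0")
    case True
    then obtain j r where r: "u = r *\<^sub>R e j" using eq by fastforce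
    then have "\<bar>r\<bar> = 1" using uS by (simp add: e_def)
    then have "r = 1 \<or> r = -1" by linarith
    then have "u \<in> poles" unfolding r poles_def by auto
    then show ?thesis by (simp add: network_def)
  next
    case False
    have "u = \<bar>x\<bar> *\<^sub>R (sgn x *\<^sub>R e (i + 1)) + \<bar>y\<bar> *\<^sub>R (sgn y *\<^sub>R e i)"
      by (simp add: eq abs_mult_sgn)
    moreover have "\<bar>x\<bar> > 0" "\<bar>y\<bar> > 0" using False by auto
    ultimately have "u \<in> quarter_circle (sgn x *\<^sub>R e (i + 1)) (sgn y *\<^sub>R e i)"
      using uS unfolding quarter_circle_def by blast
    moreover have "sgn x \<in> {1, -1}" "sgn y \<in> {1, -1}" using False by (auto simp: sgn_if)
    ultimately show ?thesis unfolding network_def by blast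
  qed
  from u obtain i where i: "u $ i = 0" by blast
  have "i = 1 \<or> i = 2 \<or> i = 3" by (rule exhaust_3)
  then have "(\<exists>x y. u = x *\<^sub>R e (2 + 1) + y *\<^sub>R e 2) \<or> (\<exists>x y. u = x *\<^sub>R e (3 + 1) + y *\<^sub>R e 3)
      \<or> (\<exists>x y. u = x *\<^sub>R e (1 + 1) + y *\<^sub>R e 1)"
  proof (elim disjE)
    assume "i = 1"
    then have "u = u$3 *\<^sub>R e (2 + 1) + u$2 *\<^sub>R e 2"
      using i by (simp add: vec_eq_iff forall_3 e_def axis_def)
    then show ?thesis by blast
  next
    assume "i = 2"
    then have "u = u$1 *\<^sub>R e (3 + 1) + u$3 *\<^sub>R e 3"
      using i by (simp add: vec_eq_iff forall_3 e_def axis_def four_3)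
    then show ?thesis by blast
  next
    assume "i = 3"
    then have "u = u$2 *\<^sub>R e (1 + 1) + u$1 *\<^sub>R e 1"
      using i by (simp add: vec_eq_iff forall_3 e_def axis_def)
    then show ?thesis by blast
  qed
  then show "u \<in> network" using in_net u by blast
qed

lemma saturate_closed_act: "\<bar>\<tau>\<bar> = 1 \<Longrightarrow> x \<in> saturate X \<Longrightarrow> act \<tau> k x \<in> saturate X"
proof -
  assume t: "\<bar>\<tau>\<bar> = 1" and "x \<in> saturate X"
  then obtain \<sigma> j v where "\<bar>\<sigma>\<bar> = 1" "v \<in> X" "x = act \<sigma> j v" unfolding mem_saturate by blast
  then have "act \<tau> k x \<in> act (\<tau> * \<sigma>) (k + j) ` X" "\<bar>\<tau> * \<sigma>\<bar> = 1" using t by (auto simp: act_act abs_mult)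
  then show ?thesis unfolding mem_saturate by blast
qed

lemma saturate_act_iff: "\<bar>\<tau>\<bar> = 1 \<Longrightarrow> act \<tau> k x \<in> saturate X \<longleftrightarrow> x \<in> saturate X"
  using saturate_closed_act[of \<tau> x X k] saturate_closed_act[of \<tau> "act \<tau> k x" X "2 * k"]
  by (auto simp: act_inverse)

lemma saturate_superset: "X \<subseteq> saturate X"
proof
  fix x assume "x \<in> X"
  then have "x \<in> act 1 0 ` X" by (simp add: image_iff)
  then show "x \<in> saturate X" unfolding mem_saturate by (intro exI[of _ 1] exI[of _ 0]) auto
qed

text \<open>An open neighbourhood of the coordinate planes, symmetric under the group. It is the
  open set from which the closed images of the cell can be cut, since the cells themselves are not
  open.\<close>

definition near_planes :: "real \<Rightarrow> (real^3) set" where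
  "near_planes r = {u \<in> S2. \<bar>u$3\<bar> < r * max \<bar>u$1\<bar> \<bar>u$2\<bar> \<or> \<bar>u$1\<bar> < r * max \<bar>u$2\<bar> \<bar>u$3\<bar>
      \<or> \<bar>u$2\<bar> < r * max \<bar>u$3\<bar> \<bar>u$1\<bar>}"

lemma openin_near_planes: "openin (top_of_set S2) (near_planes r)"
proof -
  have "near_planes r = S2 \<inter> ({u. \<bar>u$3\<bar> < r * max \<bar>u$1\<bar> \<bar>u$2\<bar>} \<union> {u. \<bar>u$1\<bar> < r * max \<bar>u$2\<bar> \<bar>u$3\<bar>}
      \<union> {u. \<bar>u$2\<bar> < r * max \<bar>u$3\<bar> \<bar>u$1\<bar>})"
    by (auto simp: near_planes_def)
  moreover have "open ({u::real^3. \<bar>u$3\<bar> < r * max \<bar>u$1\<bar> \<bar>u$2\<bar>} \<union> {u. \<bar>u$1\<bar> < r * max \<bar>u$2\<bar> \<bar>u$3\<bar>}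
      \<union> {u. \<bar>u$2\<bar> < r * max \<bar>u$3\<bar> \<bar>u$1\<bar>})"
    by (intro open_Un open_Collect_less continuous_intros continuous_on_max)
  ultimately show ?thesis by (simp only: openin_open_Int)
qed

lemma near_planes_act:
  assumes t: "\<bar>\<tau>\<bar> = 1" and u: "u \<in> near_planes r"
  shows "act \<tau> k u \<in> near_planes r"
proof -
  have S: "act \<tau> k u \<in> S2" using act_S2[OF t] u unfolding near_planes_def by blast
  consider "k mod 3 = 0" | "k mod 3 = 1" | "k mod 3 = 2" by linarith
  then show ?thesis
  proof cases
    case 1
    then show ?thesis using S u t by (simp add: near_planes_def act_components abs_mult)
  next
    case 2
    then show ?thesis using S u t by (simp add: near_planes_def act_components abs_mult) argo
  next
    case 3
    then show ?thesis using S u t by (simp add: near_planes_def act_components abs_mult) argo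
  qed
qed

text \<open>By symmetry the point may be taken close to the plane u3 = 0. If |u2| \<le> \<epsilon>
  |u1| it lies in the cell of plus or minus \<open>e 1\<close>, otherwise in that of plus or minus
  \<open>e 2\<close>. In the second case |u1| may exceed |u2| by a factor up to 1/\<epsilon>, which
  is why the width is \<epsilon>^2.\<close>

lemma near_planes_cells:
  assumes e: "0 < \<epsilon>" "\<epsilon> < 1"
  shows "near_planes (\<epsilon>\<^sup>2) \<subseteq> saturate (cell \<epsilon>)"
proof
  have plane: "u \<in> saturate (cell \<epsilon>)" if u: "u \<in> S2" "\<bar>u$3\<bar> < \<epsilon>\<^sup>2 * max \<bar>u$1\<bar> \<bar>u$2\<bar>" for u
  proof (cases "\<bar>u$2\<bar> \<le> \<epsilon> * \<bar>u$1\<bar>")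
    case True
    have "\<epsilon> * \<bar>u$1\<bar> \<le> \<bar>u$1\<bar>" using e by (intro mult_left_le_one_le) auto
    then have "max \<bar>u$1\<bar> \<bar>u$2\<bar> = \<bar>u$1\<bar>" using True by auto
    moreover have "\<epsilon> * (\<epsilon>\<^sup>2 * \<bar>u$1\<bar>) \<le> \<bar>u$1\<bar>"
      using e by (simp add: mult.assoc[symmetric] mult_left_le_one_le power_le_one mult_le_one)
    moreover have "\<epsilon> * \<bar>u$3\<bar> \<le> \<epsilon> * (\<epsilon>\<^sup>2 * max \<bar>u$1\<bar> \<bar>u$2\<bar>)"
      using u(2) e by (intro mult_left_mono) auto
    ultimately have le: "\<epsilon> * \<bar>u$3\<bar> \<le> \<bar>u$1\<bar>" by simp
    define \<tau> :: real where "\<tau> = (if u$1 < 0 then -1 else 1)"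
    have "act \<tau> 0 u \<in> cell \<epsilon>"
      unfolding cell_iff[OF e(1)] using True le u(1) act_S2[of \<tau> 0 u] by (auto simp: \<tau>_def act_components)
    then have "act \<tau> 0 u \<in> saturate (cell \<epsilon>)" using saturate_superset by blast
    then show ?thesis by (subst (asm) saturate_act_iff) (auto simp: \<tau>_def)
  next
    case False
    have "\<epsilon>\<^sup>2 * \<bar>u$1\<bar> \<le> \<epsilon> * \<bar>u$2\<bar>" using False e by (simp add: power2_eq_square mult.assoc)
    moreover have "\<epsilon>\<^sup>2 * \<bar>u$2\<bar> \<le> \<epsilon> * \<bar>u$2\<bar>"
      using e by (intro mult_right_mono) (auto simp: power2_eq_square)
    ultimately have "\<epsilon>\<^sup>2 * max \<bar>u$1\<bar> \<bar>u$2\<bar> \<le> \<epsilon> * \<bar>u$2\<bar>" by (auto simp: max_def)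
    then have le: "\<bar>u$3\<bar> \<le> \<epsilon> * \<bar>u$2\<bar>" using u(2) by linarith
    define \<tau> :: real where "\<tau> = (if u$2 < 0 then -1 else 1)"
    have "act \<tau> 1 u \<in> cell \<epsilon>"
      unfolding cell_iff[OF e(1)] using False le u(1) act_S2[of \<tau> 1 u] by (auto simp: \<tau>_def act_components)
    then have "act \<tau> 1 u \<in> saturate (cell \<epsilon>)" using saturate_superset by blast
    then show ?thesis by (subst (asm) saturate_act_iff) (auto simp: \<tau>_def)
  qed
  fix u assume u: "u \<in> near_planes (\<epsilon>\<^sup>2)"
  then have S: "act 1 k u \<in> S2" for k using act_S2[of 1 k u] by (auto simp: near_planes_def)
  have "act 1 0 u \<in> saturate (cell \<epsilon>) \<or> act 1 1 u \<in> saturate (cell \<epsilon>) \<or> act 1 2 u \<in> saturate (cell \<epsilon>)"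
    using u plane[OF S, of 0] plane[OF S, of 1] plane[OF S, of 2] unfolding near_planes_def
    by (auto simp: act_components)
  then show "u \<in> saturate (cell \<epsilon>)" by (auto simp: saturate_act_iff)
qed

section \<open>The linearised passage through a cell\<close>

text \<open>The bound 1/4 on \<epsilon> keeps entry points, which lie within 2 \<epsilon> of their
  poles, apart from each other. The bound \<epsilon>^2 on \<mu> places both arms of the cross inside
  \<open>near_planes (\<epsilon>\<^sup>2)\<close>. The assumption \<open>small\<close> lets a linear
  orbit turn from the horizontal arm into the vertical one without leaving the cross; see
  \<open>path_in_W\<close>.\<close>

locale linearised = PN_flow b c d \<phi> for b c d \<phi> +
  fixes \<alpha> \<epsilon> \<mu> \<nu> :: real and U h h'
  assumes alpha: "0 < \<alpha>" and eps: "0 < \<epsilon>" "\<epsilon> < 1/4" and mu: "0 < \<mu>" "\<mu> < \<epsilon>\<^sup>2" and nu: "\<nu> = \<epsilon> * \<mu>"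
    and small: "\<bar>d\<bar> + 2 * \<epsilon> * (2 * \<bar>d\<bar> / \<mu>) powr \<alpha> < \<mu>"
    and lin: "locally_linear \<phi> \<alpha> d \<epsilon> \<mu> \<nu> U h h'"
begin

abbreviation "W \<equiv> cross_nbhd \<epsilon> \<mu> \<nu>"
abbreviation "\<psi> \<equiv> lin_flow \<alpha> d"

lemma d_less_mu: "\<bar>d\<bar> < \<mu>"
proof -
  have "0 \<le> 2 * \<epsilon> * (2 * \<bar>d\<bar> / \<mu>) powr \<alpha>" using eps by simp
  with small show ?thesis by linarith
qed

lemma eps_sq: "\<epsilon>\<^sup>2 < \<epsilon> / 4"
  using eps by (simp add: power2_eq_square)

lemma mu_eps: "\<mu> < \<epsilon> / 4"
  using mu eps_sq by linarith

lemma nu_bounds: "0 < \<nu>" "\<nu> < \<mu>" "\<nu> < \<epsilon>\<^sup>2" "\<nu> < \<epsilon>"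
proof -
  show "0 < \<nu>" using eps mu nu by simp
  show "\<nu> < \<mu>" using eps mu nu by simp
  then show "\<nu> < \<epsilon>\<^sup>2" using mu by linarith
  then show "\<nu> < \<epsilon>" using eps_sq eps by linarith
qed

lemma inv_eps: "4 < 1 / \<epsilon>" "\<nu> < 1 / \<epsilon>" "\<epsilon> < 1 / \<epsilon>"
proof -
  show "4 < 1 / \<epsilon>" using eps by (simp add: field_simps)
  then show "\<nu> < 1 / \<epsilon>" "\<epsilon> < 1 / \<epsilon>" using nu_bounds eps by linarith+
qed

lemma d_less_eps: "\<bar>d\<bar> < \<epsilon>"
  using d_less_mu mu_eps eps by linarith

lemma mem_W: "p \<in> W \<longleftrightarrow> \<bar>fst p\<bar> \<le> \<epsilon> \<and> \<bar>snd p\<bar> < \<nu> \<or> \<bar>fst p\<bar> < \<mu> \<and> \<bar>snd p\<bar> \<le> 1 / \<epsilon>"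
  by (cases p) (auto simp: cross_nbhd_def abs_le_iff abs_less_iff)

lemmas lin_parts = lin[unfolded locally_linear_def topologically_equivalent_via_def]

lemmas U_cell = lin_parts[THEN conjunct1]
  and network_U = lin_parts[THEN conjunct2, THEN conjunct1]
  and chart_image = lin_parts[THEN conjunct2, THEN conjunct2, THEN conjunct1]
  and hom = lin_parts[THEN conjunct2, THEN conjunct2, THEN conjunct2, THEN conjunct1, THEN conjunct1]
  and maps_h = lin_parts[THEN conjunct2, THEN conjunct2, THEN conjunct2, THEN conjunct1, THEN conjunct2, THEN conjunct1]
  and maps_h' = lin_parts[THEN conjunct2, THEN conjunct2, THEN conjunct2, THEN conjunct1, THEN conjunct2, THEN conjunct2]
  and lin_sections = lin_parts[THEN conjunct2, THEN conjunct2, THEN conjunct2, THEN conjunct2]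

lemma chart_U: "u \<in> U \<Longrightarrow> chart u \<in> W"
  using chart_image by blast

lemma U_subset_cell: "U \<subseteq> cell \<epsilon>"
  using U_cell by (rule openin_imp_subset)

lemma U_S2: "u \<in> U \<Longrightarrow> u \<in> S2"
  using U_subset_cell by (auto simp: cell_def)

lemma h_inv [simp]: "u \<in> U \<Longrightarrow> h' (h u) = u" "p \<in> W \<Longrightarrow> h (h' p) = p" "u \<in> U \<Longrightarrow> h u \<in> W" "p \<in> W \<Longrightarrow> h' p \<in> U"
  using hom unfolding homeomorphism_def by blast+

lemma h_inj: "u \<in> U \<Longrightarrow> v \<in> U \<Longrightarrow> h u = h v \<Longrightarrow> u = v"
  using h_inv(1) by metis

lemma sections_in:
  assumes "\<bar>\<sigma>\<bar> = 1"
  shows "h ` {u \<in> U. fst (chart u) = \<sigma> * \<epsilon>} = {\<sigma> * \<epsilon>} \<times> {-\<nu><..<\<nu>}"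
proof -
  have *: "I_A \<epsilon> \<nu> \<union> {(\<epsilon>, 0)} \<union> I_B \<epsilon> \<nu> = {\<epsilon>} \<times> {-\<nu><..<\<nu>}"
    "I_C \<epsilon> \<nu> \<union> {(-\<epsilon>, 0)} \<union> I_D \<epsilon> \<nu> = {-\<epsilon>} \<times> {-\<nu><..<\<nu>}"
    using nu_bounds by (auto simp: I_A_def I_B_def I_C_def I_D_def)
  have "\<sigma> = 1 \<or> \<sigma> = -1" using assms by linarith
  then show ?thesis
    using lin_sections[THEN conjunct1] lin_sections[THEN conjunct2, THEN conjunct1] unfolding * by (elim disjE) simp_all
qed

lemma sections_out:
  assumes "\<bar>\<sigma>\<bar> = 1"
  shows "h ` {u \<in> U. snd (chart u) = \<sigma> / \<epsilon>} = {-\<mu><..<\<mu>} \<times> {\<sigma> / \<epsilon>}"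
proof -
  have *: "O_A (1 / \<epsilon>) \<mu> \<union> {(0, 1 / \<epsilon>)} \<union> O_B (1 / \<epsilon>) \<mu> = {-\<mu><..<\<mu>} \<times> {1 / \<epsilon>}"
    "O_C (1 / \<epsilon>) \<mu> \<union> {(0, - 1 / \<epsilon>)} \<union> O_D (1 / \<epsilon>) \<mu> = {-\<mu><..<\<mu>} \<times> {- 1 / \<epsilon>}"
    using mu by (auto simp: O_A_def O_B_def O_C_def O_D_def)
  have "\<sigma> = 1 \<or> \<sigma> = -1" using assms by linarith
  then show ?thesis
    using lin_sections[THEN conjunct2, THEN conjunct2, THEN conjunct1]
      lin_sections[THEN conjunct2, THEN conjunct2, THEN conjunct2, THEN conjunct1] unfolding * by (elim disjE) simp_all
qed

lemma glue_h:
  assumes "\<bar>\<sigma>\<bar> = 1" "u \<in> U" "fst (chart u) = \<sigma> * \<epsilon>"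
  shows "act \<sigma> 1 u \<in> U" "h (act \<sigma> 1 u) = glue (h u)"
proof -
  have "act 1 1 u = Z u" "act (-1) 1 u = S (Z u)" by (simp_all add: act_def S_def)
  moreover have "\<sigma> = 1 \<or> \<sigma> = -1" using assms by linarith
  ultimately show "act \<sigma> 1 u \<in> U" "h (act \<sigma> 1 u) = glue (h u)"
    using lin_sections[THEN conjunct2, THEN conjunct2, THEN conjunct2, THEN conjunct2] assms(2,3) by auto
qed

text \<open>The parameter \<open>x\<close> is the coordinate \<open>p\<^sub>2\<close> of the identified point of the outgoing section.\<close>

definition entry :: "real \<Rightarrow> real \<Rightarrow> real^3" where
  "entry \<sigma> x = h' (\<sigma> * \<epsilon>, \<sigma> * \<epsilon> * x)"

lemma entry_coord_W:
  assumes "\<bar>\<sigma>\<bar> = 1" "\<bar>x\<bar> < \<mu>"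
  shows "(\<sigma> * \<epsilon>, \<sigma> * \<epsilon> * x) \<in> {\<sigma> * \<epsilon>} \<times> {-\<nu><..<\<nu>}" "(\<sigma> * \<epsilon>, \<sigma> * \<epsilon> * x) \<in> W"
proof -
  have y: "\<bar>\<sigma> * \<epsilon> * x\<bar> < \<nu>" using assms eps unfolding nu by (simp add: abs_mult)
  then show "(\<sigma> * \<epsilon>, \<sigma> * \<epsilon> * x) \<in> {\<sigma> * \<epsilon>} \<times> {-\<nu><..<\<nu>}"
    by (simp add: abs_less_iff minus_less_iff)
  have "\<bar>\<sigma> * \<epsilon>\<bar> = \<epsilon>" using assms eps by (simp add: abs_mult)
  with y show "(\<sigma> * \<epsilon>, \<sigma> * \<epsilon> * x) \<in> W" unfolding mem_W by simp
qed

lemma entry: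
  assumes "\<bar>\<sigma>\<bar> = 1" "\<bar>x\<bar> < \<mu>"
  shows "entry \<sigma> x \<in> U" "fst (chart (entry \<sigma> x)) = \<sigma> * \<epsilon>" "h (entry \<sigma> x) = (\<sigma> * \<epsilon>, \<sigma> * \<epsilon> * x)"
    "act \<sigma> 1 (entry \<sigma> x) \<in> U" "h (act \<sigma> 1 (entry \<sigma> x)) = (x, \<sigma> / \<epsilon>)"
proof -
  show U: "entry \<sigma> x \<in> U" and h: "h (entry \<sigma> x) = (\<sigma> * \<epsilon>, \<sigma> * \<epsilon> * x)"
    using entry_coord_W(2)[OF assms] by (simp_all add: entry_def)
  obtain u where "u \<in> U" "fst (chart u) = \<sigma> * \<epsilon>" "h u = (\<sigma> * \<epsilon>, \<sigma> * \<epsilon> * x)"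
    using entry_coord_W(1)[OF assms] unfolding sections_in[OF assms(1), symmetric] by (smt (verit) imageE mem_Collect_eq)
  then show s: "fst (chart (entry \<sigma> x)) = \<sigma> * \<epsilon>" using h_inj[OF U] h by metis
  show "act \<sigma> 1 (entry \<sigma> x) \<in> U" by (rule glue_h[OF assms(1) U s])
  have "\<sigma> = 1 \<or> \<sigma> = -1" using assms by linarith
  then show "h (act \<sigma> 1 (entry \<sigma> x)) = (x, \<sigma> / \<epsilon>)"
    unfolding glue_h(2)[OF assms(1) U s] h using eps by (auto simp: glue_def)
qed

lemma section_in_entry:
  assumes "\<bar>\<sigma>\<bar> = 1" "u \<in> U" "fst (chart u) = \<sigma> * \<epsilon>"
  obtains x where "\<bar>x\<bar> < \<mu>" "u = entry \<sigma> x"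
proof -
  have "h u \<in> {\<sigma> * \<epsilon>} \<times> {-\<nu><..<\<nu>}" using assms unfolding sections_in[OF assms(1), symmetric] by blast
  then obtain y where y: "h u = (\<sigma> * \<epsilon>, y)" "\<bar>y\<bar> < \<nu>" by auto
  define x where "x = y / (\<sigma> * \<epsilon>)"
  have "\<bar>x\<bar> < \<mu>" using y(2) assms(1) eps by (simp add: x_def abs_mult field_simps nu)
  moreover have "\<sigma> * \<epsilon> * x = y" using assms(1) eps by (auto simp: x_def)
  then have "u = entry \<sigma> x" unfolding entry_def using y(1) h_inv(1)[OF assms(2)] by simp
  ultimately show thesis using that by blast
qed

lemma section_out_entry:
  assumes "\<bar>\<sigma>\<bar> = 1" "u \<in> U" "snd (chart u) = \<sigma> / \<epsilon> \<or> snd (h u) = \<sigma> / \<epsilon>"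
  obtains x where "\<bar>x\<bar> < \<mu>" "u = act \<sigma> 1 (entry \<sigma> x)" "h u = (x, \<sigma> / \<epsilon>)"
proof -
  have "\<exists>x. \<bar>x\<bar> < \<mu> \<and> h u = (x, \<sigma> / \<epsilon>)"
    using assms(3)
  proof
    assume "snd (chart u) = \<sigma> / \<epsilon>"
    then have "h u \<in> {-\<mu><..<\<mu>} \<times> {\<sigma> / \<epsilon>}" using assms unfolding sections_out[OF assms(1), symmetric] by blast
    then show ?thesis by auto
  next
    assume s: "snd (h u) = \<sigma> / \<epsilon>"
    then have "\<bar>snd (h u)\<bar> = 1 / \<epsilon>" using assms(1) eps by simp
    then have "\<bar>fst (h u)\<bar> < \<mu>" using h_inv(3)[OF assms(2)] inv_eps unfolding mem_W by auto
    then show ?thesis using s by (metis prod.collapse)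
  qed
  then obtain x where x: "\<bar>x\<bar> < \<mu>" "h u = (x, \<sigma> / \<epsilon>)" by blast
  then have "u = act \<sigma> 1 (entry \<sigma> x)" using h_inj assms(2) entry(4,5)[OF assms(1) x(1)] by metis
  then show thesis using that x by blast
qed

text \<open>Distinct images of the cell meet only along sections, where the identifications decide
  membership in \<open>U\<close>.\<close>

lemma saturated:
  assumes "v \<in> U" "\<bar>\<tau>\<bar> = 1" "act \<tau> k v \<in> cell \<epsilon>"
  shows "act \<tau> k v \<in> U"
proof -
  have "v \<in> cell \<epsilon>" using assms U_subset_cell by blast
  then consider "k mod 3 = 0" "\<tau> = 1" | "k mod 3 = 1" "fst (chart v) = \<tau> * \<epsilon>" | "k mod 3 = 2" "snd (chart v) = \<tau> / \<epsilon>"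
    using cell_act_cell[of \<epsilon> v \<tau> k] assms eps by force
  then show ?thesis
  proof cases
    case 1
    then show ?thesis using assms(1) act_mod[of \<tau> k] by simp
  next
    case 2
    then show ?thesis using glue_h(1)[OF assms(2,1)] act_mod[of \<tau> k] by simp
  next
    case 3
    then obtain x where x: "\<bar>x\<bar> < \<mu>" "v = act \<tau> 1 (entry \<tau> x)" using section_out_entry assms by metis
    have "act \<tau> k v = entry \<tau> x"
      unfolding x(2) act_act using assms(2) 3(1) by (subst act_mod) (simp add: mod_Suc)
    then show ?thesis using entry(1)[OF assms(2) x(1)] by simp
  qed
qed

lemma saturate_U_cell: "x \<in> saturate U \<Longrightarrow> x \<in> cell \<epsilon> \<Longrightarrow> x \<in> U"
  unfolding mem_saturate using saturated by blast

text \<open>\<open>U\<close> is open only relative to the closed cell, so openness of the union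
  could fail where copies meet. It is saved by \<open>saturate_U_cell\<close>: the union is the open
  set \<open>near_planes (\<epsilon>\<^sup>2)\<close> minus the images of the compact remainder
  \<open>cell \<epsilon> - U\<close>, and no point lies both in an image of \<open>U\<close> and in
  an image of the remainder.\<close>

lemma openin_saturate_U: "openin (top_of_set S2) (saturate U)"
proof -
  define K where "K = saturate (cell \<epsilon> - U)"
  have eps1: "\<epsilon> < 1" using eps by simp
  have "closedin (top_of_set (cell \<epsilon>)) (cell \<epsilon> - U)" using U_cell by (simp add: closedin_diff)
  then have "closed (cell \<epsilon> - U)" using closed_cell[OF eps(1)] closedin_closed_trans by blast
  moreover have "bounded (cell \<epsilon> - U)"
    by (rule bounded_subset[of S2]) (auto simp: cell_def intro: compact_imp_bounded)
  ultimately have "compact (cell \<epsilon> - U)" by (simp add: compact_eq_bounded_closed)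
  then have "closed K" unfolding K_def saturate_act
    by (intro closed_UN finite_lessThan finite.intros compact_imp_closed compact_continuous_image continuous_on_act ballI)
      auto
  moreover have "saturate U = near_planes (\<epsilon>\<^sup>2) - K"
  proof (intro equalityI subsetI)
    fix x assume x: "x \<in> saturate U"
    then obtain \<tau> k u where u: "\<bar>\<tau>\<bar> = 1" "u \<in> U" "x = act \<tau> k u" unfolding mem_saturate by blast
    have u1: "u$1 > 0" using u U_subset_cell by (auto simp: cell_def)
    \<comment> \<open>The horizontal arm lies near the plane u3 = 0 because \<nu> < \<epsilon>^2,
      the vertical arm near u2 = 0 because \<mu> < \<epsilon>^2.\<close>
    have "u \<in> near_planes (\<epsilon>\<^sup>2)"
      using chart_U[OF u(2)] unfolding mem_W
    proof
      assume "\<bar>fst (chart u)\<bar> \<le> \<epsilon> \<and> \<bar>snd (chart u)\<bar> < \<nu>"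
      then have "\<bar>u$3\<bar> < \<nu> * u$1" using u1 by (simp add: chart_def field_simps)
      also have "\<dots> \<le> \<epsilon>\<^sup>2 * max \<bar>u$1\<bar> \<bar>u$2\<bar>" using u1 nu_bounds by (intro mult_mono) auto
      finally show ?thesis using U_S2[OF u(2)] by (simp add: near_planes_def)
    next
      assume "\<bar>fst (chart u)\<bar> < \<mu> \<and> \<bar>snd (chart u)\<bar> \<le> 1 / \<epsilon>"
      then have "\<bar>u$2\<bar> < \<mu> * u$1" using u1 by (simp add: chart_def field_simps)
      also have "\<dots> \<le> \<epsilon>\<^sup>2 * max \<bar>u$3\<bar> \<bar>u$1\<bar>" using u1 mu by (intro mult_mono) auto
      finally show ?thesis using U_S2[OF u(2)] by (simp add: near_planes_def)
    qed
    then have "x \<in> near_planes (\<epsilon>\<^sup>2)" using u near_planes_act by blast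
    moreover have "x \<notin> K"
    proof
      assume "x \<in> K"
      then obtain k' \<tau>' v where v: "\<bar>\<tau>'\<bar> = 1" "v \<in> cell \<epsilon>" "v \<notin> U" "x = act \<tau>' k' v"
        unfolding K_def mem_saturate by blast
      then have "v \<in> saturate U" using x saturate_act_iff by blast
      then show False using v saturate_U_cell by blast
    qed
    ultimately show "x \<in> near_planes (\<epsilon>\<^sup>2) - K" by blast
  next
    fix x assume x: "x \<in> near_planes (\<epsilon>\<^sup>2) - K"
    then have "x \<in> saturate (cell \<epsilon>)" using near_planes_cells[OF eps(1) eps1] by blast
    then obtain \<tau> k v where v: "\<bar>\<tau>\<bar> = 1" "v \<in> cell \<epsilon>" "x = act \<tau> k v"
      unfolding mem_saturate by blast
    moreover have "v \<in> U"
    proof (rule ccontr)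
      assume "v \<notin> U"
      with v have "x \<in> K" unfolding K_def mem_saturate by blast
      with x show False by blast
    qed
    ultimately show "x \<in> saturate U" unfolding mem_saturate by blast
  qed
  ultimately show ?thesis
    using openin_near_planes[of "\<epsilon>\<^sup>2"] by (simp add: Diff_eq openin_Int_open open_Compl)
qed

lemma network_interior: "network \<subseteq> (top_of_set S2) interior_of (saturate U)"
proof -
  have "network \<subseteq> saturate U"
  proof
    fix u assume u: "u \<in> network"
    have "u \<in> near_planes (\<epsilon>\<^sup>2)"
    proof -
      have S: "u \<in> S2" and "u$1 = 0 \<or> u$2 = 0 \<or> u$3 = 0" using u unfolding network_iff by (auto, metis exhaust_3)
      moreover have "\<not> (u$1 = 0 \<and> u$2 = 0 \<and> u$3 = 0)"
      proof
        assume "u$1 = 0 \<and> u$2 = 0 \<and> u$3 = 0"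
        then have "u = 0" by (simp add: vec_eq_iff forall_3)
        then show False using S by simp
      qed
      ultimately show ?thesis using eps by (auto simp: near_planes_def zero_less_mult_iff less_max_iff_disj)
    qed
    then have "u \<in> saturate (cell \<epsilon>)" using near_planes_cells[of \<epsilon>] eps by auto
    then obtain \<tau> k v where v: "\<bar>\<tau>\<bar> = 1" "v \<in> cell \<epsilon>" "u = act \<tau> k v" unfolding mem_saturate by blast
    have "v \<in> network"
    proof -
      obtain i where "u $ i = 0" using u unfolding network_iff by blast
      then have "u$1 = 0 \<or> u$2 = 0 \<or> u$3 = 0" using exhaust_3[of i] by auto
      moreover have "\<tau> \<noteq> 0" using v(1) by auto
      ultimately have "v$1 = 0 \<or> v$2 = 0 \<or> v$3 = 0"
        using mod_3_cases[of k] act_components[of k \<tau> v] v(3) by auto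
      moreover have "v \<in> S2" using v(2) by (auto simp: cell_def)
      ultimately show ?thesis unfolding network_iff by blast
    qed
    then have "v \<in> U" using v network_U by blast
    then show "u \<in> saturate U" using v unfolding mem_saturate by blast
  qed
  then show ?thesis using openin_saturate_U by (simp add: interior_of_openin)
qed

end

section \<open>Periodic orbits of the flow on the sphere\<close>

context PN_flow
begin

lemma has_period_orbit:
  assumes "u \<in> S2" "has_period \<phi> u T" "w \<in> orbit \<phi> u"
  shows "has_period \<phi> w T"
proof -
  obtain s where w: "w = \<phi> s u" using assms(3) by (auto simp: orbit_def)
  have T: "T > 0" "\<phi> T u = u" "\<And>t. 0 < t \<Longrightarrow> t < T \<Longrightarrow> \<phi> t u \<noteq> u"
    using assms(2) unfolding has_period_def by auto
  have comm: "\<phi> t w = \<phi> s (\<phi> t u)" for t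
    unfolding w using flow_add[OF assms(1), of t s] flow_add[OF assms(1), of s t] by (simp add: add.commute)
  have "\<phi> t w \<noteq> w" if "0 < t" "t < T" for t
  proof
    assume "\<phi> t w = w"
    then have "\<phi> (- s) (\<phi> s (\<phi> t u)) = \<phi> (- s) (\<phi> s u)"
      using comm[of t] w by simp
    then show False using T(3)[OF that] assms(1) by (simp only: flow_neg flow_S2)
  qed
  then show ?thesis unfolding has_period_def using T comm by (auto simp: w)
qed

lemma has_period_act:
  assumes "u \<in> S2" "has_period \<phi> u T" "\<bar>\<tau>\<bar> = 1"
  shows "has_period \<phi> (act \<tau> k u) T"
  using assms act_inverse[of \<tau> k] unfolding has_period_def by (simp add: flow_act) metis

lemma orbit_periodic:
  assumes u: "u \<in> S2" and T: "T > 0" "\<phi> T u = u"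
  shows "orbit \<phi> u = (\<lambda>t. \<phi> t u) ` {0..<T}"
proof -
  have per: "\<phi> (real n * T) u = u" for n
    by (induction n) (use T u in \<open>auto simp: distrib_right flow_add\<close>)
  have per': "\<phi> (real_of_int n * T) u = u" for n
  proof (cases "n \<ge> 0")
    case True
    then show ?thesis using per[of "nat n"] by simp
  next
    case False
    then have "real_of_int n * T = - (real (nat (- n)) * T)" by simp
    then show ?thesis using per[of "nat (- n)"] flow_neg(1)[OF u, of "real (nat (- n)) * T"] by simp
  qed
  have "\<exists>r\<in>{0..<T}. \<phi> t u = \<phi> r u" for t
  proof (intro bexI)
    define n where "n = \<lfloor>t / T\<rfloor>"
    have "real_of_int n \<le> t / T" "t / T < real_of_int n + 1" unfolding n_def by linarith+
    then show "t - real_of_int n * T \<in> {0..<T}" using T(1) by (auto simp: field_simps)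
    show "\<phi> t u = \<phi> (t - real_of_int n * T) u"
      using flow_add[OF u, of "t - real_of_int n * T" "real_of_int n * T"] per'[of n] by simp
  qed
  then show ?thesis unfolding orbit_def by blast
qed

lemma orbit_periodic_compact:
  assumes u: "u \<in> S2" and T: "T > 0" "\<phi> T u = u"
  shows "compact (orbit \<phi> u)"
proof -
  have "orbit \<phi> u = (\<lambda>t. \<phi> t u) ` {0..T}"
  proof
    show "orbit \<phi> u \<subseteq> (\<lambda>t. \<phi> t u) ` {0..T}"
      unfolding orbit_periodic[OF u T] by (intro image_mono) auto
  qed (auto simp: orbit_def)
  then show ?thesis using flow_cont_time[OF u] compact_continuous_image by (metis compact_Icc)
qed

end

lemma exp_growth_stays_below:
  fixes a K :: real
  assumes "0 \<le> a" "a < K"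
  obtains \<delta> where "\<delta> > 0" "\<And>t. t \<le> \<delta> \<Longrightarrow> a * exp t < K"
proof (cases "a = 0")
  case True
  then show thesis using that[of 1] assms by auto
next
  case False
  then have a: "a > 0" using assms by simp
  \<comment> \<open>The time bound is the moment at which a exp t reaches the midpoint of a and
    K.\<close>
  show thesis
  proof (rule that[of "ln ((a + K) / (2 * a))"])
    have r: "1 < (a + K) / (2 * a)" using a assms by (simp add: field_simps)
    then show "0 < ln ((a + K) / (2 * a))" by simp
    fix t assume "t \<le> ln ((a + K) / (2 * a))"
    then have "exp t \<le> exp (ln ((a + K) / (2 * a)))" by simp
    also have "\<dots> = (a + K) / (2 * a)" using r by (intro exp_ln) linarith
    finally have "a * exp t \<le> a * ((a + K) / (2 * a))" using a by (intro mult_left_mono) auto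
    also have "\<dots> < K" using a assms by (simp add: field_simps)
    finally show "a * exp t < K" .
  qed
qed

lemma strict_mono_reparametrisation:
  fixes \<tau> :: "real \<Rightarrow> real"
  assumes "continuous_on {0..T} \<tau>" "strict_mono_on {0..T} \<tau>" "\<tau> 0 = 0" "0 \<le> s" "s \<le> \<tau> T" "0 \<le> T"
  obtains t where "0 \<le> t" "t \<le> T" "\<tau> t = s" "0 < s \<Longrightarrow> 0 < t" "s < \<tau> T \<Longrightarrow> t < T"
proof -
  obtain t where t: "0 \<le> t" "t \<le> T" "\<tau> t = s"
    using IVT'[of \<tau> 0 s T] assms by auto
  moreover have "0 < s \<Longrightarrow> 0 < t" "s < \<tau> T \<Longrightarrow> t < T"
    using t assms(3) by (cases "t = 0"; cases "t = T"; auto)+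
  ultimately show thesis using that by blast
qed

section \<open>How periodic orbits leave a cell\<close>

context linearised
begin

lemma lin_flow_coords: "fst (\<psi> t p) = d + (fst p - d) * exp (- \<alpha> * t)" "snd (\<psi> t p) = snd p * exp t"
  by (simp_all add: lin_flow_def case_prod_unfold)

text \<open>Forward in time p2 is a convex combination of its initial value and d.\<close>

lemma lin_flow_fst_le:
  assumes "t \<ge> 0" "\<bar>fst p\<bar> \<le> K" "\<bar>d\<bar> \<le> K"
  shows "\<bar>fst (\<psi> t p)\<bar> \<le> K"
proof -
  define \<theta> where "\<theta> = exp (- \<alpha> * t)"
  have \<theta>: "0 < \<theta>" "\<theta> \<le> 1" using assms(1) alpha by (auto simp: \<theta>_def)
  have "\<bar>fst (\<psi> t p)\<bar> = \<bar>(1 - \<theta>) * d + \<theta> * fst p\<bar>" by (simp add: lin_flow_coords \<theta>_def algebra_simps)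
  also have "\<dots> \<le> (1 - \<theta>) * \<bar>d\<bar> + \<theta> * \<bar>fst p\<bar>"
    using \<theta> by (intro abs_triangle_ineq[THEN order_trans]) (simp add: abs_mult)
  also have "\<dots> \<le> (1 - \<theta>) * K + \<theta> * K" using \<theta> assms by (intro add_mono mult_left_mono) auto
  finally show ?thesis by (simp add: algebra_simps)
qed

lemma lin_flow_fst_less:
  assumes "t \<ge> 0" "\<bar>fst p\<bar> < K" "\<bar>d\<bar> < K"
  shows "\<bar>fst (\<psi> t p)\<bar> < K"
  using lin_flow_fst_le[OF assms(1), of p "max \<bar>fst p\<bar> \<bar>d\<bar>"] assms by auto

text \<open>Only p3 can carry a linear orbit out of the cross. Away from the outgoing sections the
  relevant bound on p3 is strict, hence survives for a short time.\<close>

lemma W_forward: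
  assumes p: "p \<in> W" "\<bar>snd p\<bar> < 1 / \<epsilon>"
  obtains \<delta> where "\<delta> > 0" "\<And>t. 0 \<le> t \<Longrightarrow> t \<le> \<delta> \<Longrightarrow> \<psi> t p \<in> W"
proof -
  consider "\<bar>fst p\<bar> \<le> \<epsilon>" "\<bar>snd p\<bar> < \<nu>" | "\<bar>fst p\<bar> < \<mu>" using p(1) unfolding mem_W by blast
  then show thesis
  proof cases
    case 1
    obtain \<delta> where "\<delta> > 0" "\<And>t. t \<le> \<delta> \<Longrightarrow> \<bar>snd p\<bar> * exp t < \<nu>"
      using exp_growth_stays_below[of "\<bar>snd p\<bar>" \<nu>] 1 by auto
    then show thesis using that[of \<delta>] 1 lin_flow_fst_le[of _ p \<epsilon>] d_less_eps
      unfolding mem_W by (auto simp: lin_flow_coords(2) abs_mult)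
  next
    case 2
    obtain \<delta> where "\<delta> > 0" "\<And>t. t \<le> \<delta> \<Longrightarrow> \<bar>snd p\<bar> * exp t < 1 / \<epsilon>"
      using exp_growth_stays_below[of "\<bar>snd p\<bar>" "1 / \<epsilon>"] p by auto
    then show thesis using that[of \<delta>] 2 lin_flow_fst_less[of _ p \<mu>] d_less_mu
      unfolding mem_W by (auto simp: lin_flow_coords(2) abs_mult less_imp_le)
  qed
qed

lemma reparametrise_h:
  assumes "u \<in> U" "0 \<le> T" "\<And>t. 0 \<le> t \<Longrightarrow> t \<le> T \<Longrightarrow> \<phi> t u \<in> U"
  obtains \<tau> where "continuous_on {0..T} \<tau>" "strict_mono_on {0..T} \<tau>" "\<tau> 0 = 0"
    "\<And>t. 0 \<le> t \<Longrightarrow> t \<le> T \<Longrightarrow> h (\<phi> t u) = \<psi> (\<tau> t) (h u)"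
  using maps_h assms unfolding maps_orbits_def by (metis atLeastAtMost_iff)

lemma reparametrise_h':
  assumes "p \<in> W" "0 \<le> T" "\<And>t. 0 \<le> t \<Longrightarrow> t \<le> T \<Longrightarrow> \<psi> t p \<in> W"
  obtains \<tau> where "continuous_on {0..T} \<tau>" "strict_mono_on {0..T} \<tau>" "\<tau> 0 = 0"
    "\<And>t. 0 \<le> t \<Longrightarrow> t \<le> T \<Longrightarrow> h' (\<psi> t p) = \<phi> (\<tau> t) (h' p)"
  using maps_h' assms unfolding maps_orbits_def by (metis atLeastAtMost_iff)

lemma strict_mono_on_nonneg:
  fixes \<tau> :: "real \<Rightarrow> real"
  assumes "strict_mono_on {0..T} \<tau>" "\<tau> 0 = 0" "0 \<le> t" "t \<le> T"
  shows "0 \<le> \<tau> t" "0 < t \<Longrightarrow> 0 < \<tau> t"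
proof -
  show "0 < t \<Longrightarrow> 0 < \<tau> t" using assms strict_mono_onD[OF assms(1), of 0 t] by auto
  then show "0 \<le> \<tau> t" using assms by (cases "t = 0") auto
qed

text \<open>Otherwise \<open>h\<close> would carry a full period to a closed arc of the linear flow
  traversed in positive time. The saddle has no closed orbit except its equilibrium, and injectivity
  of \<open>h\<close> would then make v an equilibrium, against the minimality of the
  period.\<close>

lemma periodic_leaves_U:
  assumes v: "v \<in> U" and T: "has_period \<phi> v T"
  shows "\<exists>s\<ge>0. \<phi> s v \<notin> U"
proof (rule ccontr)
  assume "\<not> ?thesis"
  then have in_U: "\<phi> s v \<in> U" if "0 \<le> s" for s using that by blast
  have T0: "T > 0" "\<phi> T v = v" "\<And>t. 0 < t \<Longrightarrow> t < T \<Longrightarrow> \<phi> t v \<noteq> v"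
    using T unfolding has_period_def by auto
  obtain \<tau> where \<tau>: "continuous_on {0..T} \<tau>" "strict_mono_on {0..T} \<tau>" "\<tau> 0 = 0"
    "\<And>t. 0 \<le> t \<Longrightarrow> t \<le> T \<Longrightarrow> h (\<phi> t v) = \<psi> (\<tau> t) (h v)"
    using reparametrise_h[OF v less_imp_le[OF T0(1)]] in_U by metis
  have "\<tau> T > 0" using strict_mono_on_nonneg[OF \<tau>(2,3)] T0 by simp
  have eq: "\<psi> (\<tau> T) (h v) = h v" using \<tau>(4)[of T] T0 by simp
  have "snd (h v) * exp (\<tau> T) = snd (h v)" using arg_cong[OF eq, of snd] by (simp add: lin_flow_coords)
  then have "snd (h v) = 0" using \<open>\<tau> T > 0\<close> by simp
  moreover have "(fst (h v) - d) * exp (- \<alpha> * \<tau> T) = fst (h v) - d"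
    using arg_cong[OF eq, of fst] unfolding lin_flow_coords by linarith
  then have "fst (h v) = d" unfolding mult_cancel_left2 using \<open>\<tau> T > 0\<close> alpha by simp
  ultimately have "\<psi> t (h v) = h v" for t by (intro prod_eqI) (simp_all add: lin_flow_coords)
  then have "h (\<phi> (T/2) v) = h v" using \<tau>(4)[of "T/2"] T0(1) by simp
  then have "\<phi> (T/2) v = v" using h_inj in_U[of "T/2"] v T0(1) by simp
  then show False using T0(3)[of "T/2"] T0(1) by simp
qed

text \<open>Looks at the infimum of the times outside \<open>U\<close>. The hypothesis that the
  orbit stays in \<open>saturate U\<close> excludes an escape through a corner or an open edge of
  the cross, so the only way out is an outgoing section.\<close>

lemma exit_U:
  assumes v: "v \<in> U" and T: "has_period \<phi> v T" and sat: "orbit \<phi> v \<subseteq> saturate U"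
  obtains \<sigma> x s t where "\<bar>\<sigma>\<bar> = 1" "\<bar>x\<bar> < \<mu>" "s \<ge> 0" "t \<ge> 0" "\<phi> s v = act \<sigma> 1 (entry \<sigma> x)"
    "\<psi> t (h v) = (x, \<sigma> / \<epsilon>)"
proof -
  have vS: "v \<in> S2" using v U_S2 by blast
  define B where "B = {s. 0 \<le> s \<and> \<phi> s v \<notin> U}"
  define s1 where "s1 = Inf B"
  have B: "B \<noteq> {}" "bdd_below B" using periodic_leaves_U[OF v T] unfolding B_def by (auto intro: bdd_belowI[of _ 0])
  have s10: "0 \<le> s1" unfolding s1_def using B by (intro cInf_greatest) (auto simp: B_def)
  have before: "\<phi> s v \<in> U" if "0 \<le> s" "s < s1" for s
    using that cInf_lower[OF _ B(2), of s] unfolding s1_def B_def by force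
  \<comment> \<open>The cell is closed, so the limit from inside \<open>U\<close> is still in it;
    together with membership in \<open>saturate U\<close> this returns the exit point to
    \<open>U\<close>.\<close>
  have "\<phi> s1 v \<in> cell \<epsilon>"
  proof (cases "s1 = 0")
    case True
    then show ?thesis using v U_subset_cell vS by auto
  next
    case False
    then have "s1 \<in> closure {0..<s1}" using s10 by simp
    moreover have "\<phi> s v \<in> cell \<epsilon>" if "s \<in> {0..<s1}" for s using before that U_subset_cell by auto
    then have "(\<lambda>s. \<phi> s v) ` closure {0..<s1} \<subseteq> cell \<epsilon>"
      by (intro image_closure_subset flow_cont_time vS closed_cell eps) auto
    ultimately show ?thesis by blast
  qed
  moreover have "\<phi> s1 v \<in> saturate U" using sat by (auto simp: orbit_def)
  ultimately have v1: "\<phi> s1 v \<in> U" using saturate_U_cell by blast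
  then have upto: "\<phi> s v \<in> U" if "0 \<le> s" "s \<le> s1" for s using before that by (cases "s = s1") auto
  define p where "p = h (\<phi> s1 v)"
  have pW: "p \<in> W" using v1 by (simp add: p_def)
  \<comment> \<open>Otherwise \<open>W_forward\<close>, carried back by \<open>h'\<close>, would
    keep the orbit in \<open>U\<close> beyond the infimum.\<close>
  have "\<not> \<bar>snd p\<bar> < 1 / \<epsilon>"
  proof
    assume "\<bar>snd p\<bar> < 1 / \<epsilon>"
    then obtain \<delta> where \<delta>: "\<delta> > 0" "\<And>t. 0 \<le> t \<Longrightarrow> t \<le> \<delta> \<Longrightarrow> \<psi> t p \<in> W" using W_forward[OF pW] by blast
    obtain \<tau> where \<tau>: "continuous_on {0..\<delta>} \<tau>" "strict_mono_on {0..\<delta>} \<tau>" "\<tau> 0 = 0"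
      "\<And>t. 0 \<le> t \<Longrightarrow> t \<le> \<delta> \<Longrightarrow> h' (\<psi> t p) = \<phi> (\<tau> t) (h' p)"
      using reparametrise_h'[OF pW less_imp_le[OF \<delta>(1)] \<delta>(2)] by metis
    have pos: "\<tau> \<delta> > 0" using strict_mono_on_nonneg[OF \<tau>(2,3)] \<delta>(1) by simp
    have "s1 + \<tau> \<delta> \<le> Inf B"
    proof (rule cInf_greatest[OF B(1)])
      fix s assume s: "s \<in> B"
      show "s1 + \<tau> \<delta> \<le> s"
      proof (rule ccontr)
        assume "\<not> s1 + \<tau> \<delta> \<le> s"
        moreover have "s1 \<le> s" unfolding s1_def by (rule cInf_lower[OF s B(2)])
        ultimately have "0 \<le> s - s1" "s - s1 \<le> \<tau> \<delta>" by linarith+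
        then obtain t where t: "0 \<le> t" "t \<le> \<delta>" "\<tau> t = s - s1"
          using strict_mono_reparametrisation[OF \<tau>(1-3) _ _ less_imp_le[OF \<delta>(1)]] by metis
        have "\<phi> s v = \<phi> (s - s1) (\<phi> s1 v)" using flow_add[OF vS, of "s - s1" s1] by simp
        also have "\<dots> = h' (\<psi> t p)" using \<tau>(4)[OF t(1,2)] t(3) v1 by (simp add: p_def)
        also have "\<dots> \<in> U" using \<delta>(2)[OF t(1,2)] by simp
        finally show False using s by (simp add: B_def)
      qed
    qed
    then show False using pos by (simp add: s1_def)
  qed
  then have "\<bar>snd p\<bar> = 1 / \<epsilon>" using pW inv_eps unfolding mem_W by auto
  define \<sigma> where "\<sigma> = sgn (snd p)"
  have \<sigma>: "\<bar>\<sigma>\<bar> = 1" "snd p = \<sigma> / \<epsilon>"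
    using \<open>\<bar>snd p\<bar> = 1 / \<epsilon>\<close> eps by (auto simp: \<sigma>_def sgn_if abs_if split: if_splits)
  obtain x where x: "\<bar>x\<bar> < \<mu>" "\<phi> s1 v = act \<sigma> 1 (entry \<sigma> x)" "h (\<phi> s1 v) = (x, \<sigma> / \<epsilon>)"
    using section_out_entry[OF \<sigma>(1) v1] \<sigma>(2) unfolding p_def by metis
  obtain \<tau> where \<tau>: "strict_mono_on {0..s1} \<tau>" "\<tau> 0 = 0" "h (\<phi> s1 v) = \<psi> (\<tau> s1) (h v)"
    using reparametrise_h[OF v s10 upto] s10 by (metis order_refl)
  have "\<tau> s1 \<ge> 0" using strict_mono_on_nonneg[OF \<tau>(1,2)] s10 by simp
  then show thesis using that \<sigma>(1) x s10 \<tau>(3) by metis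
qed

definition F :: "real \<Rightarrow> real \<Rightarrow> real" where
  "F \<sigma> x = d + (\<sigma> * \<epsilon> - d) * (\<epsilon>\<^sup>2 * \<bar>x\<bar>) powr \<alpha>"

text \<open>The time in which |p3| grows from \<epsilon> |x| at the incoming section to 1/\<epsilon>
  at the outgoing one.\<close>

definition transit_time :: "real \<Rightarrow> real" where
  "transit_time x = - ln (\<epsilon>\<^sup>2 * \<bar>x\<bar>)"

lemma exp_transit_time: "x \<noteq> 0 \<Longrightarrow> exp (- transit_time x) = \<epsilon>\<^sup>2 * \<bar>x\<bar>"
  using eps by (simp add: transit_time_def)

lemma exp_transit_time_alpha: "x \<noteq> 0 \<Longrightarrow> exp (- \<alpha> * transit_time x) = (\<epsilon>\<^sup>2 * \<bar>x\<bar>) powr \<alpha>"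
  using eps by (simp add: transit_time_def powr_def)

lemma lin_exit:
  assumes "\<bar>\<sigma>\<bar> = 1" "x \<noteq> 0"
  shows "\<psi> (transit_time x) (\<sigma> * \<epsilon>, \<sigma> * \<epsilon> * x) = (F \<sigma> x, \<sigma> * sgn x / \<epsilon>)"
proof -
  have "exp (transit_time x) = 1 / (\<epsilon>\<^sup>2 * \<bar>x\<bar>)"
    unfolding exp_transit_time[OF assms(2), symmetric] by (simp add: exp_minus inverse_eq_divide)
  then have "\<sigma> * \<epsilon> * x * exp (transit_time x) = \<sigma> * sgn x / \<epsilon>"
    using assms eps by (simp add: power2_eq_square sgn_if)
  then show ?thesis using exp_transit_time_alpha[OF assms(2)]
    by (intro prod_eqI) (simp_all add: lin_flow_coords F_def)
qed

text \<open>The time at which an outgoing section is met is unknown beforehand; it is determined by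
  p3, which is a nonzero multiple of exp t.\<close>

lemma lin_exit_unique:
  assumes "\<bar>\<sigma>\<bar> = 1" "\<bar>\<sigma>'\<bar> = 1" "\<psi> t (\<sigma> * \<epsilon>, \<sigma> * \<epsilon> * x) = (x', \<sigma>' / \<epsilon>)"
  shows "x \<noteq> 0" "\<sigma>' = \<sigma> * sgn x" "x' = F \<sigma> x"
proof -
  have s: "\<sigma> * \<epsilon> * x * exp t = \<sigma>' / \<epsilon>" using arg_cong[OF assms(3), of snd] by (simp add: lin_flow_coords)
  then show x: "x \<noteq> 0" using assms(2) eps by auto
  have "sgn (\<sigma> * \<epsilon> * x * exp t) = sgn (\<sigma>' / \<epsilon>)" using s by simp
  moreover have "sgn \<sigma> = \<sigma>" "sgn \<sigma>' = \<sigma>'" using assms by (auto simp: sgn_if abs_if split: if_splits)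
  ultimately show \<sigma>': "\<sigma>' = \<sigma> * sgn x" using eps by (simp add: sgn_mult sgn_divide)
  have "snd (\<psi> t (\<sigma> * \<epsilon>, \<sigma> * \<epsilon> * x)) = snd (\<psi> (transit_time x) (\<sigma> * \<epsilon>, \<sigma> * \<epsilon> * x))"
    unfolding lin_exit[OF assms(1) x] assms(3) \<sigma>' by simp
  then have "t = transit_time x" using x assms(1) eps by (auto simp: lin_flow_coords)
  then show "x' = F \<sigma> x" using assms(3) lin_exit[OF assms(1) x] by simp
qed

lemma sgn_abs_1: "\<bar>\<sigma>\<bar> = 1 \<Longrightarrow> x \<noteq> 0 \<Longrightarrow> \<bar>\<sigma> * sgn x\<bar> = 1" for \<sigma> x :: real
  by (simp add: abs_mult)

context
  fixes u T
  assumes u: "u \<in> S2" and T: "has_period \<phi> u T" and sat: "orbit \<phi> u \<subseteq> saturate U"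
begin

text \<open>Moves an arc in an arbitrary copy of the cell to the cell of \<open>e 1\<close>, where
  \<open>h\<close> is available, keeping period and containment; the last conclusion moves the
  result back.\<close>

lemma pull_back_to_U:
  assumes "\<bar>\<tau>\<bar> = 1" "v \<in> U" "act \<tau> k v \<in> orbit \<phi> u"
  shows "has_period \<phi> v T" "orbit \<phi> v \<subseteq> saturate U" "act \<tau> k (\<phi> s v) \<in> orbit \<phi> u"
proof -
  define w where "w = act \<tau> k v"
  have wS: "w \<in> S2" and vw: "v = act \<tau> (2 * k) w"
    unfolding w_def using assms by (simp_all only: act_inverse act_S2 U_S2)
  have w: "w \<in> orbit \<phi> u" using assms(3) by (simp add: w_def)
  show "has_period \<phi> v T"
    unfolding vw by (rule has_period_act[OF wS has_period_orbit[OF u T w] assms(1)])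
  have "orbit \<phi> v = act \<tau> (2 * k) ` orbit \<phi> u"
    unfolding vw orbit_act[OF assms(1) wS] orbit_eq[OF u w] ..
  then show "orbit \<phi> v \<subseteq> saturate U" using sat saturate_closed_act[OF assms(1)] by auto
  show "act \<tau> k (\<phi> s v) \<in> orbit \<phi> u"
    using orbit_flow[OF u w, of s] flow_act[OF assms(1) U_S2[OF assms(2)], of s k] by (simp add: w_def)
qed

lemma first_state:
  obtains \<tau> k \<sigma> x where "\<bar>\<tau>\<bar> = 1" "\<bar>\<sigma>\<bar> = 1" "\<bar>x\<bar> < \<mu>" "act \<tau> k (entry \<sigma> x) \<in> orbit \<phi> u"
proof -
  obtain \<tau> k v where v: "\<bar>\<tau>\<bar> = 1" "v \<in> U" "u = act \<tau> k v"
    using orbit_self[OF u] sat unfolding mem_saturate[of _ U, abs_def] mem_saturate by (metis image_iff mem_saturate subsetD)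
  have "act \<tau> k v \<in> orbit \<phi> u" using v orbit_self[OF u] by simp
  note pb = pull_back_to_U[OF v(1,2) this]
  obtain \<sigma> x s where "\<bar>\<sigma>\<bar> = 1" "\<bar>x\<bar> < \<mu>" "\<phi> s v = act \<sigma> 1 (entry \<sigma> x)"
    using exit_U[OF v(2) pb(1,2)] by metis
  then show thesis using pb(3)[of s] that[of "\<tau> * \<sigma>" \<sigma> x "k + 1"] v(1) by (simp add: act_act abs_mult)
qed

text \<open>A periodic orbit must leave the cell again, so x = 0 is impossible: such an entry lies
  on the stable manifold, which reaches no outgoing section.\<close>

lemma next_state:
  assumes "\<bar>\<tau>\<bar> = 1" "\<bar>\<sigma>\<bar> = 1" "\<bar>x\<bar> < \<mu>" "act \<tau> k (entry \<sigma> x) \<in> orbit \<phi> u"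
  shows "x \<noteq> 0" "\<bar>F \<sigma> x\<bar> < \<mu>" "act (\<tau> * (\<sigma> * sgn x)) (k + 1) (entry (\<sigma> * sgn x) (F \<sigma> x)) \<in> orbit \<phi> u"
proof -
  note E = entry[OF assms(2,3)]
  note pb = pull_back_to_U[OF assms(1) E(1) assms(4)]
  obtain \<sigma>' x' s t where *: "\<bar>\<sigma>'\<bar> = 1" "\<bar>x'\<bar> < \<mu>" "\<phi> s (entry \<sigma> x) = act \<sigma>' 1 (entry \<sigma>' x')"
    "\<psi> t (h (entry \<sigma> x)) = (x', \<sigma>' / \<epsilon>)"
    using exit_U[OF E(1) pb(1,2)] by metis
  note lu = lin_exit_unique[OF assms(2) *(1) *(4)[unfolded E(3)]]
  show "x \<noteq> 0" by (rule lu)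
  show "\<bar>F \<sigma> x\<bar> < \<mu>" using lu *(2) by simp
  show "act (\<tau> * (\<sigma> * sgn x)) (k + 1) (entry (\<sigma> * sgn x) (F \<sigma> x)) \<in> orbit \<phi> u"
    using pb(3)[of s] lu *(3) by (simp add: act_act)
qed

end

end

section \<open>Passages with small entry parameter, and the interior of a cell\<close>

context linearised
begin

definition passage :: "real \<Rightarrow> real \<Rightarrow> (real \<times> real) set" where
  "passage \<sigma> x = (\<lambda>t. \<psi> t (\<sigma> * \<epsilon>, \<sigma> * \<epsilon> * x)) ` {0..transit_time x}"

text \<open>Stated through \<open>h\<close>, where passages are explicit. \<open>U_int_chart\<close>
  shows that it is also the part of \<open>U\<close> in the interior of the cell, which gives
  openness in the sphere and separates it from all other copies.\<close>

definition U_int :: "(real^3) set" where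
  "U_int = {u \<in> U. \<bar>fst (h u)\<bar> < \<epsilon> \<and> \<bar>snd (h u)\<bar> < 1 / \<epsilon>}"

lemma two_d_less_mu: "2 * \<bar>d\<bar> < \<mu>"
proof (rule ccontr)
  assume "\<not> 2 * \<bar>d\<bar> < \<mu>"
  then have "1 \<le> 2 * \<bar>d\<bar> / \<mu>" using mu by (simp add: field_simps)
  then have "1 \<le> (2 * \<bar>d\<bar> / \<mu>) powr \<alpha>" using alpha by (simp add: ge_one_powr_ge_zero)
  then have "2 * \<epsilon> * 1 \<le> 2 * \<epsilon> * (2 * \<bar>d\<bar> / \<mu>) powr \<alpha>" using eps by (intro mult_left_mono) auto
  then show False using small mu_eps eps by linarith
qed

text \<open>When the orbit leaves the horizontal arm, |x| exp t has reached \<mu>, so exp (- t) is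
  at most 2 |d| / \<mu>. By then p2 differs from d by at most 2 \<epsilon> (2 |d| / \<mu>) powr
  \<alpha>, and \<open>small\<close> puts it into the vertical arm.\<close>

lemma path_in_W:
  assumes \<sigma>: "\<bar>\<sigma>\<bar> = 1" and x: "x \<noteq> 0" "\<bar>x\<bar> < 2 * \<bar>d\<bar>" and t: "0 \<le> t" "t \<le> transit_time x"
  shows "\<psi> t (\<sigma> * \<epsilon>, \<sigma> * \<epsilon> * x) \<in> W"
proof -
  let ?p = "(\<sigma> * \<epsilon>, \<sigma> * \<epsilon> * x)"
  have snd: "\<bar>snd (\<psi> t ?p)\<bar> = \<epsilon> * (\<bar>x\<bar> * exp t)" using \<sigma> eps by (simp add: lin_flow_coords abs_mult)
  have se: "\<bar>\<sigma> * \<epsilon>\<bar> = \<epsilon>" using \<sigma> eps by (simp add: abs_mult)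
  have "exp t * (\<epsilon>\<^sup>2 * \<bar>x\<bar>) \<le> 1"
    using t(2) unfolding exp_transit_time[OF x(1), symmetric] by (simp flip: exp_add)
  then have "\<epsilon> * (\<bar>x\<bar> * exp t) \<le> 1 / \<epsilon>" using eps by (simp add: field_simps power2_eq_square)
  moreover have "\<bar>fst (\<psi> t ?p)\<bar> \<le> \<epsilon>" using lin_flow_fst_le[OF t(1), of ?p \<epsilon>] se d_less_eps by simp
  moreover have "\<bar>fst (\<psi> t ?p)\<bar> < \<mu>" if "\<not> \<epsilon> * (\<bar>x\<bar> * exp t) < \<nu>"
  proof -
    have "\<mu> \<le> \<bar>x\<bar> * exp t" using that eps unfolding nu by simp
    then have "exp (- t) \<le> \<bar>x\<bar> / \<mu>" using mu by (simp add: exp_minus field_simps)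
    also have "\<dots> \<le> 2 * \<bar>d\<bar> / \<mu>" using x mu by (intro divide_right_mono) auto
    finally have "exp (- t) powr \<alpha> \<le> (2 * \<bar>d\<bar> / \<mu>) powr \<alpha>" using alpha by (intro powr_mono2) auto
    then have ex: "exp (- \<alpha> * t) \<le> (2 * \<bar>d\<bar> / \<mu>) powr \<alpha>" by (simp add: powr_def mult.commute)
    have "\<bar>fst (\<psi> t ?p)\<bar> \<le> \<bar>d\<bar> + \<bar>\<sigma> * \<epsilon> - d\<bar> * exp (- \<alpha> * t)"
      unfolding lin_flow_coords by (rule order_trans[OF abs_triangle_ineq]) (simp add: abs_mult)
    also have "\<bar>\<sigma> * \<epsilon> - d\<bar> * exp (- \<alpha> * t) \<le> (2 * \<epsilon>) * (2 * \<bar>d\<bar> / \<mu>) powr \<alpha>"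
      using se d_less_eps eps ex by (intro mult_mono) auto
    finally show ?thesis using small by simp
  qed
  ultimately show ?thesis unfolding mem_W snd by blast
qed

lemma path_interior:
  assumes \<sigma>: "\<bar>\<sigma>\<bar> = 1" and x: "x \<noteq> 0" and t: "0 < t" "t < transit_time x"
  shows "\<bar>fst (\<psi> t (\<sigma> * \<epsilon>, \<sigma> * \<epsilon> * x))\<bar> < \<epsilon>" "\<bar>snd (\<psi> t (\<sigma> * \<epsilon>, \<sigma> * \<epsilon> * x))\<bar> < 1 / \<epsilon>"
proof -
  have "exp t * (\<epsilon>\<^sup>2 * \<bar>x\<bar>) < 1"
    using t(2) unfolding exp_transit_time[OF x(1), symmetric] by (simp flip: exp_add)
  then show "\<bar>snd (\<psi> t (\<sigma> * \<epsilon>, \<sigma> * \<epsilon> * x))\<bar> < 1 / \<epsilon>"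
    using eps \<sigma> by (simp add: lin_flow_coords abs_mult field_simps power2_eq_square)
  define \<theta> where "\<theta> = exp (- \<alpha> * t)"
  have \<theta>: "0 < \<theta>" "\<theta> < 1" using t(1) alpha by (auto simp: \<theta>_def)
  have "\<bar>fst (\<psi> t (\<sigma> * \<epsilon>, \<sigma> * \<epsilon> * x))\<bar> = \<bar>(1 - \<theta>) * d + \<theta> * (\<sigma> * \<epsilon>)\<bar>"
    by (simp add: lin_flow_coords \<theta>_def algebra_simps)
  also have "\<dots> \<le> \<bar>(1 - \<theta>) * d\<bar> + \<bar>\<theta> * (\<sigma> * \<epsilon>)\<bar>" by (rule abs_triangle_ineq)
  also have "\<dots> = (1 - \<theta>) * \<bar>d\<bar> + \<theta> * \<epsilon>" using \<theta> \<sigma> eps by (simp add: abs_mult)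
  also have "\<dots> < (1 - \<theta>) * \<epsilon> + \<theta> * \<epsilon>" using \<theta> d_less_eps by (intro add_strict_right_mono mult_strict_left_mono) auto
  finally show "\<bar>fst (\<psi> t (\<sigma> * \<epsilon>, \<sigma> * \<epsilon> * x))\<bar> < \<epsilon>" by (simp add: algebra_simps)
qed

lemma transit_time_pos:
  assumes "x \<noteq> 0" "\<bar>x\<bar> < 2 * \<bar>d\<bar>"
  shows "0 < transit_time x"
proof -
  have "\<bar>x\<bar> < 1" using assms two_d_less_mu mu_eps eps by linarith
  moreover have "\<epsilon>\<^sup>2 < 1" using eps_sq eps by linarith
  ultimately have "\<epsilon>\<^sup>2 * \<bar>x\<bar> < 1 * 1" using assms by (intro mult_strict_mono) auto
  then show ?thesis using assms eps by (simp add: transit_time_def)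
qed

text \<open>The counterpart of \<open>exit_U\<close>: here the linear passage is known and is
  carried back by \<open>h'\<close>. The time R comes from an unknown reparametrisation, so only its
  sign, the end point and the set of points traversed are recorded.\<close>

lemma transit:
  assumes \<sigma>: "\<bar>\<sigma>\<bar> = 1" and x: "x \<noteq> 0" "\<bar>x\<bar> < 2 * \<bar>d\<bar>"
  obtains R where "R > 0" "\<phi> R (entry \<sigma> x) = act (\<sigma> * sgn x) 1 (entry (\<sigma> * sgn x) (F \<sigma> x))"
    "\<bar>F \<sigma> x\<bar> < \<mu>" "(\<lambda>s. \<phi> s (entry \<sigma> x)) ` {0..R} = h' ` passage \<sigma> x"
    "\<And>s. 0 < s \<Longrightarrow> s < R \<Longrightarrow> \<phi> s (entry \<sigma> x) \<in> U_int"
proof -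
  let ?p = "(\<sigma> * \<epsilon>, \<sigma> * \<epsilon> * x)" and ?T = "transit_time x" and ?\<sigma>' = "\<sigma> * sgn x"
  have xmu: "\<bar>x\<bar> < \<mu>" using x two_d_less_mu by linarith
  have T0: "0 < ?T" by (rule transit_time_pos[OF x])
  note pW = path_in_W[OF \<sigma> x]
  have p0: "?p \<in> W" using entry_coord_W(2)[OF \<sigma> xmu] .
  obtain \<tau> where \<tau>: "continuous_on {0..?T} \<tau>" "strict_mono_on {0..?T} \<tau>" "\<tau> 0 = 0"
    "\<And>t. 0 \<le> t \<Longrightarrow> t \<le> ?T \<Longrightarrow> h' (\<psi> t ?p) = \<phi> (\<tau> t) (entry \<sigma> x)"
    using reparametrise_h'[OF p0 less_imp_le[OF T0] pW] unfolding entry_def by metis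
  have R0: "\<tau> ?T > 0" using strict_mono_on_nonneg[OF \<tau>(2,3)] T0 by simp
  have \<sigma>': "\<bar>?\<sigma>'\<bar> = 1" by (rule sgn_abs_1[OF \<sigma> x(1)])
  have FW: "(F \<sigma> x, ?\<sigma>' / \<epsilon>) \<in> W" using pW[of ?T] T0 lin_exit[OF \<sigma> x(1)] by simp
  have "\<bar>?\<sigma>' / \<epsilon>\<bar> = 1 / \<epsilon>" using \<sigma>' eps by simp
  then have Fmu: "\<bar>F \<sigma> x\<bar> < \<mu>" using FW inv_eps unfolding mem_W by auto
  show thesis
  proof (rule that[of "\<tau> ?T"])
    have "\<phi> (\<tau> ?T) (entry \<sigma> x) = h' (F \<sigma> x, ?\<sigma>' / \<epsilon>)"
      using \<tau>(4)[of ?T] T0 lin_exit[OF \<sigma> x(1)] by simp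
    also have "\<dots> = act ?\<sigma>' 1 (entry ?\<sigma>' (F \<sigma> x))"
      using h_inv(1)[OF entry(4)[OF \<sigma>' Fmu]] entry(5)[OF \<sigma>' Fmu] by simp
    finally show "\<phi> (\<tau> ?T) (entry \<sigma> x) = act ?\<sigma>' 1 (entry ?\<sigma>' (F \<sigma> x))" .
    have repar: "\<exists>t. 0 \<le> t \<and> t \<le> ?T \<and> \<tau> t = s \<and> (0 < s \<longrightarrow> 0 < t) \<and> (s < \<tau> ?T \<longrightarrow> t < ?T)"
      if "0 \<le> s" "s \<le> \<tau> ?T" for s
      using strict_mono_reparametrisation[OF \<tau>(1-3) that less_imp_le[OF T0]] by metis
    show "(\<lambda>s. \<phi> s (entry \<sigma> x)) ` {0..\<tau> ?T} = h' ` passage \<sigma> x"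
    proof
      show "(\<lambda>s. \<phi> s (entry \<sigma> x)) ` {0..\<tau> ?T} \<subseteq> h' ` passage \<sigma> x"
      proof
        fix y assume "y \<in> (\<lambda>s. \<phi> s (entry \<sigma> x)) ` {0..\<tau> ?T}"
        then obtain s where s: "0 \<le> s" "s \<le> \<tau> ?T" "y = \<phi> s (entry \<sigma> x)" by auto
        obtain t where "0 \<le> t" "t \<le> ?T" "\<tau> t = s" using repar[OF s(1,2)] by blast
        then have "y = h' (\<psi> t ?p)" "\<psi> t ?p \<in> passage \<sigma> x" using \<tau>(4)[of t] s by (auto simp: passage_def)
        then show "y \<in> h' ` passage \<sigma> x" by blast
      qed
      show "h' ` passage \<sigma> x \<subseteq> (\<lambda>s. \<phi> s (entry \<sigma> x)) ` {0..\<tau> ?T}"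
      proof
        fix y assume "y \<in> h' ` passage \<sigma> x"
        then obtain t where t: "0 \<le> t" "t \<le> ?T" "y = h' (\<psi> t ?p)" by (auto simp: passage_def)
        have "\<tau> t \<le> \<tau> ?T"
          using strict_mono_on_leD[OF \<tau>(2), of t ?T] t T0 by auto
        moreover have "0 \<le> \<tau> t" using strict_mono_on_nonneg[OF \<tau>(2,3)] t by simp
        ultimately show "y \<in> (\<lambda>s. \<phi> s (entry \<sigma> x)) ` {0..\<tau> ?T}" using \<tau>(4)[OF t(1,2)] t(3) by auto
      qed
    qed
    fix s assume s: "0 < s" "s < \<tau> ?T"
    then obtain t where t: "0 < t" "t < ?T" "\<tau> t = s" using repar[of s] by force
    then have "\<phi> s (entry \<sigma> x) = h' (\<psi> t ?p)" using \<tau>(4)[of t] by simp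
    then show "\<phi> s (entry \<sigma> x) \<in> U_int"
      unfolding U_int_def using pW[of t] t path_interior[OF \<sigma> x(1) t(1,2)] by simp
  qed (fact R0 Fmu)+
qed

lemma entry_chart_snd: "\<bar>\<sigma>\<bar> = 1 \<Longrightarrow> \<bar>x\<bar> < \<mu> \<Longrightarrow> \<bar>snd (chart (entry \<sigma> x))\<bar> < \<nu>"
  using chart_U[OF entry(1)[of \<sigma> x]] entry(2)[of \<sigma> x] mu_eps eps unfolding mem_W by (auto simp: abs_mult)

lemma abs_eq_cases: "\<bar>a\<bar> = K \<Longrightarrow> \<exists>\<sigma>. \<bar>\<sigma>\<bar> = 1 \<and> a = \<sigma> * K" for a K :: real
  by (intro exI[of _ "if a < 0 then -1 else 1"]) auto

text \<open>Since \<open>h\<close> is injective and maps each section onto the corresponding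
  section, a point lies on a section in the chart exactly when its image lies on one in the linear
  coordinates.\<close>

lemma U_int_chart:
  assumes u: "u \<in> U"
  shows "u \<in> U_int \<longleftrightarrow> \<bar>fst (chart u)\<bar> < \<epsilon> \<and> \<bar>snd (chart u)\<bar> < 1 / \<epsilon>"
proof -
  have le: "\<bar>fst p\<bar> \<le> \<epsilon> \<and> \<bar>snd p\<bar> \<le> 1 / \<epsilon>" if "p \<in> W" for p
    using that mu_eps eps inv_eps unfolding mem_W by auto
  have "\<bar>fst (chart u)\<bar> = \<epsilon> \<longleftrightarrow> \<bar>fst (h u)\<bar> = \<epsilon>"
  proof
    assume "\<bar>fst (chart u)\<bar> = \<epsilon>"
    then obtain \<sigma> where \<sigma>: "\<bar>\<sigma>\<bar> = 1" "fst (chart u) = \<sigma> * \<epsilon>" using abs_eq_cases by blast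
    then obtain x where "\<bar>x\<bar> < \<mu>" "u = entry \<sigma> x" using section_in_entry u by metis
    then show "\<bar>fst (h u)\<bar> = \<epsilon>" using entry(3)[OF \<sigma>(1)] \<sigma> eps by (simp add: abs_mult)
  next
    assume a: "\<bar>fst (h u)\<bar> = \<epsilon>"
    then obtain \<sigma> where \<sigma>: "\<bar>\<sigma>\<bar> = 1" "fst (h u) = \<sigma> * \<epsilon>" using abs_eq_cases by blast
    have "\<bar>snd (h u)\<bar> < \<nu>" using h_inv(3)[OF u] a mu_eps eps unfolding mem_W by auto
    then have "h u \<in> h ` {u \<in> U. fst (chart u) = \<sigma> * \<epsilon>}"
      unfolding sections_in[OF \<sigma>(1)] using \<sigma>(2) by (cases "h u") auto
    then obtain v where "v \<in> U" "fst (chart v) = \<sigma> * \<epsilon>" "h u = h v" by auto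
    then show "\<bar>fst (chart u)\<bar> = \<epsilon>" using h_inj u \<sigma> eps by (metis abs_mult abs_of_pos mult_1)
  qed
  moreover have "\<bar>snd (chart u)\<bar> = 1 / \<epsilon> \<longleftrightarrow> \<bar>snd (h u)\<bar> = 1 / \<epsilon>"
  proof
    assume "\<bar>snd (chart u)\<bar> = 1 / \<epsilon>"
    then obtain \<sigma> where \<sigma>: "\<bar>\<sigma>\<bar> = 1" "snd (chart u) = \<sigma> / \<epsilon>" using abs_eq_cases by (metis times_divide_eq_right mult_1_right)
    then obtain x where "h u = (x, \<sigma> / \<epsilon>)" using section_out_entry u by metis
    then show "\<bar>snd (h u)\<bar> = 1 / \<epsilon>" using \<sigma> eps by simp
  next
    assume "\<bar>snd (h u)\<bar> = 1 / \<epsilon>"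
    then obtain \<sigma> where \<sigma>: "\<bar>\<sigma>\<bar> = 1" "snd (h u) = \<sigma> / \<epsilon>" using abs_eq_cases by (metis times_divide_eq_right mult_1_right)
    then obtain x where x: "\<bar>x\<bar> < \<mu>" "h u = (x, \<sigma> / \<epsilon>)" using section_out_entry u by metis
    then have "h u \<in> h ` {u \<in> U. snd (chart u) = \<sigma> / \<epsilon>}" unfolding sections_out[OF \<sigma>(1)] by auto
    then obtain v where "v \<in> U" "snd (chart v) = \<sigma> / \<epsilon>" "h u = h v" by auto
    then show "\<bar>snd (chart u)\<bar> = 1 / \<epsilon>" using h_inj u \<sigma> eps by (metis abs_divide abs_of_pos)
  qed
  ultimately show ?thesis
    using le[OF h_inv(3)[OF u]] le[OF chart_U[OF u]] u unfolding U_int_def by auto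
qed

lemma openin_U_int: "openin (top_of_set S2) U_int"
proof -
  define G where "G = {u :: real^3. 0 < u$1} \<inter> {u. \<bar>u$2\<bar> < \<epsilon> * u$1} \<inter> {u. \<epsilon> * \<bar>u$3\<bar> < u$1}"
  have "open G" unfolding G_def by (intro open_Int open_Collect_less continuous_intros) 
  obtain O1 where O1: "open O1" "U = cell \<epsilon> \<inter> O1" using U_cell by (auto simp: openin_open)
  have "u \<in> U_int \<longleftrightarrow> u \<in> S2 \<inter> (G \<inter> O1)" for u
  proof -
    have "u \<in> G \<longleftrightarrow> 0 < u$1 \<and> \<bar>fst (chart u)\<bar> < \<epsilon> \<and> \<bar>snd (chart u)\<bar> < 1 / \<epsilon>"
      using eps by (auto simp: G_def chart_def field_simps)
    moreover have "u \<in> U \<Longrightarrow> 0 < u$1" using U_subset_cell by (auto simp: cell_def)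
    moreover have "u \<in> S2 \<Longrightarrow> u \<in> G \<Longrightarrow> u \<in> cell \<epsilon>" unfolding cell_iff[OF eps(1)] G_def by auto
    ultimately show ?thesis using U_int_chart[of u] O1 U_S2[of u] unfolding U_int_def by auto
  qed
  then have "U_int = S2 \<inter> (G \<inter> O1)" by blast
  then show ?thesis using \<open>open G\<close> O1 by (simp add: openin_open_Int open_Int)
qed

lemma U_int_act:
  assumes "v \<in> U_int" "\<bar>\<tau>\<bar> = 1" "act \<tau> k v \<in> cell \<epsilon>"
  shows "k mod 3 = 0 \<and> \<tau> = 1"
proof -
  have v: "v \<in> U" using assms by (auto simp: U_int_def)
  then have c: "\<bar>fst (chart v)\<bar> < \<epsilon>" "\<bar>snd (chart v)\<bar> < 1 / \<epsilon>" using U_int_chart assms(1) by auto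
  have "\<bar>\<tau> * \<epsilon>\<bar> = \<epsilon>" "\<bar>\<tau> / \<epsilon>\<bar> = 1 / \<epsilon>" using assms(2) eps by (auto simp: abs_mult)
  then show ?thesis
    using cell_act_cell[of \<epsilon> v \<tau> k] eps v U_subset_cell assms(2,3) c by force
qed

lemma entry_not_interior:
  assumes "\<bar>\<tau>\<bar> = 1" "\<bar>\<tau>'\<bar> = 1" "\<bar>\<sigma>\<bar> = 1" "\<bar>x\<bar> < \<mu>" "v \<in> U_int"
  shows "act \<tau> k (entry \<sigma> x) \<noteq> act \<tau>' k' v"
proof
  assume eq: "act \<tau> k (entry \<sigma> x) = act \<tau>' k' v"
  have "entry \<sigma> x = act \<tau> (2 * k) (act \<tau>' k' v)" using eq act_inverse[OF assms(1)] by metis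
  then have e: "entry \<sigma> x = act (\<tau> * \<tau>') (2 * k + k') v" by (simp add: act_act)
  have t: "\<bar>\<tau> * \<tau>'\<bar> = 1" using assms by (simp add: abs_mult)
  have "(2 * k + k') mod 3 = 0 \<and> \<tau> * \<tau>' = 1"
    using U_int_act[OF assms(5) t] entry(1)[OF assms(3,4)] U_subset_cell e by auto
  then have "entry \<sigma> x = v" unfolding e by (subst act_mod) simp
  then have "\<bar>\<sigma> * \<epsilon>\<bar> < \<epsilon>" using assms(5) entry(3)[OF assms(3,4)] by (simp add: U_int_def)
  then show False using assms(3) eps by (simp add: abs_mult)
qed

text \<open>An entry point lies on the incoming side with |p3| < \<nu>, hence not on an outgoing
  side, and \<open>cell_act_cell\<close> leaves only the trivial relative group element. The point
  thus remembers its group element and its sign, which is what minimality of periods rests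
  on.\<close>

lemma entry_free:
  assumes "\<bar>\<tau>\<bar> = 1" "\<bar>\<tau>'\<bar> = 1" "\<bar>\<sigma>\<bar> = 1" "\<bar>x\<bar> < \<mu>" "\<bar>\<sigma>'\<bar> = 1" "\<bar>x'\<bar> < \<mu>"
    and eq: "act \<tau> k (entry \<sigma> x) = act \<tau>' k' (entry \<sigma>' x')"
  shows "\<tau> = \<tau>'" "k mod 3 = k' mod 3" "\<sigma> = \<sigma>'"
proof -
  let ?v = "entry \<sigma> x" and ?\<tau> = "\<tau>' * \<tau>" and ?k = "2 * k' + k"
  note E = entry[OF assms(3,4)] and E' = entry[OF assms(5,6)]
  have "entry \<sigma>' x' = act \<tau>' (2 * k') (act \<tau> k ?v)" using eq act_inverse[OF assms(2)] by metis
  then have e: "entry \<sigma>' x' = act ?\<tau> ?k ?v" by (simp add: act_act)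
  have t: "\<bar>?\<tau>\<bar> = 1" using assms by (simp add: abs_mult)
  have "?k mod 3 = 0 \<and> ?\<tau> = 1 \<or> ?k mod 3 = 1 \<and> fst (chart ?v) = ?\<tau> * \<epsilon> \<or> ?k mod 3 = 2 \<and> snd (chart ?v) = ?\<tau> / \<epsilon>"
    using eps U_subset_cell E(1) E'(1) e t by (intro cell_act_cell) auto
  moreover have "\<not> (?k mod 3 = 1 \<and> fst (chart ?v) = ?\<tau> * \<epsilon>)"
  proof
    assume a: "?k mod 3 = 1 \<and> fst (chart ?v) = ?\<tau> * \<epsilon>"
    then have "?\<tau> = \<sigma>" using E(2) eps by simp
    then have "entry \<sigma>' x' = act \<sigma> 1 ?v" unfolding e using a by (subst act_mod) simp
    then have "(x, \<sigma> / \<epsilon>) = (\<sigma>' * \<epsilon>, \<sigma>' * \<epsilon> * x')" using E(5) E'(3) by metis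
    then have "\<bar>x\<bar> = \<epsilon>" using assms(5) eps by (simp add: abs_mult)
    then show False using assms(4) mu_eps eps by linarith
  qed
  moreover have "\<not> (?k mod 3 = 2 \<and> snd (chart ?v) = ?\<tau> / \<epsilon>)"
  proof
    assume a: "?k mod 3 = 2 \<and> snd (chart ?v) = ?\<tau> / \<epsilon>"
    then have "\<bar>snd (chart ?v)\<bar> = 1 / \<epsilon>" using t eps by simp
    then show False using entry_chart_snd[OF assms(3,4)] inv_eps by linarith
  qed
  ultimately have 0: "?k mod 3 = 0" "?\<tau> = 1" by blast+
  then show "k mod 3 = k' mod 3" by presburger
  show "\<tau> = \<tau>'" using 0(2) assms(1,2) by (auto simp: abs_if split: if_splits)
  have "entry \<sigma>' x' = ?v" unfolding e using 0 by (subst act_mod) simp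
  then show "\<sigma> = \<sigma>'" using E(2) E'(2) eps by simp
qed

end

section \<open>Distances to the poles\<close>

context linearised
begin

lemma U_coords:
  assumes "v \<in> U"
  shows "0 < v$1" "\<bar>v$2\<bar> \<le> \<epsilon> * v$1" "(v$1)\<^sup>2 + (v$2)\<^sup>2 + (v$3)\<^sup>2 = 1" "v$1 \<le> 1"
proof -
  show v1: "0 < v$1" and "\<bar>v$2\<bar> \<le> \<epsilon> * v$1"
    using assms U_subset_cell cell_iff[OF eps(1)] by (auto simp: cell_def)
  show n: "(v$1)\<^sup>2 + (v$2)\<^sup>2 + (v$3)\<^sup>2 = 1"
    using U_S2[OF assms] by (simp add: norm_eq_sqrt_inner inner_3 power2_eq_square)
  then have "(v$1)\<^sup>2 \<le> 1" by (smt (verit) zero_le_power2)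
  then show "v$1 \<le> 1" using v1 by (simp add: abs_square_le_1)
qed

text \<open>The squared chord is 2 - 2 v1, which is at most 2 (1 - v1^2) = 2 (v2^2 + v3^2), and both
  squares are at most \<epsilon>^2.\<close>

lemma near_e1:
  assumes v: "v \<in> U" "\<bar>snd (chart v)\<bar> < \<nu>"
  shows "dist v (e 1) \<le> 2 * \<epsilon>"
proof -
  note v1 = U_coords(1-2)[OF v(1)] and n = U_coords(3)[OF v(1)] and le1 = U_coords(4)[OF v(1)]
  have "\<bar>v$3\<bar> \<le> \<epsilon> * v$1"
  proof -
    have "\<bar>v$3\<bar> < \<nu> * v$1" using v(2) v1 by (simp add: chart_def field_simps)
    also have "\<dots> \<le> \<epsilon> * v$1" using v1 nu_bounds by simp
    finally show ?thesis by simp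
  qed
  moreover have "\<epsilon> * v$1 \<le> \<epsilon>" using eps le1 by simp
  ultimately have "(v$2)\<^sup>2 \<le> \<epsilon>\<^sup>2" "(v$3)\<^sup>2 \<le> \<epsilon>\<^sup>2"
    using v1(2) by (metis abs_ge_zero order_trans power2_abs power_mono)+
  then have "1 - (v$1)\<^sup>2 \<le> 2 * \<epsilon>\<^sup>2" using n by linarith
  moreover have "1 - v$1 \<le> 1 - (v$1)\<^sup>2" using le1 v1(1) by (simp add: power2_eq_square mult_left_le)
  moreover have "(dist v (e 1))\<^sup>2 = 2 - 2 * v$1"
    unfolding dist_norm power2_norm_eq_inner inner_3 using n
    by (simp add: e_def axis_def power2_eq_square algebra_simps)
  ultimately have "(dist v (e 1))\<^sup>2 \<le> (2 * \<epsilon>)\<^sup>2" by (simp add: power2_eq_square)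
  then show ?thesis by (rule power2_le_imp_le) (use eps in simp)
qed

lemma entry_near_e1: "\<bar>\<sigma>\<bar> = 1 \<Longrightarrow> \<bar>x\<bar> < \<mu> \<Longrightarrow> dist (entry \<sigma> x) (e 1) \<le> 2 * \<epsilon>"
  using near_e1[OF entry(1) entry_chart_snd] .

lemma entry_S2: "\<bar>\<sigma>\<bar> = 1 \<Longrightarrow> \<bar>x\<bar> < \<mu> \<Longrightarrow> entry \<sigma> x \<in> S2"
  using U_S2[OF entry(1)] .

lemma act_e1: "\<bar>\<tau>\<bar> = 1 \<Longrightarrow> act \<tau> 1 (e 1) = \<tau> *\<^sub>R e 3"
  by (simp add: act_def vec_eq_iff forall_3 e_def axis_def)

lemma dist_act_e1:
  assumes "\<bar>\<tau>\<bar> = 1"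
  shows "dist (e 1) (act \<tau> 1 (e 1)) \<ge> 1"
proof -
  have "\<bar>(e 1 - act \<tau> 1 (e 1)) $ 1\<bar> \<le> norm (e 1 - act \<tau> 1 (e 1))" by (rule component_le_norm_cart)
  then show ?thesis unfolding act_e1[OF assms] by (simp add: dist_norm e_def axis_def)
qed

text \<open>For each remaining pole the inner product with v is at most 1/4. The side condition
  takes care of the pole opposite to the exit, the only one that the shape of the cell does not
  exclude.\<close>

lemma far_from_other_poles:
  assumes v: "v \<in> U" and \<sigma>: "\<bar>\<sigma>\<bar> = 1" and side: "- \<nu> < \<sigma> * snd (chart v)"
    and p: "p \<in> poles" "p \<noteq> e 1" "p \<noteq> act \<sigma> 1 (e 1)"
  shows "1/2 \<le> dist v p"
proof -
  note v1 = U_coords(1-2)[OF v(1)] and n = U_coords(3)[OF v(1)] and le1 = U_coords(4)[OF v(1)]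
  have "\<epsilon> * v$1 \<le> \<epsilon>" using eps le1 by simp
  then have v2: "\<bar>v$2\<bar> \<le> 1/4" using v1(2) eps by linarith
  have "- (\<nu> * v$1) < \<sigma> * v$3" using side v1(1) by (simp add: chart_def field_simps)
  moreover have "\<nu> * v$1 \<le> 1/4"
  proof -
    have "\<nu> * v$1 \<le> (1/4) * 1" using nu_bounds eps le1 v1(1) by (intro mult_mono) auto
    then show ?thesis by simp
  qed
  ultimately have v3: "- (\<sigma> * v$3) \<le> 1/4" by linarith
  have sg: "\<sigma> = 1 \<or> \<sigma> = -1" using \<sigma> by linarith
  have pp: "\<exists>i. p = e i \<or> p = - e i" using p(1) by (auto simp: poles_def)
  then obtain i where i: "p = e i \<or> p = - e i" by blast
  have "v \<bullet> p \<le> 1/4"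
    using exhaust_3[of i] i sg p(2,3)[unfolded act_e1[OF \<sigma>]] v1(1) v2 v3
    by (elim disjE) (simp_all add: inner_3 e_def axis_def)
  moreover have "p \<bullet> p = 1" using i by (auto simp: e_def inner_axis_axis)
  moreover have "(dist v p)\<^sup>2 = v \<bullet> v + p \<bullet> p - 2 * (v \<bullet> p)"
    unfolding dist_norm power2_norm_eq_inner by (simp add: inner_diff_left inner_diff_right inner_commute)
  moreover have "v \<bullet> v = 1" using n by (simp add: inner_3 power2_eq_square)
  ultimately have "(1/2)\<^sup>2 \<le> (dist v p)\<^sup>2" by (simp add: power2_eq_square)
  then show ?thesis by (rule power2_le_imp_le) simp
qed

lemma poles_act: "\<bar>\<tau>\<bar> = 1 \<Longrightarrow> p \<in> poles \<Longrightarrow> \<exists>q\<in>poles. p = act \<tau> k q"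
proof -
  assume t: "\<bar>\<tau>\<bar> = 1" and p: "p \<in> poles"
  have Z: "Z q \<in> poles" if "q \<in> poles" for q
  proof -
    have "\<exists>i. q = e i \<or> q = - e i" using that by (auto simp: poles_def)
    then obtain i where "q = e i \<or> q = - e i" by blast
    moreover have "Z (e i) \<in> range e"
      using exhaust_3[of i] by (auto simp: e_def vec_eq_iff forall_3 axis_def image_iff intro: exI[of _ 1] exI[of _ 2] exI[of _ 3])
    moreover have "Z (- q) = - Z q" for q by (rule linear_neg[OF linear_Z])
    ultimately show ?thesis unfolding poles_def by auto
  qed
  have "act \<tau> (2 * k) p \<in> poles"
  proof -
    have "(Z ^^ n) p \<in> poles" for n using Z p by (induction n) auto
    moreover have "- q \<in> poles" if "q \<in> poles" for q using that unfolding poles_def by auto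
    moreover have "\<tau> = 1 \<or> \<tau> = -1" using t by linarith
    ultimately show ?thesis by (elim disjE) (simp_all add: act_def)
  qed
  moreover have "p = act \<tau> k (act \<tau> (2 * k) p)" using act_inverse'[OF t] by simp
  ultimately show ?thesis by blast
qed

end

text \<open>The conjugacy \<open>h\<close> alone does not prevent an orbit leaving through one vertical arm of the cross
  from first visiting the other pole along the opposite arm. The field does: at \<open>\<bar>p\<^sub>3\<bar> = \<nu>\<close>, where the
  arms meet, it increases \<open>\<bar>p\<^sub>3\<bar>\<close>.\<close>

locale turning = linearised +
  assumes turn: "\<And>v. v \<in> S2 \<Longrightarrow> 0 < v$1 \<Longrightarrow> \<bar>fst (chart v)\<bar> < \<mu> \<Longrightarrow> \<bar>snd (chart v)\<bar> = \<nu> \<Longrightarrow>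
    0 < (PN b c d v $ 3 * v$1 - v$3 * PN b c d v $ 1) * v$3"
begin

text \<open>At the last time with \<sigma> p3 \<le> - \<nu> equality holds, and there the cross
  forces |p2| < \<mu>. The field then pushes \<sigma> p3 further down, although afterwards it should
  stay above - \<nu>.\<close>

lemma stays_on_side:
  assumes v: "v \<in> S2" and \<sigma>: "\<bar>\<sigma>\<bar> = 1" and in_U: "\<And>s. 0 \<le> s \<Longrightarrow> s \<le> R \<Longrightarrow> \<phi> s v \<in> U"
    and fin: "snd (chart (\<phi> R v)) = \<sigma> / \<epsilon>" and s: "0 \<le> s" "s \<le> R"
  shows "- \<nu> < \<sigma> * snd (chart (\<phi> s v))"
proof (rule ccontr)
  define f where "f t = \<sigma> * snd (chart (\<phi> t v))" for t
  assume "\<not> - \<nu> < \<sigma> * snd (chart (\<phi> s v))"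
  then have fs: "f s \<le> - \<nu>" by (simp add: f_def)
  have pos: "\<phi> t v $ 1 > 0" if "0 \<le> t" "t \<le> R" for t using in_U[OF that] U_subset_cell by (auto simp: cell_def)
  have sq: "\<sigma> * \<sigma> = 1" using \<sigma> by simp
  have fR: "f R = 1 / \<epsilon>" using sq by (simp add: f_def fin)
  have df: "(f has_real_derivative \<sigma> * ((PN b c d (\<phi> t v) $ 3 * \<phi> t v $ 1 - \<phi> t v $ 3 * PN b c d (\<phi> t v) $ 1)
      / (\<phi> t v $ 1 * \<phi> t v $ 1))) (at t)" if "0 \<le> t" "t \<le> R" for t
    unfolding f_def chart_def snd_conv using pos[OF that]
    by (intro DERIV_cmult DERIV_divide flow_component_deriv v) auto
  have cf: "continuous_on {s..R} f"
    using s by (intro continuous_at_imp_continuous_on ballI DERIV_isCont[OF df]) auto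
  define A where "A = {s..R} \<inter> f -` {.. - \<nu>}"
  have "closed A" unfolding A_def by (intro continuous_closed_preimage[OF cf] closed_atLeastAtMost closed_atMost)
  moreover have "bounded A" by (rule bounded_subset[of "{s..R}"]) (auto simp: A_def)
  moreover have "s \<in> A" using fs s by (simp add: A_def)
  ultimately obtain m where m: "m \<in> A" "\<And>t. t \<in> A \<Longrightarrow> t \<le> m"
    using compact_attains_sup[of A] compact_eq_bounded_closed by (metis empty_iff)
  have mR: "s \<le> m" "m \<le> R" "f m \<le> - \<nu>" using m(1) by (auto simp: A_def)
  have "m \<noteq> R" using mR(3) fR inv_eps nu_bounds by auto
  then have mlt: "m < R" using mR by simp
  have above: "- \<nu> < f t" if "m < t" "t \<le> R" for t using m(2)[of t] that mR by (force simp: A_def)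
  have m0: "0 \<le> m" using mR s by simp
  have "f m = - \<nu>"
  proof (rule ccontr)
    assume "f m \<noteq> - \<nu>"
    then have "f m < - \<nu>" using mR by simp
    then obtain t where "m \<le> t" "t \<le> R" "f t = - \<nu>"
      using IVT'[of f m "- \<nu>" R] mlt fR inv_eps nu_bounds continuous_on_subset[OF cf, of "{m..R}"] mR by auto
    then show False using above[of t] \<open>f m \<noteq> - \<nu>\<close> by (cases "t = m") auto
  qed
  define w where "w = \<phi> m v"
  have w: "w \<in> U" "w \<in> S2" "0 < w$1" using in_U[OF m0 mR(2)] U_S2 pos[OF m0 mR(2)] by (auto simp: w_def)
  have sw: "\<sigma> * snd (chart w) = - \<nu>" using \<open>f m = - \<nu>\<close> by (simp add: f_def w_def)
  then have "\<bar>\<sigma> * snd (chart w)\<bar> = \<nu>" using nu_bounds by simp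
  then have abs: "\<bar>snd (chart w)\<bar> = \<nu>" using \<sigma> by (simp add: abs_mult)
  then have "\<bar>fst (chart w)\<bar> < \<mu>" using chart_U[OF w(1)] unfolding mem_W by auto
  from turn[OF w(2,3) this abs] have tr: "0 < (PN b c d w $ 3 * w$1 - w$3 * PN b c d w $ 1) * w$3" .
  have "\<sigma> * w$3 < 0" using sw w(3) nu_bounds unfolding chart_def by (simp add: field_simps)
  define D where "D = PN b c d w $ 3 * w$1 - w$3 * PN b c d w $ 1"
  have "\<sigma> * D < 0"
  proof -
    have "(\<sigma> * D) * (\<sigma> * w$3) = D * w$3" using sq by (metis mult.assoc mult.left_commute mult_1)
    then have "0 < (\<sigma> * D) * (\<sigma> * w$3)" using tr by (simp only: D_def)
    then show ?thesis using \<open>\<sigma> * w$3 < 0\<close> mult_nonneg_nonpos[of "\<sigma> * D" "\<sigma> * w$3"] by linarith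
  qed
  then have "\<sigma> * (D / (w$1 * w$1)) < 0" using w(3) by (simp add: divide_neg_pos)
  moreover have "(f has_real_derivative \<sigma> * (D / (w$1 * w$1))) (at m)"
    using df[OF m0 mR(2)] by (simp add: D_def w_def)
  ultimately obtain \<delta> where \<delta>: "\<delta> > 0" "\<And>k. 0 < k \<Longrightarrow> k < \<delta> \<Longrightarrow> f (m + k) < f m"
    using DERIV_neg_dec_right by metis
  define k where "k = min (\<delta>/2) (R - m)"
  have "0 < k" "k < \<delta>" "m + k \<le> R" using \<delta>(1) mlt by (auto simp: k_def)
  then show False using \<delta>(2)[of k] above[of "m + k"] \<open>f m = - \<nu>\<close> by simp
qed

end

text \<open>A periodic sequence of exit data \<open>(\<sigma> n, x n)\<close> together with signs \<open>\<tau> n\<close> such that the \<open>n\<close>-th cell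
  visited is the image of the first one under \<open>act (\<tau> n) n\<close>.\<close>

locale cycle = turning +
  fixes m :: nat and \<tau> \<sigma> x :: "nat \<Rightarrow> real"
  assumes m: "0 < m" "3 dvd m"
    and unit: "\<And>n. \<bar>\<tau> n\<bar> = 1" "\<And>n. \<bar>\<sigma> n\<bar> = 1"
    and x: "\<And>n. x n \<noteq> 0" "\<And>n. \<bar>x n\<bar> < 2 * \<bar>d\<bar>"
    and step: "\<And>n. \<sigma> (Suc n) = \<sigma> n * sgn (x n)" "\<And>n. \<tau> (Suc n) = \<tau> n * \<sigma> (Suc n)"
      "\<And>n. x (Suc n) = F (\<sigma> n) (x n)"
    and closing: "\<tau> m = \<tau> 0" "\<sigma> m = \<sigma> 0" "x m = x 0"
    and minimal: "\<And>k. 0 < k \<Longrightarrow> k < m \<Longrightarrow> 3 dvd k \<Longrightarrow> \<tau> k = \<tau> 0 \<Longrightarrow> \<sigma> k = \<sigma> 0 \<Longrightarrow> False"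
begin

lemma x_mu: "\<bar>x n\<bar> < \<mu>"
  using x(2)[of n] two_d_less_mu by linarith

definition pt :: "nat \<Rightarrow> real^3" where
  "pt n = act (\<tau> n) n (entry (\<sigma> n) (x n))"

lemma pt_S2: "pt n \<in> S2"
  unfolding pt_def using act_S2[OF unit(1)] entry_S2[OF unit(2) x_mu] by blast

lemma periodic: "\<tau> (n + m) = \<tau> n" "\<sigma> (n + m) = \<sigma> n" "x (n + m) = x n"
proof -
  have "\<tau> (n + m) = \<tau> n \<and> \<sigma> (n + m) = \<sigma> n \<and> x (n + m) = x n"
    by (induction n) (simp_all add: closing step)
  then show "\<tau> (n + m) = \<tau> n" "\<sigma> (n + m) = \<sigma> n" "x (n + m) = x n" by auto
qed

lemma act_add_m: "act t (n + m) = act t n"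
  using m(2) by (subst (1 2) act_mod) (auto simp: mod_add_eq elim!: dvdE)

lemma pt_m: "pt (n + m) = pt n"
  by (simp add: pt_def periodic act_add_m)

text \<open>\<open>transit\<close> only yields existence of a crossing time, so one is chosen for
  every n by Hilbert choice in \<open>ret\<close>.\<close>

definition is_return :: "nat \<Rightarrow> real \<Rightarrow> bool" where
  "is_return n R \<longleftrightarrow> 0 < R \<and>
     \<phi> R (entry (\<sigma> n) (x n)) = act (\<sigma> (Suc n)) 1 (entry (\<sigma> (Suc n)) (x (Suc n))) \<and>
     (\<lambda>s. \<phi> s (entry (\<sigma> n) (x n))) ` {0..R} = h' ` passage (\<sigma> n) (x n) \<and>
     (\<forall>s. 0 < s \<and> s < R \<longrightarrow> \<phi> s (entry (\<sigma> n) (x n)) \<in> U_int)"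

definition ret :: "nat \<Rightarrow> real" where
  "ret n = (SOME R. is_return n R)"

lemma is_return_ret: "is_return n (ret n)"
proof -
  obtain R where "is_return n R"
    using transit[OF unit(2)[of n] x(1)[of n] x(2)[of n]] unfolding is_return_def step by metis
  then show ?thesis unfolding ret_def by (rule someI)
qed

lemma ret_pos: "0 < ret n"
  and ret_entry: "\<phi> (ret n) (entry (\<sigma> n) (x n)) = act (\<sigma> (Suc n)) 1 (entry (\<sigma> (Suc n)) (x (Suc n)))"
  and ret_passage: "(\<lambda>s. \<phi> s (entry (\<sigma> n) (x n))) ` {0..ret n} = h' ` passage (\<sigma> n) (x n)"
  and ret_int: "0 < s \<Longrightarrow> s < ret n \<Longrightarrow> \<phi> s (entry (\<sigma> n) (x n)) \<in> U_int"
  using is_return_ret[of n] unfolding is_return_def by auto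

definition time :: "nat \<Rightarrow> real" where
  "time n = (\<Sum>i<n. ret i)"

lemma time_simps: "time 0 = 0" "time (Suc n) = time n + ret n"
  by (simp_all add: time_def)

lemma flow_act_entry:
  "\<phi> s (pt n) = act (\<tau> n) n (\<phi> s (entry (\<sigma> n) (x n)))"
  unfolding pt_def by (rule flow_act[OF unit(1) entry_S2[OF unit(2) x_mu]])

lemma flow_pt: "\<phi> (ret n) (pt n) = pt (Suc n)"
  unfolding flow_act_entry ret_entry act_act by (simp add: pt_def step(2)[of n])

lemma flow_time: "\<phi> (time n) (pt 0) = pt n"
proof (induction n)
  case (Suc n)
  have "\<phi> (time (Suc n)) (pt 0) = \<phi> (ret n) (\<phi> (time n) (pt 0))"
    using flow_add[OF pt_S2, of "ret n" "time n" 0] by (simp add: time_simps add.commute)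
  then show ?case by (simp add: Suc flow_pt)
qed (simp add: time_simps pt_S2[unfolded mem_sphere_0])

lemma flow_between: "\<phi> t (pt 0) = act (\<tau> n) n (\<phi> (t - time n) (entry (\<sigma> n) (x n)))"
  using flow_add[OF pt_S2, of "t - time n" "time n" 0] unfolding flow_time flow_act_entry[of _ n] by simp

lemma between_times: "0 \<le> t \<Longrightarrow> t < time N \<Longrightarrow> \<exists>n<N. time n \<le> t \<and> t < time (Suc n)"
proof (induction N)
  case (Suc N)
  then show ?case by (cases "t < time N") (auto intro: less_SucI)
qed (simp add: time_simps)

text \<open>Strictly between gates the orbit runs in interiors of copies of the cell, which contain
  no entry point. At the gates, a return before step m would give the same group element and sign,
  contrary to \<open>minimal\<close>.\<close>

lemma has_period_pt: "has_period \<phi> (pt 0) (time m)"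
  unfolding has_period_def
proof (intro conjI allI impI)
  show "0 < time m" unfolding time_def using m ret_pos by (intro sum_pos) auto
  show "\<phi> (time m) (pt 0) = pt 0" using flow_time[of m] pt_m[of 0] by simp
  fix t assume t: "0 < t \<and> t < time m"
  then obtain n where n: "n < m" "time n \<le> t" "t < time (Suc n)" using between_times[of t m] by force
  show "\<phi> t (pt 0) \<noteq> pt 0"
  proof (cases "t = time n")
    case True
    then have "0 < n" using t by (cases n) (auto simp: time_simps)
    show ?thesis
    proof
      assume "\<phi> t (pt 0) = pt 0"
      then have "pt n = pt 0" using True flow_time by simp
      from entry_free[OF unit(1,1) unit(2) x_mu unit(2) x_mu this[unfolded pt_def]]
      show False using minimal[OF \<open>0 < n\<close> n(1)] by auto
    qed
  next
    case False
    then have "\<phi> (t - time n) (entry (\<sigma> n) (x n)) \<in> U_int" using n by (intro ret_int) (auto simp: time_simps)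
    then have "pt 0 \<noteq> act (\<tau> n) n (\<phi> (t - time n) (entry (\<sigma> n) (x n)))"
      unfolding pt_def by (rule entry_not_interior[OF unit(1,1) unit(2) x_mu])
    then show ?thesis using flow_between[of t n] by metis
  qed
qed

text \<open>Describes the orbit as a point set without return times, so that it can be compared with
  neighbouring passages.\<close>

lemma orbit_pt: "orbit \<phi> (pt 0) = (\<Union>n. act (\<tau> n) n ` h' ` passage (\<sigma> n) (x n))"
proof
  have T: "0 < time m" "\<phi> (time m) (pt 0) = pt 0" using has_period_pt by (auto simp: has_period_def)
  show "orbit \<phi> (pt 0) \<subseteq> (\<Union>n. act (\<tau> n) n ` h' ` passage (\<sigma> n) (x n))"
  proof
    fix w assume "w \<in> orbit \<phi> (pt 0)"
    then obtain t where t: "0 \<le> t" "t < time m" "w = \<phi> t (pt 0)" unfolding orbit_periodic[OF pt_S2 T] by auto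
    then obtain n where n: "time n \<le> t" "t < time (Suc n)" using between_times[of t m] by blast
    then have "\<phi> (t - time n) (entry (\<sigma> n) (x n)) \<in> h' ` passage (\<sigma> n) (x n)"
      unfolding ret_passage[symmetric] by (auto simp: time_simps)
    then show "w \<in> (\<Union>n. act (\<tau> n) n ` h' ` passage (\<sigma> n) (x n))" unfolding t(3) flow_between[of t n] by blast
  qed
  show "(\<Union>n. act (\<tau> n) n ` h' ` passage (\<sigma> n) (x n)) \<subseteq> orbit \<phi> (pt 0)"
  proof
    fix w assume "w \<in> (\<Union>n. act (\<tau> n) n ` h' ` passage (\<sigma> n) (x n))"
    then obtain n s where "w = act (\<tau> n) n (\<phi> s (entry (\<sigma> n) (x n)))" unfolding ret_passage[symmetric] by blast
    then have "w = \<phi> (time n + s) (pt 0)" using flow_between[of "time n + s" n] by simp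
    then show "w \<in> orbit \<phi> (pt 0)" by (auto simp: orbit_def)
  qed
qed

lemma passage_W: "passage (\<sigma> n) (x n) \<subseteq> W"
  unfolding passage_def using path_in_W[OF unit(2) x] by auto

lemma orbit_saturate: "orbit \<phi> (pt 0) \<subseteq> saturate U"
proof
  fix w assume "w \<in> orbit \<phi> (pt 0)"
  then obtain n p where "w = act (\<tau> n) n (h' p)" "p \<in> W" unfolding orbit_pt using passage_W by blast
  then show "w \<in> saturate U" unfolding mem_saturate using unit(1) h_inv(4) by blast
qed

lemma periodic_orbit_pt: "periodic_orbit \<phi> (orbit \<phi> (pt 0))"
  unfolding periodic_orbit_def using pt_S2 has_period_pt by blast

text \<open>The marked times are the gate crossings. Between two of them the arc is pulled back to
  the first cell, where all poles except that of the cell and that of the exit are at distance at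
  least 1/2.\<close>

lemma passes:
  assumes \<eta>: "2 * \<epsilon> < \<eta>" "\<eta> \<le> 1/2" and ps: "length ps = Suc m" "\<And>n. n \<le> m \<Longrightarrow> ps ! n = act (\<tau> n) n (e 1)"
  shows "passes_nearby \<phi> \<eta> ps (orbit \<phi> (pt 0))"
proof -
  have 1: "dist (\<phi> (time i) (pt 0)) (ps ! i) < \<eta>" if "i < length ps" for i
  proof -
    have "dist (\<phi> (time i) (pt 0)) (ps ! i) = dist (entry (\<sigma> i) (x i)) (e 1)"
      unfolding flow_time using that ps by (simp add: pt_def dist_act[OF unit(1)])
    also have "\<dots> < \<eta>" using entry_near_e1[OF unit(2) x_mu, of i i] \<eta>(1) by linarith
    finally show ?thesis .
  qed
  have 2: "\<eta> \<le> dist (\<phi> t (pt 0)) p"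
    if i: "Suc i < length ps" and t: "t \<in> {time i..time (Suc i)}" and p: "p \<in> poles - {ps ! i, ps ! Suc i}" for i t p
  proof -
    define v where "v = entry (\<sigma> i) (x i)"
    define s where "s = t - time i"
    have s: "0 \<le> s" "s \<le> ret i" using t by (auto simp: s_def time_simps)
    have in_U: "\<phi> r v \<in> U" if "0 \<le> r" "r \<le> ret i" for r
    proof -
      have "\<phi> r v \<in> h' ` passage (\<sigma> i) (x i)" unfolding ret_passage[symmetric] v_def using that by auto
      then show ?thesis using passage_W[of i] h_inv(4) by auto
    qed
    have "snd (chart (\<phi> (ret i) v)) = \<sigma> (Suc i) / \<epsilon>"
    proof -
      define w where "w = entry (\<sigma> (Suc i)) (x (Suc i))"
      have w1: "w$1 > 0" using entry(1)[OF unit(2) x_mu, of "Suc i" "Suc i"] U_subset_cell by (auto simp: w_def cell_def)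
      have f: "w$2 / w$1 = \<sigma> (Suc i) * \<epsilon>" using entry(2)[OF unit(2) x_mu, of "Suc i" "Suc i"] by (simp add: w_def chart_def)
      have "\<sigma> (Suc i) \<noteq> 0" using unit(2)[of "Suc i"] by auto
      have "snd (chart (\<phi> (ret i) v)) = w$1 / w$2"
        unfolding v_def ret_entry w_def[symmetric] using \<open>\<sigma> (Suc i) \<noteq> 0\<close> by (simp add: chart_def act_def)
      also have "\<dots> = 1 / (\<sigma> (Suc i) * \<epsilon>)" unfolding f[symmetric] by simp
      also have "\<dots> = \<sigma> (Suc i) / \<epsilon>" using unit(2)[of "Suc i"] by (auto simp: abs_if split: if_splits)
      finally show ?thesis .
    qed
    then have side: "- \<nu> < \<sigma> (Suc i) * snd (chart (\<phi> s v))"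
      using stays_on_side[OF _ unit(2) in_U _ s] entry_S2[OF unit(2) x_mu] unfolding v_def by blast
    obtain q where q: "q \<in> poles" "p = act (\<tau> i) i q" using poles_act[OF unit(1)] p by blast
    have "q \<noteq> e 1" using p q ps i by auto
    moreover have "act (\<tau> i) i (act (\<sigma> (Suc i)) 1 (e 1)) = ps ! Suc i"
      using ps i by (simp add: act_act step(2)[of i])
    then have "q \<noteq> act (\<sigma> (Suc i)) 1 (e 1)" using p q by auto
    ultimately have "1/2 \<le> dist (\<phi> s v) q"
      using far_from_other_poles[OF in_U[OF s] unit(2) side q(1)] by blast
    also have "\<dots> = dist (\<phi> t (pt 0)) p"
      unfolding flow_between[of t i] q(2) dist_act[OF unit(1)] by (simp add: v_def s_def)
    finally show ?thesis using \<eta> by simp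
  qed
  have "\<forall>i<length ps. dist (\<phi> (time i) (pt 0)) (ps ! i) < \<eta>" using 1 by blast
  moreover have "\<forall>i. Suc i < length ps \<longrightarrow> time i < time (Suc i) \<and>
      (\<forall>t\<in>{time i..time (Suc i)}. \<forall>p\<in>poles - {ps ! i, ps ! Suc i}. \<eta> \<le> dist (\<phi> t (pt 0)) p)"
    using 2 by (intro allI impI conjI ballI) (auto simp: time_simps(2) ret_pos)
  moreover have "time 0 = 0" "time (length ps - 1) = time m" using ps(1) by (simp_all add: time_simps)
  ultimately show ?thesis
    unfolding passes_nearby_def using has_period_pt pt_S2 by blast
qed

end

section \<open>Stability of the cycles\<close>

context PN_flow
begin

text \<open>\<open>\<kappa> = 1\<close> is the flow itself and \<open>\<kappa> = -1\<close> the reversed flow. The sets \<open>N k\<close> need not be open, and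
  the lower bound \<open>\<delta>\<close> on the time between gates excludes an accumulation of crossing times.\<close>

lemma attracting_by_traps:
  fixes \<kappa> \<delta> :: real and N E :: "nat \<Rightarrow> (real^3) set"
  assumes \<delta>: "0 < \<delta>" and S: "\<gamma> \<subseteq> S2" "\<And>k. N k \<subseteq> S2" "\<And>k. E k \<subseteq> S2"
    and mono: "\<And>k. N (Suc k) \<subseteq> N k" and inv: "\<And>u t. u \<in> \<gamma> \<Longrightarrow> \<phi> t u \<in> \<gamma>"
    and basis: "\<And>V. openin (top_of_set S2) V \<Longrightarrow> \<gamma> \<subseteq> V \<Longrightarrow> \<exists>k. N k \<subseteq> V"
    and nbhd: "\<And>k. \<exists>O'. openin (top_of_set S2) O' \<and> O' \<subseteq> N k \<and> (\<forall>u\<in>\<gamma>. \<exists>t\<ge>0. \<phi> (\<kappa> * t) u \<in> O')"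
    and enter: "\<And>k u. u \<in> N k \<Longrightarrow> \<exists>t\<ge>0. (\<forall>s\<in>{0..t}. \<phi> (\<kappa> * s) u \<in> N k) \<and> \<phi> (\<kappa> * t) u \<in> E k"
    and step: "\<And>k u. u \<in> E k \<Longrightarrow> \<exists>t\<ge>\<delta>. (\<forall>s\<in>{0..t}. \<phi> (\<kappa> * s) u \<in> N k) \<and> \<phi> (\<kappa> * t) u \<in> E (Suc k)"
  shows "attracting (\<lambda>t. \<phi> (\<kappa> * t)) \<gamma>"
proof -
  define f where "f t u = \<phi> (\<kappa> * t) u" for t u
  have fadd: "f (s + t) u = f s (f t u)" if "u \<in> S2" for s t u
    unfolding f_def distrib_left using flow_add[OF that] by simp
  have stay: "\<forall>k u. u \<in> E k \<longrightarrow> (\<forall>t. 0 \<le> t \<and> t \<le> real n * \<delta> \<longrightarrow> f t u \<in> N k)" for n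
  proof (induction n)
    case 0
    show ?case
    proof (intro allI impI)
      fix k u t assume "u \<in> E k" "0 \<le> t \<and> t \<le> real 0 * \<delta>"
      moreover obtain t1 where "t1 \<ge> \<delta>" "\<forall>s\<in>{0..t1}. f s u \<in> N k" using step[OF \<open>u \<in> E k\<close>] unfolding f_def by blast
      ultimately show "f t u \<in> N k" using \<delta> by simp
    qed
  next
    case (Suc n)
    show ?case
    proof (intro allI impI)
      fix k u t assume u: "u \<in> E k" and t: "0 \<le> t \<and> t \<le> real (Suc n) * \<delta>"
      obtain t1 where t1: "t1 \<ge> \<delta>" "\<forall>s\<in>{0..t1}. f s u \<in> N k" "f t1 u \<in> E (Suc k)"
        using step[OF u] unfolding f_def by blast
      show "f t u \<in> N k"
      proof (cases "t \<le> t1")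
        case True
        then show ?thesis using t1(2) t by simp
      next
        case False
        have "f t u = f (t - t1) (f t1 u)" using fadd[OF subsetD[OF S(3) u], of "t - t1" t1] by simp
        moreover have "t - t1 \<le> real n * \<delta>" using t t1(1) by (simp add: algebra_simps)
        ultimately show ?thesis using Suc t1(3) False mono by force
      qed
    qed
  qed
  have stayE: "f t u \<in> N k" if "u \<in> E k" "0 \<le> t" for k u t
  proof -
    obtain n where "t / \<delta> \<le> real n" using real_arch_simple by blast
    then have "t \<le> real n * \<delta>" using \<delta> by (simp add: field_simps)
    then show ?thesis using stay[of n] that by blast
  qed
  have stayN: "f t u \<in> N k" if u: "u \<in> N k" "0 \<le> t" for k u t
  proof -
    obtain t1 where t1: "t1 \<ge> 0" "\<forall>s\<in>{0..t1}. f s u \<in> N k" "f t1 u \<in> E k" using enter[OF u(1)] unfolding f_def by blast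
    show ?thesis
    proof (cases "t \<le> t1")
      case False
      have "f t u = f (t - t1) (f t1 u)" using fadd[OF subsetD[OF S(2) u(1)], of "t - t1" t1] by simp
      then show ?thesis using stayE[OF t1(3), of "t - t1"] False by simp
    qed (use t1 that in auto)
  qed
  have deeper: "\<exists>t\<ge>0. f t u \<in> E (k + j)" if u: "u \<in> E k" for k j u
  proof (induction j)
    case 0
    then show ?case using u flow_0 S(3) by (intro exI[of _ 0]) (auto simp: f_def subset_iff)
  next
    case (Suc j)
    then obtain t where t: "t \<ge> 0" "f t u \<in> E (k + j)" by blast
    obtain t1 where "t1 \<ge> \<delta>" "f t1 (f t u) \<in> E (Suc (k + j))" using step[OF t(2)] unfolding f_def by blast
    then show ?case using t(1) \<delta> fadd[OF subsetD[OF S(3) u], of t1 t] by (intro exI[of _ "t1 + t"]) auto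
  qed
  have monoN: "N (k + j) \<subseteq> N j" for k j
    using lift_Suc_antimono_le[of N j "k + j"] mono by simp
  have eventually_in: "\<exists>t0\<ge>0. \<forall>t\<ge>t0. f t u \<in> N j" if u: "u \<in> N k" for u k j
  proof -
    have uS: "u \<in> S2" using u S(2) by blast
    obtain t1 where t1: "t1 \<ge> 0" "f t1 u \<in> E k" using enter[OF u] unfolding f_def by blast
    obtain t2 where t2: "t2 \<ge> 0" "f t2 (f t1 u) \<in> E (k + j)" using deeper[OF t1(2)] by blast
    have "f t u \<in> N j" if "t \<ge> t1 + t2" for t
    proof -
      have "f t u = f (t - (t1 + t2)) (f (t2 + t1) u)" using fadd[OF uS, of "t - (t1 + t2)" "t2 + t1"] by (simp add: add.commute)
      also have "f (t2 + t1) u = f t2 (f t1 u)" by (rule fadd[OF uS])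
      finally show ?thesis using stayE[OF t2(2), of "t - (t1 + t2)"] that monoN by auto
    qed
    then show ?thesis using t1 t2 by (intro exI[of _ "t1 + t2"]) auto
  qed
  have funnel: "\<exists>M. openin (top_of_set S2) M \<and> \<gamma> \<subseteq> M \<and>
      (\<forall>u\<in>M. \<exists>t\<ge>0. (\<forall>s. 0 \<le> s \<and> s \<le> t \<longrightarrow> f s u \<in> V) \<and> f t u \<in> N k)"
    if V: "openin (top_of_set S2) V" "\<gamma> \<subseteq> V" for V k
  proof -
    obtain O' where O': "openin (top_of_set S2) O'" "O' \<subseteq> N k" "\<forall>u\<in>\<gamma>. \<exists>t\<ge>0. f t u \<in> O'"
      using nbhd[of k] unfolding f_def by blast
    \<comment> \<open>Points that reach the open set O' without leaving V before. This set is open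
      by continuous dependence even though the traps are not.\<close>
    define M where "M = {u \<in> S2. \<exists>t\<ge>0. (\<forall>s. 0 \<le> s \<and> s \<le> t \<longrightarrow> f s u \<in> V) \<and> f t u \<in> O'}"
    have "\<exists>T. openin (top_of_set S2) T \<and> u \<in> T \<and> T \<subseteq> M" if "u \<in> M" for u
    proof -
      obtain t where t: "u \<in> S2" "t \<ge> 0" "\<forall>s. 0 \<le> s \<and> s \<le> t \<longrightarrow> f s u \<in> V" "f t u \<in> O'"
        using \<open>u \<in> M\<close> unfolding M_def by blast
      have "compact ((\<lambda>s. \<kappa> * s) ` {0..t})" by (intro compact_continuous_image continuous_intros) auto
      then obtain T1 where T1: "openin (top_of_set S2) T1" "u \<in> T1" "\<And>v r. v \<in> T1 \<Longrightarrow> r \<in> (\<lambda>s. \<kappa> * s) ` {0..t} \<Longrightarrow> \<phi> r v \<in> V"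
        using t(3) by (elim flow_tube[OF t(1) _ V(1)]) (auto simp: f_def)
      have "\<phi> r u \<in> O'" if "r \<in> {\<kappa> * t}" for r using t(4) that by (simp add: f_def)
      then obtain T2 where T2: "openin (top_of_set S2) T2" "u \<in> T2" "\<And>v r. v \<in> T2 \<Longrightarrow> r \<in> {\<kappa> * t} \<Longrightarrow> \<phi> r v \<in> O'"
        using flow_tube[OF t(1) compact_sing O'(1)] by metis
      have "T1 \<inter> T2 \<subseteq> M"
      proof
        fix v assume v: "v \<in> T1 \<inter> T2"
        then have "v \<in> S2" using openin_subset[OF T1(1)] by auto
        moreover have "f s v \<in> V" if "0 \<le> s \<and> s \<le> t" for s 
        proof -
          have "\<kappa> * s \<in> (\<lambda>s. \<kappa> * s) ` {0..t}" using that by (intro imageI) simp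
          then show ?thesis unfolding f_def using T1(3)[of v "\<kappa> * s"] v by blast
        qed
        moreover have "f t v \<in> O'" using T2(3)[of v] v by (auto simp: f_def)
        ultimately show "v \<in> M" unfolding M_def using t(2) by blast
      qed
      then show ?thesis using T1 T2 by (intro exI[of _ "T1 \<inter> T2"]) auto
    qed
    then have "openin (top_of_set S2) M" by (subst openin_subopen) blast
    moreover have "\<gamma> \<subseteq> M"
    proof
      fix u assume u: "u \<in> \<gamma>"
      then obtain t where "t \<ge> 0" "f t u \<in> O'" using O'(3) by blast
      moreover have "f s u \<in> V" for s using inv[OF u] V(2) by (auto simp: f_def)
      ultimately show "u \<in> M" unfolding M_def using u S(1) by blast
    qed
    moreover have "\<forall>u\<in>M. \<exists>t\<ge>0. (\<forall>s. 0 \<le> s \<and> s \<le> t \<longrightarrow> f s u \<in> V) \<and> f t u \<in> N k"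
      unfolding M_def using O'(2) by blast
    ultimately show ?thesis by blast
  qed
  have stable: "\<exists>M. openin (top_of_set S2) M \<and> \<gamma> \<subseteq> M \<and> (\<forall>u\<in>M. \<forall>t\<ge>0. f t u \<in> V)"
    if V: "openin (top_of_set S2) V \<and> \<gamma> \<subseteq> V" for V
  proof -
    obtain k where k: "N k \<subseteq> V" using basis V by blast
    obtain M where M: "openin (top_of_set S2) M" "\<gamma> \<subseteq> M"
      "\<forall>u\<in>M. \<exists>t\<ge>0. (\<forall>s. 0 \<le> s \<and> s \<le> t \<longrightarrow> f s u \<in> V) \<and> f t u \<in> N k"
      using funnel[of V k] V by blast
    have "f t u \<in> V" if u: "u \<in> M" "t \<ge> 0" for u t
    proof -
      obtain t1 where t1: "t1 \<ge> 0" "\<forall>s. 0 \<le> s \<and> s \<le> t1 \<longrightarrow> f s u \<in> V" "f t1 u \<in> N k" using M(3) u(1) by blast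
      show ?thesis
      proof (cases "t \<le> t1")
        case False
        have "u \<in> S2" using openin_subset[OF M(1)] u(1) by auto
        then have "f t u = f (t - t1) (f t1 u)" using fadd[of u "t - t1" t1] by simp
        then show ?thesis using stayN[OF t1(3), of "t - t1"] False k by auto
      qed (use t1 u in auto)
    qed
    then show ?thesis using M by blast
  qed
  have attract: "\<exists>M. openin (top_of_set S2) M \<and> \<gamma> \<subseteq> M \<and> (\<forall>u\<in>M. ((\<lambda>t. infdist (f t u) \<gamma>) \<longlongrightarrow> 0) at_top)"
  proof -
    obtain M where M: "openin (top_of_set S2) M" "\<gamma> \<subseteq> M"
      "\<forall>u\<in>M. \<exists>t\<ge>0. (\<forall>s. 0 \<le> s \<and> s \<le> t \<longrightarrow> f s u \<in> S2) \<and> f t u \<in> N 0"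
      using funnel[of S2 0] S(1) by auto
    have "((\<lambda>t. infdist (f t u) \<gamma>) \<longlongrightarrow> 0) at_top" if u: "u \<in> M" for u
    proof (rule tendstoI)
      fix r :: real assume r: "0 < r"
      have uS: "u \<in> S2" using openin_subset[OF M(1)] u by auto
      define V where "V = S2 \<inter> {w. infdist w \<gamma> < r}"
      have "openin (top_of_set S2) V"
        unfolding V_def by (intro openin_open_Int open_Collect_less continuous_intros)
      moreover have "\<gamma> \<subseteq> V" using S(1) r by (auto simp: V_def)
      ultimately obtain j where j: "N j \<subseteq> V" using basis by blast
      obtain t1 where t1: "t1 \<ge> 0" "f t1 u \<in> N 0" using M(3) u by blast
      obtain t0 where t0: "t0 \<ge> 0" "\<forall>t\<ge>t0. f t (f t1 u) \<in> N j" using eventually_in[OF t1(2)] by blast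
      have "dist (infdist (f t u) \<gamma>) 0 < r" if "t \<ge> t0 + t1" for t
      proof -
        have "f t u = f (t - t1) (f t1 u)" using fadd[OF uS, of "t - t1" t1] by simp
        then have "f t u \<in> V" using t0(2) j that by auto
        then show ?thesis by (simp add: V_def infdist_nonneg)
      qed
      then show "\<forall>\<^sub>F t in at_top. dist (infdist (f t u) \<gamma>) 0 < r"
        unfolding eventually_at_top_linorder by blast
    qed
    then show ?thesis using M by blast
  qed
  show ?thesis
    unfolding attracting_def f_def[symmetric] using stable attract by blast
qed

text \<open>Uniform continuity on a compact time interval times the sphere; its purpose is a lower
  bound for travel times between separated places.\<close>

lemma flow_close_for_short_times:
  assumes "0 < r"
  obtains \<theta> where "0 < \<theta>" "\<And>u t. u \<in> S2 \<Longrightarrow> \<bar>t\<bar> \<le> \<theta> \<Longrightarrow> dist (\<phi> t u) u < r"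
proof -
  have "uniformly_continuous_on ({-1..1} \<times> S2) (\<lambda>(t, u). \<phi> t u)"
    by (intro compact_uniformly_continuous compact_Times compact_Icc compact_sphere
        continuous_on_subset[OF flow_cont]) auto
  then obtain \<delta> where \<delta>: "\<delta> > 0" "\<And>p p'. p \<in> {-1..1} \<times> S2 \<Longrightarrow> p' \<in> {-1..1} \<times> S2 \<Longrightarrow> dist p' p < \<delta> \<Longrightarrow>
      dist (case p' of (t, u) \<Rightarrow> \<phi> t u) (case p of (t, u) \<Rightarrow> \<phi> t u) < r"
    using assms unfolding uniformly_continuous_on_def by metis
  show thesis
  proof
    show "0 < min 1 (\<delta>/2)" using \<delta>(1) by simp
    fix u :: "real^3" and t :: real assume "u \<in> S2" "\<bar>t\<bar> \<le> min 1 (\<delta>/2)"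
    then show "dist (\<phi> t u) u < r"
      using \<delta>(2)[of "(0, u)" "(t, u)"] \<delta>(1) flow_0[of u] by (auto simp: dist_Pair_Pair abs_le_iff)
  qed
qed

lemma openin_act:
  assumes t: "\<bar>\<tau>\<bar> = 1" and X: "openin (top_of_set S2) X"
  shows "openin (top_of_set S2) (act \<tau> k ` X)"
proof -
  have XS: "X \<subseteq> S2" using openin_subset[OF X] by simp
  have "act \<tau> k ` X = S2 \<inter> act \<tau> (2 * k) -` X"
  proof (intro equalityI subsetI)
    fix w assume "w \<in> act \<tau> k ` X"
    then obtain v where "v \<in> X" "w = act \<tau> k v" by blast
    then show "w \<in> S2 \<inter> act \<tau> (2 * k) -` X" using act_inverse[OF t] act_S2[OF t, of k v] XS by auto
  next
    fix w assume "w \<in> S2 \<inter> act \<tau> (2 * k) -` X"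
    then have "act \<tau> (2 * k) w \<in> X" "w = act \<tau> k (act \<tau> (2 * k) w)" using act_inverse'[OF t] by auto
    then show "w \<in> act \<tau> k ` X" by blast
  qed
  also have "openin (top_of_set S2) \<dots>"
    using act_S2[OF t] by (intro continuous_openin_preimage[OF continuous_on_act _ X]) blast
  finally show ?thesis .
qed

text \<open>In either time direction the travel time becomes nonnegative after adding enough
  multiples of the period.\<close>

lemma periodic_orbit_reaches:
  assumes u: "u \<in> S2" "has_period \<phi> u T" and vw: "v \<in> orbit \<phi> u" "w \<in> orbit \<phi> u" and \<kappa>: "\<bar>\<kappa>\<bar> = 1"
  shows "\<exists>t\<ge>0. \<phi> (\<kappa> * t) v = w"
proof -
  have v: "v \<in> S2" "has_period \<phi> v T" using orbit_mem_S2[OF u(1) vw(1)] has_period_orbit[OF u vw(1)] by auto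
  then have T: "T > 0" "\<phi> T v = v" by (auto simp: has_period_def)
  have per: "\<phi> (real n * T) v = v" for n
    by (induction n) (use T v in \<open>auto simp: distrib_right flow_add\<close>)
  have per': "\<phi> (\<kappa> * (real n * T)) v = v" for n
  proof -
    have "\<kappa> = 1 \<or> \<kappa> = -1" using \<kappa> by linarith
    then show ?thesis using per[of n] flow_neg(1)[OF v(1), of "real n * T"] by auto
  qed
  have "w \<in> orbit \<phi> v" using orbit_eq[OF u(1) vw(1)] vw(2) by simp
  then obtain s where s: "w = \<phi> s v" by (auto simp: orbit_def)
  obtain n where n: "\<bar>s\<bar> / T \<le> real n" using real_arch_simple by blast
  have "\<kappa> * (\<kappa> * s + real n * T) = s + \<kappa> * (real n * T)" using \<kappa> by (simp add: distrib_left mult.assoc[symmetric])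
  then have "\<phi> (\<kappa> * (\<kappa> * s + real n * T)) v = w" using flow_add[OF v(1), of s] per'[of n] s by simp
  moreover have "0 \<le> \<kappa> * s + real n * T"
  proof -
    have "\<bar>\<kappa> * s\<bar> \<le> real n * T" using n T(1) \<kappa> by (simp add: abs_mult field_simps)
    then show ?thesis by linarith
  qed
  ultimately show ?thesis by blast
qed

end

section \<open>Open tubes in linear coordinates, and a lower bound for transit times\<close>

context linearised
begin

text \<open>Since \<open>snd p * \<bar>fst p - d\<bar> powr (1 / \<alpha>)\<close> is constant along linear orbits, this recovers the parameter
  of the entry point of the orbit through \<open>p\<close>.\<close>

definition entry_param :: "real \<Rightarrow> real \<times> real \<Rightarrow> real" where
  "entry_param \<sigma> p = \<sigma> * snd p * ((fst p - d) / (\<sigma> * \<epsilon> - d)) powr (1 / \<alpha>) / \<epsilon>"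

lemma sigma_side: "\<bar>\<sigma>\<bar> = 1 \<Longrightarrow> 0 < \<sigma> * (\<sigma> * \<epsilon> - d)"
  using d_less_eps by (auto simp: abs_if split: if_splits)

lemma sigma_ratio: "\<bar>\<sigma>\<bar> = 1 \<Longrightarrow> (a - d) / (\<sigma> * \<epsilon> - d) = \<sigma> * (a - d) / (\<sigma> * (\<sigma> * \<epsilon> - d))"
  using sigma_side[of \<sigma>] by (auto simp: abs_if divide_simps split: if_splits)

lemma entry_param_path:
  assumes "\<bar>\<sigma>\<bar> = 1"
  shows "entry_param \<sigma> (\<psi> t (\<sigma> * \<epsilon>, \<sigma> * \<epsilon> * y)) = y" "0 < \<sigma> * (fst (\<psi> t (\<sigma> * \<epsilon>, \<sigma> * \<epsilon> * y)) - d)"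
proof -
  have "\<sigma> * \<epsilon> - d \<noteq> 0" using sigma_side[OF assms] by auto
  then have "(fst (\<psi> t (\<sigma> * \<epsilon>, \<sigma> * \<epsilon> * y)) - d) / (\<sigma> * \<epsilon> - d) = exp (- \<alpha> * t)" by (simp add: lin_flow_coords)
  then have "entry_param \<sigma> (\<psi> t (\<sigma> * \<epsilon>, \<sigma> * \<epsilon> * y)) = \<sigma> * (\<sigma> * \<epsilon> * y * exp t) * exp (- t) / \<epsilon>"
    using alpha by (simp add: entry_param_def powr_def lin_flow_coords)
  also have "\<dots> = (\<sigma> * \<sigma>) * y * (exp t * exp (- t))" using eps by simp
  also have "\<dots> = y" using assms by (simp flip: exp_add)
  finally show "entry_param \<sigma> (\<psi> t (\<sigma> * \<epsilon>, \<sigma> * \<epsilon> * y)) = y" .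
  show "0 < \<sigma> * (fst (\<psi> t (\<sigma> * \<epsilon>, \<sigma> * \<epsilon> * y)) - d)"
    using sigma_side[OF assms] by (simp add: lin_flow_coords mult.assoc[symmetric])
qed

text \<open>The ratio of p2 - d to its value at the section determines the elapsed time, since p2 -
  d decays like exp (- \<alpha> t). The sign condition selects the side of the line p2 = d that is
  fed by the section of sign \<sigma>.\<close>

lemma passage_of_entry_param:
  assumes \<sigma>: "\<bar>\<sigma>\<bar> = 1" and p: "p \<in> W" "0 < \<sigma> * (fst p - d)" and y: "entry_param \<sigma> p \<noteq> 0" "\<bar>entry_param \<sigma> p\<bar> < 2 * \<bar>d\<bar>"
  shows "p \<in> passage \<sigma> (entry_param \<sigma> p)"
proof -
  define y where "y = entry_param \<sigma> p"
  define r where "r = (fst p - d) / (\<sigma> * \<epsilon> - d)"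
  define t where "t = - ln r / \<alpha>"
  have r0: "0 < r" unfolding r_def sigma_ratio[OF \<sigma>] using p(2) sigma_side[OF \<sigma>] by (rule divide_pos_pos)
  have "\<bar>fst p\<bar> \<le> \<epsilon>" "\<bar>snd p\<bar> \<le> 1 / \<epsilon>" using p(1) mu_eps eps inv_eps unfolding mem_W by auto
  then have "\<sigma> * (fst p - d) \<le> \<sigma> * (\<sigma> * \<epsilon> - d)" using \<sigma> by (auto simp: abs_if split: if_splits)
  then have r1: "r \<le> 1" unfolding r_def sigma_ratio[OF \<sigma>]
    using sigma_side[OF \<sigma>] by (subst divide_le_eq_1_pos)
  have ert: "exp (- \<alpha> * t) = r" using alpha r0 by (simp add: t_def)
  have epr: "r powr (1 / \<alpha>) = exp (- t)" using r0 alpha by (simp add: powr_def t_def)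
  have y_eq: "y = \<sigma> * snd p * exp (- t) / \<epsilon>" unfolding y_def entry_param_def r_def[symmetric] epr ..
  then have "\<sigma> * \<epsilon> * y * exp t = (\<sigma> * \<sigma>) * snd p * (exp (- t) * exp t)" using eps by simp
  also have "\<dots> = snd p" using \<sigma> by (simp flip: exp_add)
  finally have "snd (\<psi> t (\<sigma> * \<epsilon>, \<sigma> * \<epsilon> * y)) = snd p" by (simp add: lin_flow_coords)
  moreover have "fst (\<psi> t (\<sigma> * \<epsilon>, \<sigma> * \<epsilon> * y)) = fst p"
    using ert r0 unfolding lin_flow_coords by (auto simp: r_def)
  ultimately have p_eq: "p = \<psi> t (\<sigma> * \<epsilon>, \<sigma> * \<epsilon> * y)" by (simp add: prod_eq_iff)
  have "ln r \<le> 0" using r0 r1 by simp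
  then have "0 \<le> t" using alpha unfolding t_def by (intro divide_nonneg_pos) auto
  moreover have "t \<le> transit_time y"
  proof -
    have "\<bar>y\<bar> = \<bar>snd p\<bar> * exp (- t) / \<epsilon>" unfolding y_eq using \<sigma> eps by (simp add: abs_mult)
    also have "\<dots> \<le> (1 / \<epsilon>) * exp (- t) / \<epsilon>" using \<open>\<bar>snd p\<bar> \<le> 1 / \<epsilon>\<close> eps by (intro divide_right_mono mult_right_mono) auto
    finally have "exp (- transit_time y) \<le> exp (- t)"
      using eps y(1) by (simp add: exp_transit_time y_def[symmetric] field_simps power2_eq_square)
    then show ?thesis by simp
  qed
  ultimately show ?thesis unfolding passage_def y_def[symmetric] using p_eq by auto
qed

lemma openin_tube: 
  assumes "\<bar>\<sigma>\<bar> = 1"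
  shows "openin (top_of_set S2) {u \<in> U_int. 0 < \<sigma> * (fst (h u) - d) \<and> \<bar>entry_param \<sigma> (h u) - z\<bar> < r}"
proof -
  have ch: "continuous_on U h" using hom by (simp add: homeomorphism_def)
  have cU: "continuous_on U_int h" by (rule continuous_on_subset[OF ch]) (auto simp: U_int_def)
  define X where "X = {u \<in> U_int. 0 < \<sigma> * (fst (h u) - d)}"
  have "X = U_int \<inter> (\<lambda>u. \<sigma> * (fst (h u) - d)) -` {0<..}" by (auto simp: X_def)
  then have "openin (top_of_set U_int) X"
    by (auto intro!: continuous_openin_preimage_gen continuous_intros continuous_on_fst cU)
  then have X: "openin (top_of_set S2) X" using openin_U_int openin_trans by blast
  have "continuous_on X (\<lambda>u. \<bar>entry_param \<sigma> (h u) - z\<bar>)"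
  proof -
    have cX: "continuous_on X h" by (rule continuous_on_subset[OF cU]) (auto simp: X_def)
    have "(fst (h u) - d) / (\<sigma> * \<epsilon> - d) \<noteq> 0" if "u \<in> X" for u
      using that sigma_side[OF assms] unfolding X_def sigma_ratio[OF assms] by auto
    moreover have "\<sigma> * \<epsilon> - d \<noteq> 0" using sigma_side[OF assms] by auto
    ultimately show ?thesis unfolding entry_param_def using eps
      by (intro continuous_intros continuous_on_fst[OF cX] continuous_on_snd[OF cX] continuous_on_powr) auto
  qed
  then have "openin (top_of_set X) (X \<inter> (\<lambda>u. \<bar>entry_param \<sigma> (h u) - z\<bar>) -` {..<r})"
    by (rule continuous_openin_preimage_gen) simp
  then have "openin (top_of_set S2) (X \<inter> (\<lambda>u. \<bar>entry_param \<sigma> (h u) - z\<bar>) -` {..<r})" using X openin_trans by blast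
  moreover have "X \<inter> (\<lambda>u. \<bar>entry_param \<sigma> (h u) - z\<bar>) -` {..<r} =
    {u \<in> U_int. 0 < \<sigma> * (fst (h u) - d) \<and> \<bar>entry_param \<sigma> (h u) - z\<bar> < r}" by (auto simp: X_def)
  ultimately show ?thesis by simp
qed

text \<open>Start and end are within 2 \<epsilon> of two poles that are at distance at least 1, so
  the point moves by at least 1 - 4 \<epsilon>, uniformly in all data.\<close>

lemma transit_time_lower_bound:
  obtains \<theta> where "0 < \<theta>" "\<And>\<sigma> \<sigma>' x x' R. \<bar>\<sigma>\<bar> = 1 \<Longrightarrow> \<bar>\<sigma>'\<bar> = 1 \<Longrightarrow> \<bar>x\<bar> < \<mu> \<Longrightarrow> \<bar>x'\<bar> < \<mu> \<Longrightarrow> 0 < R \<Longrightarrow>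
    \<phi> R (entry \<sigma> x) = act \<sigma>' 1 (entry \<sigma>' x') \<Longrightarrow> \<theta> \<le> R"
proof -
  have "0 < 1 - 4 * \<epsilon>" using eps by simp
  then obtain \<theta> where \<theta>: "0 < \<theta>" "\<And>u t. u \<in> S2 \<Longrightarrow> \<bar>t\<bar> \<le> \<theta> \<Longrightarrow> dist (\<phi> t u) u < 1 - 4 * \<epsilon>"
    using flow_close_for_short_times by metis
  have "\<theta> \<le> R" if *: "\<bar>\<sigma>\<bar> = 1" "\<bar>\<sigma>'\<bar> = 1" "\<bar>x\<bar> < \<mu>" "\<bar>x'\<bar> < \<mu>" "0 < R"
    "\<phi> R (entry \<sigma> x) = act \<sigma>' 1 (entry \<sigma>' x')" for \<sigma> \<sigma>' x x' R
  proof (rule ccontr)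
    assume "\<not> \<theta> \<le> R"
    then have "dist (act \<sigma>' 1 (entry \<sigma>' x')) (entry \<sigma> x) < 1 - 4 * \<epsilon>"
      using \<theta>(2)[OF entry_S2[OF *(1,3)], of R] *(5,6) by simp
    moreover have "dist (entry \<sigma> x) (e 1) \<le> 2 * \<epsilon>" by (rule entry_near_e1[OF *(1,3)])
    moreover have "dist (act \<sigma>' 1 (entry \<sigma>' x')) (act \<sigma>' 1 (e 1)) \<le> 2 * \<epsilon>"
      unfolding dist_act[OF *(2)] by (rule entry_near_e1[OF *(2,4)])
    moreover have "dist (e 1) (act \<sigma>' 1 (e 1)) \<ge> 1" by (rule dist_act_e1[OF *(2)])
    moreover have "dist (e 1) (act \<sigma>' 1 (e 1)) \<le> dist (entry \<sigma> x) (e 1) + dist (act \<sigma>' 1 (entry \<sigma>' x')) (entry \<sigma> x)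
        + dist (act \<sigma>' 1 (entry \<sigma>' x')) (act \<sigma>' 1 (e 1))"
      using dist_triangle[of "e 1" "act \<sigma>' 1 (e 1)" "entry \<sigma> x"]
        dist_triangle[of "entry \<sigma> x" "act \<sigma>' 1 (e 1)" "act \<sigma>' 1 (entry \<sigma>' x')"] by (simp add: dist_commute)
    ultimately show False by linarith
  qed
  then show thesis using that \<theta>(1) by blast
qed

end

context cycle
begin

lemma periodic_mod: "\<tau> (n mod m) = \<tau> n" "\<sigma> (n mod m) = \<sigma> n" "x (n mod m) = x n" "act t (n mod m) = act t n"
proof -
  have "\<tau> (n mod m + k * m) = \<tau> (n mod m) \<and> \<sigma> (n mod m + k * m) = \<sigma> (n mod m) \<and> x (n mod m + k * m) = x (n mod m)
      \<and> act t (n mod m + k * m) = act t (n mod m)" for k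
  proof (induction k)
    case (Suc k)
    have "n mod m + Suc k * m = (n mod m + k * m) + m" by simp
    then show ?case using Suc by (simp only: periodic act_add_m)
  qed simp
  from this[of "n div m"] show "\<tau> (n mod m) = \<tau> n" "\<sigma> (n mod m) = \<sigma> n" "x (n mod m) = x n" "act t (n mod m) = act t n"
    by simp_all
qed

context
  fixes \<rho> :: real
  assumes \<rho>: "0 < \<rho>" and near: "\<And>n y. \<bar>y - x n\<bar> < \<rho> \<Longrightarrow> sgn y = sgn (x n) \<and> \<bar>y\<bar> < 2 * \<bar>d\<bar>"
begin

text \<open>Full passages whose entry parameter is close to that of the cycle. The radius is halved
  with k because one passage, forward for an attracting cycle and backward for a repelling one, at
  least halves the distance, so it leads from \<open>gates k\<close> to
  \<open>gates (Suc k)\<close>.\<close>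

definition tubes :: "nat \<Rightarrow> (real^3) set" where
  "tubes k = (\<Union>n. \<Union>y\<in>{y. \<bar>y - x n\<bar> < \<rho> / 2 ^ k}. act (\<tau> n) n ` h' ` passage (\<sigma> n) y)"

definition gates :: "nat \<Rightarrow> (real^3) set" where
  "gates k = (\<Union>n. \<Union>y\<in>{y. \<bar>y - x n\<bar> < \<rho> / 2 ^ k}. {act (\<tau> n) n (entry (\<sigma> n) y)})"

lemma rho_k: "0 < \<rho> / 2 ^ k" "\<rho> / 2 ^ k \<le> \<rho>" "\<rho> / 2 ^ Suc k = \<rho> / 2 ^ k / 2"
  using \<rho> by (auto simp: field_simps)

lemma near_k:
  assumes "\<bar>y - x n\<bar> < \<rho> / 2 ^ k"
  shows "sgn y = sgn (x n)" "y \<noteq> 0" "\<bar>y\<bar> < 2 * \<bar>d\<bar>" "\<bar>y\<bar> < \<mu>"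
proof -
  have "\<bar>y - x n\<bar> < \<rho>" using assms rho_k(2)[of k] by linarith
  then show *: "sgn y = sgn (x n)" "\<bar>y\<bar> < 2 * \<bar>d\<bar>" using near by auto
  then show "y \<noteq> 0" "\<bar>y\<bar> < \<mu>" using x(1)[of n] two_d_less_mu by (auto simp: sgn_0_0)
qed

lemma near_transit:
  assumes "\<bar>y - x n\<bar> < \<rho> / 2 ^ k"
  obtains R where "0 < R" "\<phi> R (entry (\<sigma> n) y) = act (\<sigma> (Suc n)) 1 (entry (\<sigma> (Suc n)) (F (\<sigma> n) y))"
    "\<bar>F (\<sigma> n) y\<bar> < \<mu>" "(\<lambda>s. \<phi> s (entry (\<sigma> n) y)) ` {0..R} = h' ` passage (\<sigma> n) y"
  using transit[OF unit(2)[of n] near_k(2,3)[OF assms]] unfolding near_k(1)[OF assms] step(1)[symmetric] by metis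

lemma passage_W_near: "\<bar>y - x n\<bar> < \<rho> / 2 ^ k \<Longrightarrow> passage (\<sigma> n) y \<subseteq> W"
  unfolding passage_def using path_in_W[OF unit(2)] near_k by auto

lemma flow_act_entry_near:
  "\<bar>y - x n\<bar> < \<rho> / 2 ^ k \<Longrightarrow> \<phi> s (act (\<tau> n) n (entry (\<sigma> n) y)) = act (\<tau> n) n (\<phi> s (entry (\<sigma> n) y))"
  by (rule flow_act[OF unit(1) entry_S2[OF unit(2)]]) (rule near_k(4))

lemma tubes_S2: "tubes k \<subseteq> S2"
proof
  fix u assume "u \<in> tubes k"
  then obtain n y p where y: "\<bar>y - x n\<bar> < \<rho> / 2 ^ k" "p \<in> passage (\<sigma> n) y" "u = act (\<tau> n) n (h' p)"
    unfolding tubes_def by blast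
  then have "h' p \<in> S2" using passage_W_near[OF y(1)] U_S2[OF h_inv(4)] by blast
  then show "u \<in> S2" using y(3) act_S2[OF unit(1)] by blast
qed

lemma gates_S2: "gates k \<subseteq> S2"
proof
  fix u assume "u \<in> gates k"
  then obtain n y where y: "\<bar>y - x n\<bar> < \<rho> / 2 ^ k" "u = act (\<tau> n) n (entry (\<sigma> n) y)"
    unfolding gates_def by blast
  then show "u \<in> S2" using entry_S2[OF unit(2) near_k(4)[OF y(1)]] act_S2[OF unit(1)] by blast
qed

lemma tubes_mono: "tubes (Suc k) \<subseteq> tubes k"
proof -
  have "\<rho> / 2 ^ Suc k \<le> \<rho> / 2 ^ k" using \<rho> by (simp add: field_simps)
  then show ?thesis unfolding tubes_def by (fastforce intro: less_le_trans)
qed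

lemma tubes_memI:
  assumes "\<bar>y - x n\<bar> < \<rho> / 2 ^ k" "u \<in> h' ` passage (\<sigma> n) y"
  shows "act (\<tau> n) n u \<in> tubes k"
  unfolding tubes_def using assms by blast

lemma gates_memI:
  assumes "\<bar>y - x n\<bar> < \<rho> / 2 ^ k"
  shows "act (\<tau> n) n (entry (\<sigma> n) y) \<in> gates k"
  unfolding gates_def using assms by blast

text \<open>Passages have varying duration. Rescaling time by the transit time parametrises them all
  by a fixed compact interval, and uniform continuity over that interval applies.\<close>

lemma tubes_near:
  assumes V: "openin (top_of_set S2) V" and sub: "act (\<tau> n) n ` h' ` passage (\<sigma> n) (x n) \<subseteq> V"
  shows "\<exists>r>0. \<forall>y. \<bar>y - x n\<bar> < r \<longrightarrow> act (\<tau> n) n ` h' ` passage (\<sigma> n) y \<subseteq> V"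
proof -
  define \<Theta> where "\<Theta> = (\<lambda>(y, \<theta>). act (\<tau> n) n (h' (\<psi> (\<theta> * transit_time y) (\<sigma> n * \<epsilon>, \<sigma> n * \<epsilon> * y))))"
  define B where "B = {y. \<bar>y - x n\<bar> < \<rho>}"
  have B: "y \<noteq> 0" "\<bar>y\<bar> < 2 * \<bar>d\<bar>" if "y \<in> B" for y using near_k(2,3)[of y n 0] that by (auto simp: B_def)
  have xB: "x n \<in> B" using \<rho> by (simp add: B_def)
  obtain G where G: "open G" "V = S2 \<inter> G" using V by (auto simp: openin_open)
  have in_passage: "\<psi> (\<theta> * transit_time y) (\<sigma> n * \<epsilon>, \<sigma> n * \<epsilon> * y) \<in> passage (\<sigma> n) y" if "y \<in> B" "\<theta> \<in> {0..1}" for y \<theta>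
    unfolding passage_def using that transit_time_pos[OF B[OF that(1)]] by (intro imageI) (auto simp: mult_left_le_one_le)
  have passage_cover: "\<exists>\<theta>\<in>{0..1}. p = \<psi> (\<theta> * transit_time y) (\<sigma> n * \<epsilon>, \<sigma> n * \<epsilon> * y)" if yB: "y \<in> B" and p: "p \<in> passage (\<sigma> n) y" for y p
  proof -
    obtain t where t: "0 \<le> t" "t \<le> transit_time y" "p = \<psi> t (\<sigma> n * \<epsilon>, \<sigma> n * \<epsilon> * y)" using p by (auto simp: passage_def)
    have "transit_time y > 0" by (rule transit_time_pos[OF B[OF yB]])
    then show ?thesis using t by (intro bexI[of _ "t / transit_time y"]) (auto simp: field_simps)
  qed
  have passageW: "passage (\<sigma> n) y \<subseteq> W" if "y \<in> B" for y using passage_W_near[of y n 0] that by (simp add: B_def)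
  have cont: "continuous_on (B \<times> {0..1}) \<Theta>"
  proof -
    have ct: "continuous_on (B \<times> {0..1::real}) (\<lambda>p. transit_time (fst p))"
      unfolding transit_time_def using B eps
      by (intro continuous_intros continuous_on_fst continuous_on_id) auto
    have "continuous_on (B \<times> {0..1}) (\<lambda>p. \<psi> (snd p * transit_time (fst p)) (\<sigma> n * \<epsilon>, \<sigma> n * \<epsilon> * fst p))"
      unfolding lin_flow_def prod.case by (intro continuous_intros ct continuous_on_fst continuous_on_snd continuous_on_id)
    moreover have "continuous_on W (\<lambda>p. act (\<tau> n) n (h' p))"
      using hom unfolding homeomorphism_def by (intro continuous_on_compose2[OF continuous_on_act[of UNIV]]) auto
    ultimately have "continuous_on (B \<times> {0..1}) (\<lambda>p. act (\<tau> n) n (h' (\<psi> (snd p * transit_time (fst p)) (\<sigma> n * \<epsilon>, \<sigma> n * \<epsilon> * fst p))))"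
      using in_passage passageW by (elim continuous_on_compose2) (auto, blast)
    then show ?thesis by (simp add: \<Theta>_def case_prod_unfold)
  qed
  have "compact ((\<lambda>\<theta>. \<Theta> (x n, \<theta>)) ` {0..1})"
  proof (intro compact_continuous_image compact_Icc)
    show "continuous_on {0..1} (\<lambda>\<theta>. \<Theta> (x n, \<theta>))"
      using xB by (intro continuous_on_compose2[OF cont]) (auto intro!: continuous_on_Pair continuous_on_const continuous_on_id)
  qed
  moreover have "(\<lambda>\<theta>. \<Theta> (x n, \<theta>)) ` {0..1} \<subseteq> G"
    using sub in_passage[OF xB] G(2) by (auto simp: \<Theta>_def)
  ultimately obtain r where r: "r > 0" "(\<Union>w\<in>(\<lambda>\<theta>. \<Theta> (x n, \<theta>)) ` {0..1}. ball w r) \<subseteq> G"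
    using compact_subset_open_imp_ball_epsilon_subset G(1) by blast
  obtain X0 where X0: "x n \<in> X0" "open X0" "\<forall>y\<in>X0 \<inter> B. \<forall>\<theta>\<in>{0..1}. dist (\<Theta> (y, \<theta>)) (\<Theta> (x n, \<theta>)) \<le> r/2"
    by (rule continuous_on_prod_compactE[OF cont compact_Icc xB, of "r/2"]) (use r(1) in auto)
  obtain r1 where r1: "r1 > 0" "ball (x n) r1 \<subseteq> X0" using X0(1,2) open_contains_ball by blast
  have "act (\<tau> n) n ` h' ` passage (\<sigma> n) y \<subseteq> V" if y: "\<bar>y - x n\<bar> < min r1 \<rho>" for y
  proof
    fix w assume "w \<in> act (\<tau> n) n ` h' ` passage (\<sigma> n) y"
    then obtain p where p: "p \<in> passage (\<sigma> n) y" "w = act (\<tau> n) n (h' p)" by blast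
    have yB: "y \<in> B" using y by (simp add: B_def)
    have "y \<in> X0" using r1(2) y by (auto simp: dist_real_def abs_minus_commute)
    obtain \<theta> where \<theta>: "\<theta> \<in> {0..1}" "w = \<Theta> (y, \<theta>)" using passage_cover[OF yB p(1)] p(2) by (auto simp: \<Theta>_def)
    then have "dist w (\<Theta> (x n, \<theta>)) \<le> r/2" using X0(3) \<open>y \<in> X0\<close> yB by blast
    then have "w \<in> ball (\<Theta> (x n, \<theta>)) r" using r(1) by (simp add: dist_commute)
    then have "w \<in> G" using r(2) \<theta>(1) by blast
    moreover have "w \<in> S2" using p passageW[OF yB] U_S2[OF h_inv(4)] act_S2[OF unit(1)] by blast
    ultimately show "w \<in> V" using G(2) by blast
  qed
  then show ?thesis using r1(1) \<rho> by (intro exI[of _ "min r1 \<rho>"]) auto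
qed

lemma tubes_basis:
  assumes V: "openin (top_of_set S2) V" "orbit \<phi> (pt 0) \<subseteq> V"
  shows "\<exists>k. tubes k \<subseteq> V"
proof -
  have "\<forall>n. \<exists>r>0. \<forall>y. \<bar>y - x n\<bar> < r \<longrightarrow> act (\<tau> n) n ` h' ` passage (\<sigma> n) y \<subseteq> V"
    using tubes_near[OF V(1)] V(2) unfolding orbit_pt by blast
  then obtain r where r: "\<And>n. r n > 0" "\<And>n y. \<bar>y - x n\<bar> < r n \<Longrightarrow> act (\<tau> n) n ` h' ` passage (\<sigma> n) y \<subseteq> V"
    by metis
  \<comment> \<open>By periodicity only m of the radii occur, so their minimum is positive.\<close>
  define r0 where "r0 = Min (r ` {..<m})"
  have "r0 > 0" unfolding r0_def using m(1) r(1) by (subst Min_gr_iff) auto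
  have r0: "r0 \<le> r (n mod m)" for n unfolding r0_def using m(1) by (intro Min_le) auto
  obtain k where k: "\<rho> / r0 < 2 ^ k" using real_arch_pow[of 2 "\<rho> / r0"] by auto
  then have "\<rho> / 2 ^ k < r0" using \<open>r0 > 0\<close> by (simp add: field_simps)
  have "tubes k \<subseteq> V"
  proof
    fix w assume "w \<in> tubes k"
    then obtain n y where y: "\<bar>y - x n\<bar> < \<rho> / 2 ^ k" "w \<in> act (\<tau> n) n ` h' ` passage (\<sigma> n) y"
      unfolding tubes_def by blast
    have "\<bar>y - x (n mod m)\<bar> < r (n mod m)"
      using y(1) \<open>\<rho> / 2 ^ k < r0\<close> r0[of n] by (simp add: periodic_mod)
    from r(2)[OF this] show "w \<in> V" using y(2) by (auto simp: periodic_mod)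
  qed
  then show ?thesis by blast
qed

text \<open>A tube need not be open where it crosses sections. Its part in the interior of the
  initial cell is open by \<open>openin_tube\<close>, and every point of the periodic orbit reaches
  that part.\<close>

lemma tubes_nbhd:
  assumes \<kappa>: "\<bar>\<kappa>\<bar> = 1"
  shows "\<exists>O'. openin (top_of_set S2) O' \<and> O' \<subseteq> tubes k \<and> (\<forall>u\<in>orbit \<phi> (pt 0). \<exists>t\<ge>0. \<phi> (\<kappa> * t) u \<in> O')"
proof -
  define Q where "Q = {u \<in> U_int. 0 < \<sigma> 0 * (fst (h u) - d) \<and> \<bar>entry_param (\<sigma> 0) (h u) - x 0\<bar> < \<rho> / 2 ^ k}"
  define O' where "O' = act (\<tau> 0) 0 ` Q"
  have "openin (top_of_set S2) O'"
    unfolding O'_def Q_def by (intro openin_act[OF unit(1)] openin_tube[OF unit(2)])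
  moreover have "O' \<subseteq> tubes k"
  proof
    fix w assume "w \<in> O'"
    then obtain u where u: "u \<in> Q" "w = act (\<tau> 0) 0 u" by (auto simp: O'_def)
    then have q: "u \<in> U" "0 < \<sigma> 0 * (fst (h u) - d)" "\<bar>entry_param (\<sigma> 0) (h u) - x 0\<bar> < \<rho> / 2 ^ k"
      by (auto simp: Q_def U_int_def)
    have "h u \<in> passage (\<sigma> 0) (entry_param (\<sigma> 0) (h u))"
      by (rule passage_of_entry_param[OF unit(2) h_inv(3)[OF q(1)] q(2) near_k(2,3)[OF q(3)]])
    then have "u \<in> h' ` passage (\<sigma> 0) (entry_param (\<sigma> 0) (h u))" using h_inv(1)[OF q(1)] by (metis imageI)
    then show "w \<in> tubes k" unfolding u(2) by (rule tubes_memI[OF q(3)])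
  qed
  moreover have "\<exists>t\<ge>0. \<phi> (\<kappa> * t) u \<in> O'" if u: "u \<in> orbit \<phi> (pt 0)" for u
  proof -
    define v where "v = \<phi> (ret 0 / 2) (entry (\<sigma> 0) (x 0))"
    have vi: "v \<in> U_int" unfolding v_def using ret_pos[of 0] by (intro ret_int) auto
    have "v \<in> h' ` passage (\<sigma> 0) (x 0)"
      unfolding v_def ret_passage[symmetric] using ret_pos[of 0] by (intro imageI) auto
    then obtain p where p: "p \<in> passage (\<sigma> 0) (x 0)" "v = h' p" by blast
    have "h v = p" using p passage_W[of 0] by auto
    then have "v \<in> Q" unfolding Q_def using vi p(1) entry_param_path[OF unit(2)[of 0]] rho_k(1)[of k] by (auto simp: passage_def)
    then have "act (\<tau> 0) 0 v \<in> O'" by (simp add: O'_def)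
    moreover have "act (\<tau> 0) 0 v \<in> orbit \<phi> (pt 0)" unfolding orbit_pt using p by blast
    then have "\<exists>t\<ge>0. \<phi> (\<kappa> * t) u = act (\<tau> 0) 0 v"
      by (intro periodic_orbit_reaches[OF pt_S2 has_period_pt u _ \<kappa>])
    ultimately show ?thesis by metis
  qed
  ultimately show ?thesis by blast
qed

lemma orbit_pt_S2: "orbit \<phi> (pt 0) \<subseteq> S2"
  using orbit_mem_S2[OF pt_S2] by blast

lemma gate_times:
  obtains \<theta> where "0 < \<theta>" "\<And>n k y R. \<bar>y - x n\<bar> < \<rho> / 2 ^ k \<Longrightarrow> 0 < R \<Longrightarrow> \<bar>F (\<sigma> n) y\<bar> < \<mu> \<Longrightarrow>
    \<phi> R (entry (\<sigma> n) y) = act (\<sigma> (Suc n)) 1 (entry (\<sigma> (Suc n)) (F (\<sigma> n) y)) \<Longrightarrow> \<theta> \<le> R"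
proof -
  obtain \<theta> where "0 < \<theta>" "\<And>\<sigma> \<sigma>' x x' R. \<bar>\<sigma>\<bar> = 1 \<Longrightarrow> \<bar>\<sigma>'\<bar> = 1 \<Longrightarrow> \<bar>x\<bar> < \<mu> \<Longrightarrow> \<bar>x'\<bar> < \<mu> \<Longrightarrow> 0 < R \<Longrightarrow>
    \<phi> R (entry \<sigma> x) = act \<sigma>' 1 (entry \<sigma>' x') \<Longrightarrow> \<theta> \<le> R" using transit_time_lower_bound by metis
  then show thesis using that near_k(4) unit(2) by metis
qed

lemma act_step: "act (\<tau> n) n (act (\<sigma> (Suc n)) 1 u) = act (\<tau> (Suc n)) (Suc n) u"
  by (simp add: act_act step(2))

text \<open>From anywhere in a tube the flow runs along the present passage to its exit, which is a
  gate; each further passage halves the distance to the cycle.\<close>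

lemma attracting_cycle:
  assumes contr: "\<And>n y. \<bar>y - x n\<bar> < \<rho> \<Longrightarrow> \<bar>F (\<sigma> n) y - x (Suc n)\<bar> \<le> \<bar>y - x n\<bar> / 2"
  shows "attracting \<phi> (orbit \<phi> (pt 0))"
proof -
  obtain \<theta> where \<theta>: "0 < \<theta>" "\<And>n k y R. \<bar>y - x n\<bar> < \<rho> / 2 ^ k \<Longrightarrow> 0 < R \<Longrightarrow> \<bar>F (\<sigma> n) y\<bar> < \<mu> \<Longrightarrow>
    \<phi> R (entry (\<sigma> n) y) = act (\<sigma> (Suc n)) 1 (entry (\<sigma> (Suc n)) (F (\<sigma> n) y)) \<Longrightarrow> \<theta> \<le> R"
    using gate_times by metis
  have F: "\<bar>F (\<sigma> n) y - x (Suc n)\<bar> < \<rho> / 2 ^ Suc k" if "\<bar>y - x n\<bar> < \<rho> / 2 ^ k" for n y k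
  proof -
    have "\<bar>y - x n\<bar> < \<rho>" using that rho_k(2)[of k] by linarith
    moreover have "\<bar>y - x n\<bar> / 2 < \<rho> / 2 ^ k / 2" using that by (rule divide_strict_right_mono) simp
    ultimately show ?thesis unfolding rho_k(3) using contr by (blast intro: le_less_trans)
  qed
  have "attracting (\<lambda>t. \<phi> (1 * t)) (orbit \<phi> (pt 0))"
  proof (rule attracting_by_traps[OF \<theta>(1) orbit_pt_S2 tubes_S2 gates_S2 tubes_mono _ tubes_basis tubes_nbhd])
    show "\<phi> t u \<in> orbit \<phi> (pt 0)" if "u \<in> orbit \<phi> (pt 0)" for u t by (rule orbit_flow[OF pt_S2 that])
    show "\<exists>t\<ge>0. (\<forall>s\<in>{0..t}. \<phi> (1 * s) u \<in> tubes k) \<and> \<phi> (1 * t) u \<in> gates k" if u: "u \<in> tubes k" for k u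
    proof -
      obtain n y v where y: "\<bar>y - x n\<bar> < \<rho> / 2 ^ k" "v \<in> h' ` passage (\<sigma> n) y" "u = act (\<tau> n) n v"
        using u unfolding tubes_def by blast
      obtain R where R: "0 < R" "\<phi> R (entry (\<sigma> n) y) = act (\<sigma> (Suc n)) 1 (entry (\<sigma> (Suc n)) (F (\<sigma> n) y))"
        "\<bar>F (\<sigma> n) y\<bar> < \<mu>" "(\<lambda>s. \<phi> s (entry (\<sigma> n) y)) ` {0..R} = h' ` passage (\<sigma> n) y"
        using near_transit[OF y(1)] by metis
      obtain r where r: "0 \<le> r" "r \<le> R" "v = \<phi> r (entry (\<sigma> n) y)" using y(2) unfolding R(4)[symmetric] by auto
      have eS: "entry (\<sigma> n) y \<in> S2" by (rule entry_S2[OF unit(2) near_k(4)[OF y(1)]])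
      have fl: "\<phi> s u = act (\<tau> n) n (\<phi> (s + r) (entry (\<sigma> n) y))" for s
        unfolding y(3) r(3) flow_act[OF unit(1) flow_S2[OF eS]] flow_add[OF eS] ..
      have "\<phi> s u \<in> tubes k" if "0 \<le> s" "s \<le> R - r" for s
        unfolding fl by (rule tubes_memI[OF y(1)]) (use that r in \<open>auto simp: R(4)[symmetric]\<close>)
      moreover have "\<phi> (R - r) u \<in> gates k"
      proof -
        have "\<rho> / 2 ^ Suc k \<le> \<rho> / 2 ^ k" using \<rho> by (simp add: field_simps)
        then have "\<bar>F (\<sigma> n) y - x (Suc n)\<bar> < \<rho> / 2 ^ k" using F[OF y(1)] by (rule less_le_trans[rotated])
        moreover have "\<phi> (R - r) u = act (\<tau> (Suc n)) (Suc n) (entry (\<sigma> (Suc n)) (F (\<sigma> n) y))"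
          unfolding fl by (simp only: diff_add_cancel R(2) act_step)
        ultimately show ?thesis by (simp only: gates_memI)
      qed
      ultimately show ?thesis using r by (intro exI[of _ "R - r"]) auto
    qed
    show "\<exists>t\<ge>\<theta>. (\<forall>s\<in>{0..t}. \<phi> (1 * s) u \<in> tubes k) \<and> \<phi> (1 * t) u \<in> gates (Suc k)" if u: "u \<in> gates k" for k u
    proof -
      obtain n y where y: "\<bar>y - x n\<bar> < \<rho> / 2 ^ k" "u = act (\<tau> n) n (entry (\<sigma> n) y)"
        using u unfolding gates_def by blast
      obtain R where R: "0 < R" "\<phi> R (entry (\<sigma> n) y) = act (\<sigma> (Suc n)) 1 (entry (\<sigma> (Suc n)) (F (\<sigma> n) y))"
        "\<bar>F (\<sigma> n) y\<bar> < \<mu>" "(\<lambda>s. \<phi> s (entry (\<sigma> n) y)) ` {0..R} = h' ` passage (\<sigma> n) y"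
        using near_transit[OF y(1)] by metis
      have fl: "\<phi> s u = act (\<tau> n) n (\<phi> s (entry (\<sigma> n) y))" for s
        unfolding y(2) by (rule flow_act_entry_near[OF y(1)])
      have "\<theta> \<le> R" by (rule \<theta>(2)[OF y(1) R(1,3,2)])
      moreover have "\<phi> s u \<in> tubes k" if "0 \<le> s" "s \<le> R" for s
        unfolding fl by (rule tubes_memI[OF y(1)]) (use that in \<open>auto simp: R(4)[symmetric]\<close>)
      moreover have "\<phi> R u \<in> gates (Suc k)"
        unfolding fl R(2) act_step by (rule gates_memI[OF F[OF y(1)]])
      ultimately show ?thesis by (intro exI[of _ R]) auto
    qed
  qed simp_all
  then show ?thesis by simp
qed

text \<open>In reversed time a passage is followed back to its own entry, which is already a gate.
  The next step needs a preimage under the exit map, so the hypothesis is a covering property with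
  halved radius instead of a contraction estimate.\<close>

lemma repelling_cycle:
  assumes expand: "\<And>n z r. 0 < r \<Longrightarrow> r \<le> \<rho> \<Longrightarrow> \<bar>z - x (Suc n)\<bar> < r \<Longrightarrow> \<exists>y. \<bar>y - x n\<bar> < r / 2 \<and> F (\<sigma> n) y = z"
  shows "repelling \<phi> (orbit \<phi> (pt 0))"
proof -
  obtain \<theta> where \<theta>: "0 < \<theta>" "\<And>n k y R. \<bar>y - x n\<bar> < \<rho> / 2 ^ k \<Longrightarrow> 0 < R \<Longrightarrow> \<bar>F (\<sigma> n) y\<bar> < \<mu> \<Longrightarrow>
    \<phi> R (entry (\<sigma> n) y) = act (\<sigma> (Suc n)) 1 (entry (\<sigma> (Suc n)) (F (\<sigma> n) y)) \<Longrightarrow> \<theta> \<le> R"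
    using gate_times by metis
  have "attracting (\<lambda>t. \<phi> (-1 * t)) (orbit \<phi> (pt 0))"
  proof (rule attracting_by_traps[OF \<theta>(1) orbit_pt_S2 tubes_S2 gates_S2 tubes_mono _ tubes_basis tubes_nbhd])
    show "\<phi> t u \<in> orbit \<phi> (pt 0)" if "u \<in> orbit \<phi> (pt 0)" for u t by (rule orbit_flow[OF pt_S2 that])
    show "\<exists>t\<ge>0. (\<forall>s\<in>{0..t}. \<phi> (-1 * s) u \<in> tubes k) \<and> \<phi> (-1 * t) u \<in> gates k" if u: "u \<in> tubes k" for k u
    proof -
      obtain n y v where y: "\<bar>y - x n\<bar> < \<rho> / 2 ^ k" "v \<in> h' ` passage (\<sigma> n) y" "u = act (\<tau> n) n v"
        using u unfolding tubes_def by blast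
      obtain R where R: "0 < R" "(\<lambda>s. \<phi> s (entry (\<sigma> n) y)) ` {0..R} = h' ` passage (\<sigma> n) y"
        using near_transit[OF y(1)] by metis
      obtain r where r: "0 \<le> r" "r \<le> R" "v = \<phi> r (entry (\<sigma> n) y)" using y(2) unfolding R(2)[symmetric] by auto
      have eS: "entry (\<sigma> n) y \<in> S2" by (rule entry_S2[OF unit(2) near_k(4)[OF y(1)]])
      have fl: "\<phi> s u = act (\<tau> n) n (\<phi> (s + r) (entry (\<sigma> n) y))" for s
        unfolding y(3) r(3) flow_act[OF unit(1) flow_S2[OF eS]] flow_add[OF eS] ..
      have "\<phi> (-1 * s) u \<in> tubes k" if "0 \<le> s" "s \<le> r" for s
        unfolding fl by (rule tubes_memI[OF y(1)]) (use that r in \<open>auto simp: R(2)[symmetric]\<close>)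
      moreover have "\<phi> (-1 * r) u \<in> gates k"
        unfolding fl using gates_memI[OF y(1)] eS by simp
      ultimately show ?thesis using r by (intro exI[of _ r]) auto
    qed
    show "\<exists>t\<ge>\<theta>. (\<forall>s\<in>{0..t}. \<phi> (-1 * s) u \<in> tubes k) \<and> \<phi> (-1 * t) u \<in> gates (Suc k)" if u: "u \<in> gates k" for k u
    proof -
      obtain n0 z where z0: "\<bar>z - x n0\<bar> < \<rho> / 2 ^ k" "u = act (\<tau> n0) n0 (entry (\<sigma> n0) z)"
        using u unfolding gates_def by blast
      \<comment> \<open>A predecessor index modulo m; adding m avoids the case n0 = 0.\<close>
      define n where "n = n0 + m - 1"
      have n: "Suc n = n0 + m" using m(1) by (simp add: n_def)
      have z: "\<bar>z - x (Suc n)\<bar> < \<rho> / 2 ^ k" "u = act (\<tau> (Suc n)) (Suc n) (entry (\<sigma> (Suc n)) z)"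
        using z0 unfolding n by (simp_all add: periodic act_add_m)
      obtain y where y: "\<bar>y - x n\<bar> < \<rho> / 2 ^ Suc k" "F (\<sigma> n) y = z"
        using expand[OF rho_k(1,2) z(1)] unfolding rho_k(3) by blast
      obtain R where R: "0 < R" "\<phi> R (entry (\<sigma> n) y) = act (\<sigma> (Suc n)) 1 (entry (\<sigma> (Suc n)) (F (\<sigma> n) y))"
        "\<bar>F (\<sigma> n) y\<bar> < \<mu>" "(\<lambda>s. \<phi> s (entry (\<sigma> n) y)) ` {0..R} = h' ` passage (\<sigma> n) y"
        using near_transit[OF y(1)] by metis
      have eS: "entry (\<sigma> n) y \<in> S2" by (rule entry_S2[OF unit(2) near_k(4)[OF y(1)]])
      have u: "u = act (\<tau> n) n (\<phi> R (entry (\<sigma> n) y))"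
        unfolding R(2) act_step y(2) z(2) ..
      have fl: "\<phi> s u = act (\<tau> n) n (\<phi> (s + R) (entry (\<sigma> n) y))" for s
        unfolding u flow_act[OF unit(1) flow_S2[OF eS]] flow_add[OF eS] ..
      have "\<theta> \<le> R" by (rule \<theta>(2)[OF y(1) R(1,3,2)])
      moreover have "\<phi> (-1 * s) u \<in> tubes k" if "0 \<le> s" "s \<le> R" for s
        unfolding fl by (rule subsetD[OF tubes_mono], rule tubes_memI[OF y(1)]) (use that in \<open>auto simp: R(4)[symmetric]\<close>)
      moreover have "\<phi> (-1 * R) u \<in> gates (Suc k)"
        unfolding fl using gates_memI[OF y(1)] eS by simp
      ultimately show ?thesis by (intro exI[of _ R]) auto
    qed
  qed simp_all
  then show ?thesis unfolding repelling_def by simp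
qed

end
end

section \<open>The exit map\<close>

lemma powr_contraction:
  fixes \<alpha> M s t :: real
  assumes "1 < \<alpha>" "0 \<le> s" "s \<le> M" "0 \<le> t" "t \<le> M"
  shows "\<bar>s powr \<alpha> - t powr \<alpha>\<bar> \<le> \<alpha> * M powr (\<alpha> - 1) * \<bar>s - t\<bar>"
proof -
  have main: "t powr \<alpha> - s powr \<alpha> \<le> \<alpha> * M powr (\<alpha> - 1) * (t - s)" if "0 \<le> s" "s < t" "t \<le> M" for s t
  \<comment> \<open>The mean value theorem needs a derivative at the left end point too, so s = 0 is
    treated by factoring t powr \<alpha>.\<close>
  proof (cases "s = 0")
    case True
    have "t powr \<alpha> = t powr (\<alpha> - 1) * t" using that True by (simp add: powr_diff)
    also have "\<dots> \<le> M powr (\<alpha> - 1) * t" using that assms True by (intro mult_right_mono powr_mono2) auto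
    also have "\<dots> \<le> \<alpha> * M powr (\<alpha> - 1) * t" using that assms True by (intro mult_right_mono) auto
    finally show ?thesis using True by simp
  next
    case False
    then have s: "0 < s" using that by simp
    have "\<exists>z>s. z < t \<and> t powr \<alpha> - s powr \<alpha> = (t - s) * (\<alpha> * z powr (\<alpha> - 1))"
      using s that by (intro MVT2) (auto intro!: derivative_eq_intros simp: powr_diff)
    then obtain z where z: "s < z" "z < t" "t powr \<alpha> - s powr \<alpha> = (t - s) * (\<alpha> * z powr (\<alpha> - 1))" by blast
    have "z powr (\<alpha> - 1) \<le> M powr (\<alpha> - 1)" using z s that assms by (intro powr_mono2) auto
    then have "(t - s) * (\<alpha> * z powr (\<alpha> - 1)) \<le> (t - s) * (\<alpha> * M powr (\<alpha> - 1))"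
      using that assms by (intro mult_left_mono) auto
    then show ?thesis using z(3) by (simp add: mult.commute)
  qed
  have mono: "s powr \<alpha> \<le> t powr \<alpha>" if "0 \<le> s" "s < t" for s t using that assms by (intro powr_mono2) auto
  show ?thesis using main[of s t] main[of t s] mono[of s t] mono[of t s] assms
    by (cases s t rule: linorder_cases) (auto simp: abs_if)
qed

lemma powr_expansion:
  fixes \<alpha> M s t :: real
  assumes "0 < \<alpha>" "\<alpha> < 1" "0 < s" "s \<le> t" "t \<le> M"
  shows "\<alpha> * M powr (\<alpha> - 1) * (t - s) \<le> t powr \<alpha> - s powr \<alpha>"
proof (cases "s = t")
  case False
  then have "\<exists>z>s. z < t \<and> t powr \<alpha> - s powr \<alpha> = (t - s) * (\<alpha> * z powr (\<alpha> - 1))"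
    using assms by (intro MVT2) (auto intro!: derivative_eq_intros simp: powr_diff)
  then obtain z where z: "s < z" "z < t" "t powr \<alpha> - s powr \<alpha> = (t - s) * (\<alpha> * z powr (\<alpha> - 1))" by blast
  have "M powr (\<alpha> - 1) \<le> z powr (\<alpha> - 1)" using z assms by (intro powr_mono2') auto
  then have "(t - s) * (\<alpha> * M powr (\<alpha> - 1)) \<le> (t - s) * (\<alpha> * z powr (\<alpha> - 1))"
    using assms by (intro mult_left_mono) auto
  then show ?thesis using z(3) by (simp add: mult.commute)
qed simp

context linearised
begin

definition K :: "real \<Rightarrow> real" where
  "K \<sigma> = (\<sigma> * \<epsilon> - d) * (\<epsilon>\<^sup>2) powr \<alpha>"

text \<open>A lower bound for the modulus of \<open>K\<close> that is free of d, because \<mu> has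
  to be fixed before d. It comes from |d| \<le> \<epsilon> / 2.\<close>

definition K_min :: real where
  "K_min = \<epsilon> / 2 * (\<epsilon>\<^sup>2) powr \<alpha>"

lemma F_K: "F \<sigma> x = d + K \<sigma> * \<bar>x\<bar> powr \<alpha>"
  by (simp add: F_def K_def powr_mult)

lemma eps_powr: "0 < (\<epsilon>\<^sup>2) powr \<alpha>" "(\<epsilon>\<^sup>2) powr \<alpha> \<le> 1"
proof -
  show "0 < (\<epsilon>\<^sup>2) powr \<alpha>" using eps by simp
  have "\<epsilon>\<^sup>2 \<le> 1" using eps_sq eps by linarith
  then show "(\<epsilon>\<^sup>2) powr \<alpha> \<le> 1" using alpha by (intro powr_le1) auto
qed

lemma K_le_1: "\<bar>\<sigma>\<bar> = 1 \<Longrightarrow> \<bar>K \<sigma>\<bar> \<le> 1"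
proof -
  assume \<sigma>: "\<bar>\<sigma>\<bar> = 1"
  have "\<bar>\<sigma> * \<epsilon>\<bar> = \<epsilon>" using \<sigma> eps by (simp add: abs_mult)
  then have "\<bar>\<sigma> * \<epsilon> - d\<bar> \<le> 1" using d_less_eps eps by linarith
  then have "\<bar>\<sigma> * \<epsilon> - d\<bar> * (\<epsilon>\<^sup>2) powr \<alpha> \<le> 1 * 1" using eps_powr by (intro mult_mono) auto
  then show ?thesis by (simp add: K_def abs_mult)
qed

lemma K_min: "0 < K_min" "\<bar>\<sigma>\<bar> = 1 \<Longrightarrow> K_min \<le> \<sigma> * K \<sigma>"
proof -
  show "0 < K_min" using eps eps_powr by (simp add: K_min_def)
  assume \<sigma>: "\<bar>\<sigma>\<bar> = 1"
  have "\<bar>d\<bar> \<le> \<epsilon> / 2" using d_less_mu mu_eps eps by linarith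
  then have "\<epsilon> / 2 \<le> \<sigma> * (\<sigma> * \<epsilon> - d)" using \<sigma> by (auto simp: abs_if split: if_splits)
  then have "\<epsilon> / 2 * (\<epsilon>\<^sup>2) powr \<alpha> \<le> \<sigma> * (\<sigma> * \<epsilon> - d) * (\<epsilon>\<^sup>2) powr \<alpha>"
    using eps_powr by (intro mult_right_mono) auto
  then show "K_min \<le> \<sigma> * K \<sigma>" by (simp add: K_def K_min_def mult.assoc)
qed

lemma F_continuous: "continuous_on A (F \<sigma>)"
  unfolding F_K[abs_def] using alpha by (intro continuous_intros continuous_on_powr') auto

lemma entry_continuous: "\<bar>\<sigma>\<bar> = 1 \<Longrightarrow> continuous_on {-\<mu><..<\<mu>} (entry \<sigma>)"
  unfolding entry_def
proof (rule continuous_on_compose2[of W h'])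
  show "continuous_on W h'" using hom by (simp add: homeomorphism_def)
  show "continuous_on {-\<mu><..<\<mu>} (\<lambda>x. (\<sigma> * \<epsilon>, \<sigma> * \<epsilon> * x))" by (intro continuous_intros)
  show "\<bar>\<sigma>\<bar> = 1 \<Longrightarrow> (\<lambda>x. (\<sigma> * \<epsilon>, \<sigma> * \<epsilon> * x)) ` {-\<mu><..<\<mu>} \<subseteq> W" using entry_coord_W(2) by (auto simp: abs_less_iff)
qed

text \<open>Records an entry of the orbit modulo the group. Thus questions about the orbit become
  questions about the scalar map; the group element is recovered only when the orbit is
  identified.\<close>

definition state_in :: "(real^3) set \<Rightarrow> real \<Rightarrow> real \<Rightarrow> bool" where
  "state_in \<gamma> \<sigma> x \<longleftrightarrow> \<bar>\<sigma>\<bar> = 1 \<and> \<bar>x\<bar> < \<mu> \<and> (\<exists>\<tau> k. \<bar>\<tau>\<bar> = 1 \<and> act \<tau> k (entry \<sigma> x) \<in> \<gamma>)"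

lemma states:
  assumes "periodic_orbit \<phi> \<gamma>" "\<gamma> \<subseteq> saturate U"
  shows "\<exists>\<sigma> x. state_in \<gamma> \<sigma> x" "state_in \<gamma> \<sigma> x \<Longrightarrow> x \<noteq> 0" "state_in \<gamma> \<sigma> x \<Longrightarrow> state_in \<gamma> (\<sigma> * sgn x) (F \<sigma> x)"
proof -
  obtain u T where u: "u \<in> S2" "has_period \<phi> u T" "\<gamma> = orbit \<phi> u"
    using assms(1) unfolding periodic_orbit_def by blast
  note sat = assms(2)[unfolded u(3)]
  show "\<exists>\<sigma> x. state_in \<gamma> \<sigma> x"
    using first_state[OF u(1,2) sat] unfolding state_in_def u(3) by metis
  show "x \<noteq> 0" if "state_in \<gamma> \<sigma> x"
    using that next_state(1)[OF u(1,2) sat] unfolding state_in_def u(3) by blast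
  show "state_in \<gamma> (\<sigma> * sgn x) (F \<sigma> x)" if s: "state_in \<gamma> \<sigma> x"
  proof -
    obtain \<tau> k where t: "\<bar>\<tau>\<bar> = 1" "\<bar>\<sigma>\<bar> = 1" "\<bar>x\<bar> < \<mu>" "act \<tau> k (entry \<sigma> x) \<in> orbit \<phi> u"
      using s unfolding state_in_def u(3) by blast
    note ns = next_state[OF u(1,2) sat t]
    have "\<bar>\<sigma> * sgn x\<bar> = 1" by (rule sgn_abs_1[OF t(2) ns(1)])
    then show ?thesis unfolding state_in_def u(3) using ns t(1) by (metis abs_mult mult_1)
  qed
qed

lemma periodic_orbit_compact: "periodic_orbit \<phi> \<gamma> \<Longrightarrow> compact \<gamma>"
  using orbit_periodic_compact unfolding periodic_orbit_def has_period_def by blast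

text \<open>Modulo the group there are finitely many candidate limit points. If a compact orbit
  missed them all, it would keep a positive distance from them, against continuity of
  \<open>entry\<close>. The limit may depend on \<sigma>, as required when the attractor has period
  2.\<close>

lemma state_in_limit:
  assumes \<gamma>: "compact \<gamma>" and z: "\<And>\<sigma>. \<bar>\<sigma>\<bar> = 1 \<Longrightarrow> \<bar>z \<sigma>\<bar> < \<mu>"
    and lim: "\<And>r. 0 < r \<Longrightarrow> \<exists>\<sigma> x. state_in \<gamma> \<sigma> x \<and> \<bar>x - z \<sigma>\<bar> < r"
  shows "\<exists>\<sigma>. state_in \<gamma> \<sigma> (z \<sigma>)"
proof (rule ccontr)
  assume none: "\<nexists>\<sigma>. state_in \<gamma> \<sigma> (z \<sigma>)"
  define P where "P = (\<lambda>(\<tau>, k, \<sigma>). act \<tau> k (entry \<sigma> (z \<sigma>))) ` ({1, -1} \<times> {..<3} \<times> {1, -1})"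
  have "compact P" unfolding P_def by (intro finite_imp_compact) auto
  moreover have "P \<inter> \<gamma> = {}"
  proof (rule ccontr)
    assume "P \<inter> \<gamma> \<noteq> {}"
    then obtain \<tau> k \<sigma> where "\<tau> \<in> {1, -1}" "\<sigma> \<in> {1, -1}" "act \<tau> k (entry \<sigma> (z \<sigma>)) \<in> \<gamma>" unfolding P_def by auto
    moreover from this have "\<bar>\<tau>\<bar> = 1" "\<bar>\<sigma>\<bar> = 1" by auto
    ultimately have "state_in \<gamma> \<sigma> (z \<sigma>)" unfolding state_in_def using z by blast
    then show False using none by blast
  qed
  ultimately obtain D where D: "0 < D" "\<And>p w. p \<in> P \<Longrightarrow> w \<in> \<gamma> \<Longrightarrow> D \<le> dist p w"
    using separate_compact_closed[of P \<gamma>] compact_imp_closed[OF \<gamma>] by metis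
  have "\<exists>r>0. \<forall>x. \<bar>x\<bar> < \<mu> \<and> \<bar>x - z \<sigma>\<bar> < r \<longrightarrow> dist (entry \<sigma> x) (entry \<sigma> (z \<sigma>)) < D" if \<sigma>: "\<bar>\<sigma>\<bar> = 1" for \<sigma>
  proof -
    have "z \<sigma> \<in> {-\<mu><..<\<mu>}" using z[OF \<sigma>] by (auto simp: abs_less_iff)
    with entry_continuous[OF \<sigma>] D(1) obtain r where "r > 0"
      "\<forall>x\<in>{-\<mu><..<\<mu>}. dist x (z \<sigma>) < r \<longrightarrow> dist (entry \<sigma> x) (entry \<sigma> (z \<sigma>)) < D"
      unfolding continuous_on_iff by blast
    then show ?thesis by (intro exI[of _ r]) (auto simp: dist_real_def abs_less_iff)
  qed
  then obtain r where r: "\<And>\<sigma>. \<bar>\<sigma>\<bar> = 1 \<Longrightarrow> r \<sigma> > 0"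
    "\<And>\<sigma> x. \<bar>\<sigma>\<bar> = 1 \<Longrightarrow> \<bar>x\<bar> < \<mu> \<Longrightarrow> \<bar>x - z \<sigma>\<bar> < r \<sigma> \<Longrightarrow> dist (entry \<sigma> x) (entry \<sigma> (z \<sigma>)) < D"
    by metis
  obtain \<sigma> x where s: "state_in \<gamma> \<sigma> x" "\<bar>x - z \<sigma>\<bar> < min (r 1) (r (-1))"
    using lim[of "min (r 1) (r (-1))"] r(1)[of 1] r(1)[of "-1"] by auto
  then obtain \<tau> k where t: "\<bar>\<sigma>\<bar> = 1" "\<bar>x\<bar> < \<mu>" "\<bar>\<tau>\<bar> = 1" "act \<tau> k (entry \<sigma> x) \<in> \<gamma>"
    unfolding state_in_def by blast
  have pm: "\<sigma> = 1 \<or> \<sigma> = -1" "\<tau> = 1 \<or> \<tau> = -1" using t by linarith+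
  then have "\<bar>x - z \<sigma>\<bar> < r \<sigma>" using s(2) by auto
  then have "dist (entry \<sigma> x) (entry \<sigma> (z \<sigma>)) < D" by (rule r(2)[OF t(1,2)])
  moreover have "act \<tau> (k mod 3) (entry \<sigma> (z \<sigma>)) \<in> P"
    unfolding P_def using pm by (intro image_eqI[of _ _ "(\<tau>, k mod 3, \<sigma>)"]) auto
  then have "D \<le> dist (act \<tau> k (entry \<sigma> (z \<sigma>))) (act \<tau> k (entry \<sigma> x))" using D(2) t(4) act_mod by metis
  ultimately show False unfolding dist_act[OF t(3)] by (simp add: dist_commute)
qed

section \<open>The exit map for \<alpha> > 1\<close>

context
  assumes alpha1: "1 < \<alpha>" and mu1: "\<mu> powr (\<alpha> - 1) \<le> 1 / (4 * \<alpha>)"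
begin

text \<open>The derivative of |x| powr \<alpha> is at most \<alpha> \<mu> powr (\<alpha> - 1) in
  modulus, which the assumption on \<mu> makes at most 1/4, and |K| is at most 1.\<close>

lemma F_contraction:
  assumes \<sigma>: "\<bar>\<sigma>\<bar> = 1" and xy: "\<bar>x\<bar> < \<mu>" "\<bar>y\<bar> < \<mu>"
  shows "\<bar>F \<sigma> x - F \<sigma> y\<bar> \<le> \<bar>x - y\<bar> / 4"
proof -
  have "\<bar>F \<sigma> x - F \<sigma> y\<bar> = \<bar>K \<sigma>\<bar> * \<bar>\<bar>x\<bar> powr \<alpha> - \<bar>y\<bar> powr \<alpha>\<bar>"
    unfolding F_K by (simp add: abs_mult[symmetric] right_diff_distrib)
  also have "\<dots> \<le> 1 * (\<alpha> * \<mu> powr (\<alpha> - 1) * \<bar>\<bar>x\<bar> - \<bar>y\<bar>\<bar>)"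
    using xy by (intro mult_mono K_le_1[OF \<sigma>] powr_contraction[OF alpha1]) auto
  also have "\<dots> \<le> 1 / 4 * \<bar>x - y\<bar>"
  proof -
    have "\<alpha> * \<mu> powr (\<alpha> - 1) \<le> 1 / 4" using mu1 alpha1 by (simp add: field_simps)
    then have "\<alpha> * \<mu> powr (\<alpha> - 1) * \<bar>\<bar>x\<bar> - \<bar>y\<bar>\<bar> \<le> 1 / 4 * \<bar>x - y\<bar>"
      by (intro mult_mono abs_triangle_ineq3) auto
    then show ?thesis by simp
  qed
  finally show ?thesis by simp
qed

lemma F_near_d: "\<bar>\<sigma>\<bar> = 1 \<Longrightarrow> \<bar>x\<bar> < \<mu> \<Longrightarrow> \<bar>F \<sigma> x - d\<bar> \<le> \<bar>x\<bar> / 4"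
  using F_contraction[of \<sigma> x 0] mu by (simp add: F_def)

lemma F_sgn:
  assumes "d \<noteq> 0" "\<bar>\<sigma>\<bar> = 1" "\<bar>x\<bar> < 2 * \<bar>d\<bar>"
  shows "sgn (F \<sigma> x) = sgn d" "\<bar>F \<sigma> x\<bar> < 2 * \<bar>d\<bar>"
proof -
  have "\<bar>F \<sigma> x - d\<bar> < \<bar>d\<bar> / 2" using F_near_d[OF assms(2), of x] assms(3) two_d_less_mu by linarith
  then show "sgn (F \<sigma> x) = sgn d" "\<bar>F \<sigma> x\<bar> < 2 * \<bar>d\<bar>"
    using assms(1) by (auto simp: sgn_if abs_if split: if_splits)
qed

text \<open>For d > 0 each branch keeps its sign, so z \<sigma> is a fixed point of
  \<open>F \<sigma>\<close>. For d < 0 the branches alternate, and a fixed point of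
  \<open>F (-1)\<close> after \<open>F 1\<close> supplies both points of the 2-cycle. Existence is
  by intermediate values on the interval between 0 and 2 d.\<close>

lemma attractor_exists:
  assumes "d \<noteq> 0"
  obtains z where "\<And>\<sigma>. \<bar>\<sigma>\<bar> = 1 \<Longrightarrow> z (\<sigma> * sgn d) = F \<sigma> (z \<sigma>) \<and> sgn (z \<sigma>) = sgn d \<and> \<bar>z \<sigma>\<bar> < 2 * \<bar>d\<bar>"
proof -
  have bound: "\<bar>F \<sigma> y - d\<bar> \<le> \<bar>d\<bar> / 2" if "\<bar>\<sigma>\<bar> = 1" "\<bar>y\<bar> \<le> 2 * \<bar>d\<bar>" for \<sigma> y
    using F_near_d[OF that(1), of y] that(2) two_d_less_mu by linarith
  have pm: "\<sigma> = 1 \<or> \<sigma> = -1" if "\<bar>\<sigma>\<bar> = 1" for \<sigma> :: real using that by linarith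
  show thesis
  proof (cases "d > 0")
    case True
    have "\<exists>y. \<bar>y\<bar> \<le> 2 * \<bar>d\<bar> \<and> F \<sigma> y = y" if "\<bar>\<sigma>\<bar> = 1" for \<sigma>
    proof -
      have "\<exists>y\<ge>0. y \<le> 2 * d \<and> F \<sigma> y - y = 0"
      proof (intro IVT2'[of "\<lambda>y. F \<sigma> y - y"] continuous_intros F_continuous)
        show "F \<sigma> (2 * d) - 2 * d \<le> 0" "0 \<le> F \<sigma> 0 - 0" "0 \<le> 2 * d"
          using bound[OF that, of 0] bound[OF that, of "2 * d"] True by linarith+
      qed
      then show ?thesis using True by (metis abs_of_nonneg abs_of_pos eq_iff_diff_eq_0)
    qed
    then obtain z where z: "\<And>\<sigma>. \<bar>\<sigma>\<bar> = 1 \<Longrightarrow> \<bar>z \<sigma>\<bar> \<le> 2 * \<bar>d\<bar> \<and> F \<sigma> (z \<sigma>) = z \<sigma>" by metis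
    have "sgn (z \<sigma>) = sgn d \<and> \<bar>z \<sigma>\<bar> < 2 * \<bar>d\<bar>" if "\<bar>\<sigma>\<bar> = 1" for \<sigma>
      using bound[OF that, of "z \<sigma>"] z[OF that] True by (auto simp: sgn_if abs_if split: if_splits)
    then show thesis using that[of z] z True by auto
  next
    case False
    then have d: "d < 0" using assms by simp
    have b2: "\<bar>F 1 y - d\<bar> \<le> \<bar>d\<bar> / 2" "\<bar>F (-1) (F 1 y) - d\<bar> \<le> \<bar>d\<bar> / 2" if "\<bar>y\<bar> \<le> 2 * \<bar>d\<bar>" for y
    proof -
      show *: "\<bar>F 1 y - d\<bar> \<le> \<bar>d\<bar> / 2" using bound[of 1 y] that by simp
      then have "\<bar>F 1 y\<bar> \<le> 2 * \<bar>d\<bar>" by linarith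
      then show "\<bar>F (-1) (F 1 y) - d\<bar> \<le> \<bar>d\<bar> / 2" by (intro bound) auto
    qed
    have "\<exists>y\<ge>2 * d. y \<le> 0 \<and> F (-1) (F 1 y) - y = 0"
    proof (intro IVT2'[of "\<lambda>y. F (-1) (F 1 y) - y"] continuous_intros continuous_on_compose2[OF F_continuous[of UNIV] F_continuous])
      show "F (-1) (F 1 0) - 0 \<le> 0" "0 \<le> F (-1) (F 1 (2 * d)) - 2 * d" "2 * d \<le> 0"
        using b2(2)[of 0] b2(2)[of "2 * d"] d by linarith+
    qed auto
    then obtain y where y: "2 * d \<le> y" "y \<le> 0" "F (-1) (F 1 y) = y" by auto
    then have "\<bar>y\<bar> \<le> 2 * \<bar>d\<bar>" by simp
    note b = b2[OF this]
    define z where "z \<sigma> = (if \<sigma> = 1 then y else F 1 y)" for \<sigma> :: real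
    have "z (\<sigma> * sgn d) = F \<sigma> (z \<sigma>) \<and> sgn (z \<sigma>) = sgn d \<and> \<bar>z \<sigma>\<bar> < 2 * \<bar>d\<bar>" if "\<bar>\<sigma>\<bar> = 1" for \<sigma>
      using pm[OF that] y(3) b d by (auto simp: z_def sgn_if abs_if split: if_splits)
    then show thesis using that by blast
  qed
qed

text \<open>Convergence has two phases: the modulus falls below 2 |d|, after which all signs are
  those of d and the distance to z shrinks geometrically. Compactness of the orbit then puts the
  limit itself on it.\<close>

lemma states_converge:
  assumes d: "d \<noteq> 0" and \<gamma>: "periodic_orbit \<phi> \<gamma>" "\<gamma> \<subseteq> saturate U"
    and z: "\<And>\<sigma>. \<bar>\<sigma>\<bar> = 1 \<Longrightarrow> z (\<sigma> * sgn d) = F \<sigma> (z \<sigma>) \<and> sgn (z \<sigma>) = sgn d \<and> \<bar>z \<sigma>\<bar> < 2 * \<bar>d\<bar>"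
  shows "\<exists>\<sigma>. state_in \<gamma> \<sigma> (z \<sigma>)"
proof -
  note st = states[OF \<gamma>]
  \<comment> \<open>The recursion |x'| \<le> |d| + |x| / 4 preserves the form 3/2 |d| + r with r
    divided by 4; any factor from 4/3 up would do, and below 2 it reaches the second phase.\<close>
  have bounded: "\<exists>\<sigma> x. state_in \<gamma> \<sigma> x \<and> \<bar>x\<bar> \<le> 3/2 * \<bar>d\<bar> + \<mu> / 4 ^ n" for n
  proof (induction n)
    case 0
    obtain \<sigma> x where "state_in \<gamma> \<sigma> x" using st(1) by blast
    moreover from this have "\<bar>x\<bar> < \<mu>" by (simp add: state_in_def)
    ultimately show ?case by (intro exI[of _ \<sigma>] exI[of _ x]) auto
  next
    case (Suc n)
    then obtain \<sigma> x where s: "state_in \<gamma> \<sigma> x" "\<bar>x\<bar> \<le> 3/2 * \<bar>d\<bar> + \<mu> / 4 ^ n" by blast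
    then have "\<bar>F \<sigma> x - d\<bar> \<le> \<bar>x\<bar> / 4" by (intro F_near_d) (auto simp: state_in_def)
    moreover define r where "r = \<mu> / 4 ^ n"
    ultimately have "\<bar>F \<sigma> x\<bar> \<le> 3/2 * \<bar>d\<bar> + r / 4" using s(2) by linarith
    moreover have "r / 4 = \<mu> / 4 ^ Suc n" by (simp add: r_def)
    ultimately show ?case using st(3)[OF s(1)] by metis
  qed
  obtain n where n: "\<mu> / (\<bar>d\<bar> / 2) < 4 ^ n" using real_arch_pow[of 4] by auto
  have "\<mu> / 4 ^ n < \<bar>d\<bar> / 2" using n d by (simp add: field_simps)
  moreover obtain \<sigma>0 x0 where s0: "state_in \<gamma> \<sigma>0 x0" "\<bar>x0\<bar> \<le> 3/2 * \<bar>d\<bar> + \<mu> / 4 ^ n" using bounded by blast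
  ultimately have s0: "state_in \<gamma> \<sigma>0 x0" "\<bar>x0\<bar> < 2 * \<bar>d\<bar>" by linarith+
  have s0': "\<bar>\<sigma>0\<bar> = 1" using s0(1) by (simp add: state_in_def)
  \<comment> \<open>The base case uses the image of x0 instead of x0, since only after one
    application of \<open>F\<close> is the sign known to be that of d.\<close>
  have conv: "\<exists>\<sigma> x. state_in \<gamma> \<sigma> x \<and> sgn x = sgn d \<and> \<bar>x\<bar> < 2 * \<bar>d\<bar> \<and> \<bar>x - z \<sigma>\<bar> \<le> 4 * \<bar>d\<bar> / 4 ^ n" for n
  proof (induction n)
    case 0
    have "\<bar>\<sigma>0 * sgn x0\<bar> = 1" using st(3)[OF s0(1)] by (simp add: state_in_def)
    then have "\<bar>z (\<sigma>0 * sgn x0)\<bar> < 2 * \<bar>d\<bar>" using z by blast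
    then have "\<bar>F \<sigma>0 x0 - z (\<sigma>0 * sgn x0)\<bar> \<le> 4 * \<bar>d\<bar>" using F_sgn(2)[OF d s0' s0(2)] by linarith
    then show ?case using st(3)[OF s0(1)] F_sgn[OF d s0' s0(2)] by (intro exI) auto
  next
    case (Suc n)
    then obtain \<sigma> x where s: "state_in \<gamma> \<sigma> x" "sgn x = sgn d" "\<bar>x\<bar> < 2 * \<bar>d\<bar>" "\<bar>x - z \<sigma>\<bar> \<le> 4 * \<bar>d\<bar> / 4 ^ n" by blast
    have \<sigma>: "\<bar>\<sigma>\<bar> = 1" "\<bar>x\<bar> < \<mu>" using s(1) by (auto simp: state_in_def)
    have "\<bar>z \<sigma>\<bar> < \<mu>" using z[OF \<sigma>(1)] two_d_less_mu by linarith
    then have "\<bar>F \<sigma> x - F \<sigma> (z \<sigma>)\<bar> \<le> \<bar>x - z \<sigma>\<bar> / 4" by (rule F_contraction[OF \<sigma>])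
    also have "\<dots> \<le> 4 * \<bar>d\<bar> / 4 ^ n / 4" using s(4) by (rule divide_right_mono) simp
    finally have "\<bar>F \<sigma> x - z (\<sigma> * sgn x)\<bar> \<le> 4 * \<bar>d\<bar> / 4 ^ Suc n" using z[OF \<sigma>(1)] s(2) by (simp add: mult.commute)
    then show ?case using st(3)[OF s(1)] F_sgn[OF d \<sigma>(1) s(3)] by blast
  qed
  show ?thesis
  proof (rule state_in_limit[OF periodic_orbit_compact[OF \<gamma>(1)]])
    show "\<bar>z \<sigma>\<bar> < \<mu>" if "\<bar>\<sigma>\<bar> = 1" for \<sigma> using z[OF that] two_d_less_mu by linarith
    fix r :: real assume r: "0 < r"
    obtain n where "4 * \<bar>d\<bar> / r < 4 ^ n" using real_arch_pow[of 4] by auto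
    then have "4 * \<bar>d\<bar> / 4 ^ n < r" using r by (simp add: field_simps)
    then show "\<exists>\<sigma> x. state_in \<gamma> \<sigma> x \<and> \<bar>x - z \<sigma>\<bar> < r" using conv[of n] by (meson le_less_trans)
  qed
qed

end

section \<open>The exit map for \<alpha> < 1\<close>

context
  assumes alpha_less_1: "\<alpha> < 1" and mu2: "4 / (K_min * \<alpha>) \<le> \<mu> powr (\<alpha> - 1)"
begin

text \<open>The assumption on \<mu> makes the derivative at least 4 in modulus on the positive part
  of the domain. The factor \<sigma> accounts for the direction: \<open>K \<sigma>\<close> has the
  sign of \<sigma>.\<close>

lemma F_expansion:
  assumes \<sigma>: "\<bar>\<sigma>\<bar> = 1" and st: "0 < s" "s \<le> t" "t < \<mu>"
  shows "4 * (t - s) \<le> \<sigma> * (F \<sigma> t - F \<sigma> s)"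
proof -
  have "4 \<le> K_min * (\<alpha> * \<mu> powr (\<alpha> - 1))" using mu2 K_min(1) alpha by (simp add: field_simps)
  then have "4 * (t - s) \<le> K_min * (\<alpha> * \<mu> powr (\<alpha> - 1)) * (t - s)" using st by (intro mult_right_mono) auto
  also have "\<dots> = K_min * (\<alpha> * \<mu> powr (\<alpha> - 1) * (t - s))" by simp
  also have "\<dots> \<le> (\<sigma> * K \<sigma>) * (t powr \<alpha> - s powr \<alpha>)"
    using st alpha by (intro mult_mono K_min(2)[OF \<sigma>] powr_expansion alpha_less_1) (auto intro: powr_mono2 order_trans[OF less_imp_le[OF K_min(1)] K_min(2)[OF \<sigma>]])
  also have "\<dots> = \<sigma> * (F \<sigma> t - F \<sigma> s)" using st by (simp add: F_K algebra_simps)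
  finally show ?thesis .
qed

lemma F_expansion_abs:
  assumes \<sigma>: "\<bar>\<sigma>\<bar> = 1" and st: "0 < s" "s < \<mu>" "0 < t" "t < \<mu>"
  shows "4 * \<bar>t - s\<bar> \<le> \<bar>F \<sigma> t - F \<sigma> s\<bar>"
proof -
  have "\<bar>\<sigma> * (F \<sigma> t - F \<sigma> s)\<bar> = \<bar>F \<sigma> t - F \<sigma> s\<bar>" "\<bar>\<sigma> * (F \<sigma> s - F \<sigma> t)\<bar> = \<bar>F \<sigma> t - F \<sigma> s\<bar>"
    by (simp_all only: abs_mult \<sigma> mult_1 abs_minus_commute[of "F \<sigma> s"])
  then show ?thesis
    using F_expansion[OF \<sigma>, of s t] F_expansion[OF \<sigma>, of t s] st
      abs_ge_self[of "\<sigma> * (F \<sigma> t - F \<sigma> s)"] abs_ge_self[of "\<sigma> * (F \<sigma> s - F \<sigma> t)"]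
    by (cases "s \<le> t") auto
qed

lemma K_powr_ge:
  assumes \<sigma>: "\<bar>\<sigma>\<bar> = 1" and x: "\<bar>x\<bar> < \<mu>"
  shows "4 * \<bar>x\<bar> \<le> \<bar>K \<sigma>\<bar> * \<bar>x\<bar> powr \<alpha>"
proof (cases "x = 0")
  case False
  have "4 \<le> K_min * (\<alpha> * \<mu> powr (\<alpha> - 1))" using mu2 K_min(1) alpha by (simp add: field_simps)
  also have "\<dots> \<le> K_min * (1 * \<bar>x\<bar> powr (\<alpha> - 1))"
    using alpha alpha_less_1 x False K_min(1) by (intro mult_left_mono mult_mono powr_mono2') auto
  finally have "4 * \<bar>x\<bar> \<le> K_min * \<bar>x\<bar> powr (\<alpha> - 1) * \<bar>x\<bar>" by (intro mult_right_mono) auto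
  also have "\<dots> = K_min * \<bar>x\<bar> powr \<alpha>" using False by (simp add: powr_diff)
  also have "\<dots> \<le> \<bar>K \<sigma>\<bar> * \<bar>x\<bar> powr \<alpha>"
  proof -
    have "\<bar>K \<sigma>\<bar> = \<bar>\<sigma> * K \<sigma>\<bar>" using \<sigma> by (simp add: abs_mult)
    then show ?thesis using K_min(2)[OF \<sigma>] by (intro mult_right_mono) auto
  qed
  finally show ?thesis .
qed simp

text \<open>The end points of the interval of radius r/2 about z are sent at least 2 r away from the
  image of z, to opposite sides, so intermediate values cover w. The strict bound on y comes
  afterwards from expansion itself.\<close>

lemma F_covers:
  assumes \<sigma>: "\<bar>\<sigma>\<bar> = 1" and r: "0 < r" "r < 2 * z" "z + r / 2 < \<mu>" and w: "\<bar>w - F \<sigma> z\<bar> < r"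
  shows "\<exists>y. \<bar>y - z\<bar> < r / 2 \<and> F \<sigma> y = w"
proof -
  define u v where "u = z - r / 2" and "v = z + r / 2"
  have uv: "0 < u" "u < z" "z < v" "v < \<mu>" using r by (auto simp: u_def v_def)
  have 1: "2 * r \<le> \<sigma> * (F \<sigma> v - F \<sigma> z)" "2 * r \<le> \<sigma> * (F \<sigma> z - F \<sigma> u)"
    using F_expansion[OF \<sigma>, of z v] F_expansion[OF \<sigma>, of u z] uv by (auto simp: u_def v_def)
  have "\<sigma> = 1 \<or> \<sigma> = -1" using \<sigma> by linarith
  then have "\<exists>y\<ge>u. y \<le> v \<and> F \<sigma> y = w"
  proof
    assume "\<sigma> = 1"
    then show ?thesis using 1 w r(1) uv by (intro IVT' F_continuous) auto
  next
    assume "\<sigma> = -1"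
    then show ?thesis using 1 w r(1) uv by (intro IVT2' F_continuous) auto
  qed
  then obtain y where y: "u \<le> y" "y \<le> v" "F \<sigma> y = w" by blast
  have "4 * \<bar>y - z\<bar> \<le> \<bar>w - F \<sigma> z\<bar>" using F_expansion_abs[OF \<sigma>, of z y] y uv by auto
  then show ?thesis using w y(3) by (intro exI[of _ y]) auto
qed

text \<open>The difference F z - z changes sign between 0, where it equals d, and |d|, where the
  power term has modulus at least 4 |d| and the sign opposite to d.\<close>

lemma repeller_exists:
  assumes "d \<noteq> 0"
  obtains z where "0 < z" "z < \<bar>d\<bar>" "F (- sgn d) z = z"
proof -
  have dm: "\<bar>d\<bar> < \<mu>" by (rule d_less_mu)
  have s: "\<bar>- sgn d\<bar> = 1" using assms by (simp add: sgn_if)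
  have 4: "4 * \<bar>d\<bar> \<le> \<bar>K (- sgn d)\<bar> * \<bar>d\<bar> powr \<alpha>" by (rule K_powr_ge[OF s dm])
  have Ks: "0 < (- sgn d) * K (- sgn d)" using K_min(2)[OF s] K_min(1) by linarith
  have "\<exists>z\<ge>0. z \<le> \<bar>d\<bar> \<and> F (- sgn d) z - z = 0"
  proof (cases "d > 0")
    case True
    then show ?thesis using Ks 4
      by (intro IVT2'[of "\<lambda>z. F (- sgn d) z - z"] continuous_intros F_continuous) (auto simp: F_K)
  next
    case False
    then show ?thesis using Ks 4 assms
      by (intro IVT'[of "\<lambda>z. F (- sgn d) z - z"] continuous_intros F_continuous) (auto simp: F_K)
  qed
  then obtain z where z: "0 \<le> z" "z \<le> \<bar>d\<bar>" "F (- sgn d) z = z" by auto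
  have "z \<noteq> 0" using z(3) assms by (auto simp: F_K)
  moreover have "z \<noteq> \<bar>d\<bar>"
  proof
    assume zd: "z = \<bar>d\<bar>"
    then have "d + K (- sgn d) * \<bar>d\<bar> powr \<alpha> = \<bar>d\<bar>" using z(3) by (simp add: F_K)
    moreover have "\<bar>K (- sgn d)\<bar> * \<bar>d\<bar> powr \<alpha> = \<bar>K (- sgn d) * \<bar>d\<bar> powr \<alpha>\<bar>" by (simp add: abs_mult)
    ultimately have "4 * \<bar>d\<bar> \<le> \<bar>\<bar>d\<bar> - d\<bar>" using 4 by linarith
    then show False using assms by linarith
  qed
  ultimately show thesis using that[of z] z by simp
qed

lemma states_repelled:
  assumes d: "d \<noteq> 0" and \<gamma>: "periodic_orbit \<phi> \<gamma>" "\<gamma> \<subseteq> saturate U"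
    and z: "0 < z" "z < \<bar>d\<bar>" "F (- sgn d) z = z"
  shows "state_in \<gamma> (- sgn d) z"
proof -
  note st = states[OF \<gamma>]
  have small_x: "\<bar>x\<bar> < \<bar>d\<bar>" if s: "state_in \<gamma> \<sigma> x" for \<sigma> x
  proof (rule ccontr)
    assume "\<not> \<bar>x\<bar> < \<bar>d\<bar>"
    have grow: "\<exists>\<sigma> x. state_in \<gamma> \<sigma> x \<and> 3 ^ n * \<bar>d\<bar> \<le> \<bar>x\<bar>" for n
    proof (induction n)
      case 0
      then show ?case using s \<open>\<not> \<bar>x\<bar> < \<bar>d\<bar>\<close> by (intro exI[of _ \<sigma>] exI[of _ x]) auto
    next
      case (Suc n)
      then obtain \<sigma> x where s: "state_in \<gamma> \<sigma> x" "3 ^ n * \<bar>d\<bar> \<le> \<bar>x\<bar>" by blast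
      have "1 * \<bar>d\<bar> \<le> 3 ^ n * \<bar>d\<bar>" by (intro mult_right_mono) auto
      then have "\<bar>d\<bar> \<le> \<bar>x\<bar>" using s(2) by linarith
      moreover have "4 * \<bar>x\<bar> \<le> \<bar>K \<sigma> * \<bar>x\<bar> powr \<alpha>\<bar>"
        using K_powr_ge[of \<sigma> x] s(1) by (simp add: state_in_def abs_mult)
      ultimately have "3 * \<bar>x\<bar> \<le> \<bar>F \<sigma> x\<bar>" unfolding F_K by linarith
      then have "3 ^ Suc n * \<bar>d\<bar> \<le> \<bar>F \<sigma> x\<bar>" using s(2) by simp
      then show ?case using st(3)[OF s(1)] by blast
    qed
    obtain n where "\<mu> / \<bar>d\<bar> < 3 ^ n" using real_arch_pow[of 3] by auto
    then have "\<mu> < 3 ^ n * \<bar>d\<bar>" using d by (simp add: field_simps)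
    then show False using grow[of n] by (auto simp: state_in_def)
  qed
  have sgn_\<sigma>: "\<sigma> = - sgn d" if s: "state_in \<gamma> \<sigma> x" for \<sigma> x
  proof -
    have \<sigma>: "\<bar>\<sigma>\<bar> = 1" using s by (simp add: state_in_def)
    have "\<bar>d + K \<sigma> * \<bar>x\<bar> powr \<alpha>\<bar> < \<bar>d\<bar>" using small_x[OF st(3)[OF s]] by (simp add: F_K)
    then have "0 < d \<and> K \<sigma> * \<bar>x\<bar> powr \<alpha> < 0 \<or> d < 0 \<and> 0 < K \<sigma> * \<bar>x\<bar> powr \<alpha>" using d by linarith
    then have "d * (K \<sigma> * \<bar>x\<bar> powr \<alpha>) < 0" unfolding mult_less_0_iff[of d] .
    moreover have "0 \<le> \<bar>x\<bar> powr \<alpha>" by simp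
    ultimately have "d * K \<sigma> < 0" by (metis mult.assoc mult_nonneg_nonneg not_less)
    moreover have "0 < \<sigma> * K \<sigma>" using K_min(2)[OF \<sigma>] K_min(1) by linarith
    ultimately show ?thesis using \<sigma> by (auto simp: mult_less_0_iff zero_less_mult_iff sgn_if abs_if split: if_splits)
  qed
  have pos: "0 < x" if s: "state_in \<gamma> \<sigma> x" for \<sigma> x
  proof -
    have "\<sigma> * sgn x = \<sigma>" using sgn_\<sigma>[OF s] sgn_\<sigma>[OF st(3)[OF s]] by simp
    then have "sgn x = 1" using s by (auto simp: state_in_def)
    then show ?thesis by (simp add: sgn_1_pos)
  qed
  obtain \<sigma>0 x0 where s0: "state_in \<gamma> \<sigma>0 x0" using st(1) by blast
  \<comment> \<open>A state different from z would have its distance to z multiplied by at least 4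
    at every passage while staying within \<mu> of 0. No limit argument is needed here.\<close>
  have "x0 = z"
  proof (rule ccontr)
    assume ne: "x0 \<noteq> z"
    have grow: "\<exists>\<sigma> x. state_in \<gamma> \<sigma> x \<and> 4 ^ n * \<bar>x0 - z\<bar> \<le> \<bar>x - z\<bar>" for n
    proof (induction n)
      case 0
      then show ?case using s0 by (intro exI[of _ \<sigma>0] exI[of _ x0]) auto
    next
      case (Suc n)
      then obtain \<sigma> x where s: "state_in \<gamma> \<sigma> x" "4 ^ n * \<bar>x0 - z\<bar> \<le> \<bar>x - z\<bar>" by blast
      have \<sigma>: "\<bar>\<sigma>\<bar> = 1" "x < \<mu>" using s(1) by (auto simp: state_in_def)
      have "4 * \<bar>x - z\<bar> \<le> \<bar>F \<sigma> x - F \<sigma> z\<bar>"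
        using z d_less_mu pos[OF s(1)] \<sigma>(2) by (intro F_expansion_abs[OF \<sigma>(1)]) auto
      also have "F \<sigma> z = z" using z(3) sgn_\<sigma>[OF s(1)] by simp
      finally have "4 ^ Suc n * \<bar>x0 - z\<bar> \<le> \<bar>F \<sigma> x - z\<bar>" using s(2) by simp
      then show ?case using st(3)[OF s(1)] by blast
    qed
    obtain n where "2 * \<mu> / \<bar>x0 - z\<bar> < 4 ^ n" using real_arch_pow[of 4] by auto
    then have "2 * \<mu> < 4 ^ n * \<bar>x0 - z\<bar>" using ne by (simp add: field_simps)
    moreover obtain \<sigma> x where s: "state_in \<gamma> \<sigma> x" "4 ^ n * \<bar>x0 - z\<bar> \<le> \<bar>x - z\<bar>" using grow by blast
    moreover have "\<bar>x\<bar> < \<mu>" using s(1) by (simp add: state_in_def)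
    ultimately show False using z d_less_mu by linarith
  qed
  then show ?thesis using s0 sgn_\<sigma>[OF s0] by simp
qed

end
end

section \<open>Distinguishing periodic orbits by the poles they visit\<close>

context PN_flow
begin

lemma passes_nearby_hits:
  assumes "passes_nearby \<phi> \<eta> ps \<gamma>" "p \<in> set ps"
  shows "\<exists>w\<in>\<gamma>. dist w p < \<eta>"
proof -
  obtain u ts where "\<gamma> = orbit \<phi> u" "\<forall>i<length ps. dist (\<phi> (ts i) u) (ps ! i) < \<eta>"
    using assms(1) unfolding passes_nearby_def by blast
  then show ?thesis using assms(2) unfolding orbit_def in_set_conv_nth by blast
qed

text \<open>The listed intervals cover one full period, and on each of them every pole other than
  its two end entries is kept at distance \<eta>.\<close>

lemma passes_nearby_avoids:
  assumes "passes_nearby \<phi> \<eta> ps \<gamma>" "p \<in> poles" "p \<notin> set ps" "w \<in> \<gamma>"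
  shows "\<eta> \<le> dist w p"
proof -
  obtain u T ts where u: "u \<in> S2" "has_period \<phi> u T" "\<gamma> = orbit \<phi> u" "ts 0 = 0" "ts (length ps - 1) = T"
    "\<forall>i. Suc i < length ps \<longrightarrow> ts i < ts (Suc i) \<and>
       (\<forall>t\<in>{ts i..ts (Suc i)}. \<forall>p\<in>poles - {ps ! i, ps ! Suc i}. \<eta> \<le> dist (\<phi> t u) p)"
    using assms(1) unfolding passes_nearby_def by blast
  have T: "0 < T" "\<phi> T u = u" using u(2) by (auto simp: has_period_def)
  obtain t where t: "0 \<le> t" "t < T" "w = \<phi> t u"
    using assms(4) unfolding u(3) orbit_periodic[OF u(1) T] by auto
  have "\<exists>i<n. ts i \<le> t \<and> t \<le> ts (Suc i)" if "t < ts n" for n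
    using that
  proof (induction n)
    case (Suc n)
    then show ?case by (cases "t < ts n") (auto intro: less_SucI)
  qed (use t(1) u(4) in simp)
  from this[of "length ps - 1"] obtain i where i: "i < length ps - 1" "t \<in> {ts i..ts (Suc i)}"
    using t(2) u(5) by auto
  then have "p \<noteq> ps ! i" "p \<noteq> ps ! Suc i" using assms(3) nth_mem[of i ps] nth_mem[of "Suc i" ps] by force+
  then have "p \<in> poles - {ps ! i, ps ! Suc i}" using assms(2) by blast
  moreover have "Suc i < length ps" using i(1) by linarith
  ultimately show ?thesis using u(6) i(2) t(3) by blast
qed

lemma passes_nearby_distinct:
  assumes "passes_nearby \<phi> \<eta> ps \<gamma>" "passes_nearby \<phi> \<eta> ps' \<gamma>'" "p \<in> set ps" "p \<notin> set ps'" "p \<in> poles"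
  shows "\<gamma> \<noteq> \<gamma>'"
  using passes_nearby_hits[OF assms(1,3)] passes_nearby_avoids[OF assms(2,5,4)] by force

end

lemma pole_eq_iff [simp]: "e i = e j \<longleftrightarrow> i = j" "- e i \<noteq> e j" "e i \<noteq> - e j"
proof -
  show "e i = e j \<longleftrightarrow> i = j" by (simp add: e_def axis_eq_axis)
  show "- e i \<noteq> e j" for i j
  proof
    assume "- e i = e j"
    then have "(- e i) $ j = e j $ j" by simp
    then show False by (simp add: e_def axis_def split: if_splits)
  qed
  then show "e i \<noteq> - e j" by metis
qed

lemma pole_mem [simp]: "e i \<in> poles" "- e i \<in> poles"
  by (auto simp: poles_def)

lemma act_pole: "act \<tau> k (e 1) = \<tau> *\<^sub>R e (if k mod 3 = 0 then 1 else if k mod 3 = 1 then 3 else 2)"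
proof -
  have "Z (e 1) = e 3" "Z (e 3) = e 2" by (simp_all add: vec_eq_iff forall_3 e_def axis_def)
  moreover have "k mod 3 = 0 \<or> k mod 3 = 1 \<or> k mod 3 = 2" by linarith
  ultimately show ?thesis by (subst act_mod) (auto simp: act_def numeral_2_eq_2)
qed

text \<open>Defined outside the locale of cycles so that several cycles can be named and compared at
  once.\<close>

definition (in linearised) cycle_orbit :: "(nat \<Rightarrow> real) \<Rightarrow> (nat \<Rightarrow> real) \<Rightarrow> (nat \<Rightarrow> real) \<Rightarrow> (real^3) set" where
  "cycle_orbit \<tau> \<sigma> x = orbit \<phi> (act (\<tau> 0) 0 (entry (\<sigma> 0) (x 0)))"

context cycle
begin

lemma cycle_orbit_pt: "orbit \<phi> (pt 0) = cycle_orbit \<tau> \<sigma> x"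
  by (simp add: cycle_orbit_def pt_def)

lemma same_sign_radius: "\<exists>\<rho>>0. \<forall>n y. \<bar>y - x n\<bar> < \<rho> \<longrightarrow> sgn y = sgn (x n) \<and> \<bar>y\<bar> < 2 * \<bar>d\<bar>"
proof -
  define f where "f n = min \<bar>x n\<bar> (2 * \<bar>d\<bar> - \<bar>x n\<bar>)" for n
  define \<rho> where "\<rho> = Min (f ` {..<m})"
  have "0 < f n" for n using x[of n] by (simp add: f_def)
  then have "0 < \<rho>" unfolding \<rho>_def using m(1) by (subst Min_gr_iff) auto
  moreover have "sgn y = sgn (x n) \<and> \<bar>y\<bar> < 2 * \<bar>d\<bar>" if "\<bar>y - x n\<bar> < \<rho>" for n y
  proof -
    have "\<rho> \<le> f (n mod m)" unfolding \<rho>_def using m(1) by (intro Min_le) auto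
    then have "\<bar>y - x n\<bar> < \<bar>x n\<bar>" "\<bar>y - x n\<bar> < 2 * \<bar>d\<bar> - \<bar>x n\<bar>" using that by (auto simp: f_def periodic_mod)
    then show ?thesis by (auto simp: sgn_if abs_if split: if_splits)
  qed
  ultimately show ?thesis by blast
qed

lemma attracting_orbit:
  assumes "1 < \<alpha>" "\<mu> powr (\<alpha> - 1) \<le> 1 / (4 * \<alpha>)"
  shows "attracting \<phi> (cycle_orbit \<tau> \<sigma> x)"
proof -
  obtain \<rho> where \<rho>: "\<rho> > 0" "\<And>n y. \<bar>y - x n\<bar> < \<rho> \<Longrightarrow> sgn y = sgn (x n) \<and> \<bar>y\<bar> < 2 * \<bar>d\<bar>"
    using same_sign_radius by blast
  show ?thesis
    unfolding cycle_orbit_pt[symmetric]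
  proof (rule attracting_cycle[OF \<rho>])
    fix n y assume "\<bar>y - x n\<bar> < \<rho>"
    then have "\<bar>y\<bar> < \<mu>" using \<rho>(2) two_d_less_mu by fastforce
    then have "\<bar>F (\<sigma> n) y - F (\<sigma> n) (x n)\<bar> \<le> \<bar>y - x n\<bar> / 4"
      by (rule F_contraction[OF assms unit(2) _ x_mu])
    then show "\<bar>F (\<sigma> n) y - x (Suc n)\<bar> \<le> \<bar>y - x n\<bar> / 2" unfolding step(3) by linarith
  qed auto
qed

lemma repelling_orbit:
  assumes "\<alpha> < 1" "4 / (K_min * \<alpha>) \<le> \<mu> powr (\<alpha> - 1)" and pos: "\<And>n. 0 < x n"
  shows "repelling \<phi> (cycle_orbit \<tau> \<sigma> x)"
proof -
  obtain \<rho> where \<rho>: "\<rho> > 0" "\<And>n y. \<bar>y - x n\<bar> < \<rho> \<Longrightarrow> sgn y = sgn (x n) \<and> \<bar>y\<bar> < 2 * \<bar>d\<bar>"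
    using same_sign_radius by blast
  show ?thesis
    unfolding cycle_orbit_pt[symmetric]
  proof (rule repelling_cycle[OF \<rho>])
    fix n and w r :: real assume r: "0 < r" "r \<le> \<rho>" "\<bar>w - x (Suc n)\<bar> < r"
    \<comment> \<open>Within radius \<rho> the sign is constant, so 0 is excluded and the covering
      interval stays in the positive part.\<close>
    have "\<not> x n < \<rho>" using \<rho>(2)[of 0 n] pos[of n] by auto
    then have "r < 2 * x n" using r pos[of n] by linarith
    moreover have "\<bar>x n + r / 2\<bar> < 2 * \<bar>d\<bar>" using \<rho>(2)[of "x n + r / 2" n] r by auto
    then have "x n + r / 2 < \<mu>" using two_d_less_mu by linarith
    ultimately show "\<exists>y. \<bar>y - x n\<bar> < r / 2 \<and> F (\<sigma> n) y = w"
      using r by (intro F_covers[OF assms(1,2) unit(2)]) (simp_all add: step(3))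
  qed auto
qed

text \<open>Two orbits with a common point coincide, and the exponent of a group element matters
  only modulo 3.\<close>

lemma cycle_orbit_unique:
  assumes "periodic_orbit \<phi> \<gamma>" "act (\<tau> n) k (entry (\<sigma> n) (x n)) \<in> \<gamma>" "k mod 3 = n mod 3"
  shows "\<gamma> = cycle_orbit \<tau> \<sigma> x"
proof -
  obtain u where u: "u \<in> S2" "\<gamma> = orbit \<phi> u" using assms(1) unfolding periodic_orbit_def by blast
  have "act (\<tau> n) k = act (\<tau> n) n" using act_mod assms(3) by metis
  then have "pt n \<in> \<gamma>" using assms(2) by (simp add: pt_def)
  then have "orbit \<phi> (pt n) = \<gamma>" using u orbit_eq by blast
  moreover have "pt n \<in> orbit \<phi> (pt 0)" using flow_time[of n] unfolding orbit_def by (metis rangeI)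
  then have "orbit \<phi> (pt n) = orbit \<phi> (pt 0)" by (rule orbit_eq[OF pt_S2])
  ultimately show ?thesis by (simp only: cycle_orbit_pt)
qed

lemmas cycle_orbit_facts = periodic_orbit_pt[unfolded cycle_orbit_pt] orbit_saturate[unfolded cycle_orbit_pt]
lemma cycle_orbit_passes:
  assumes "2 * \<epsilon> < \<eta>" "\<eta> \<le> 1/2"
  shows "passes_nearby \<phi> \<eta> (map (\<lambda>n. act (\<tau> n) n (e 1)) [0..<Suc m]) (cycle_orbit \<tau> \<sigma> x)"
  unfolding cycle_orbit_pt[symmetric] by (rule passes[OF assms]) (simp_all add: nth_append del: upt_Suc)

end

section \<open>The explicit cycles and the four cases\<close>

context turning
begin

text \<open>With \<sigma> = 1 throughout, the accumulated sign never changes, so each initial sign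
  \<tau>0 gives its own lift, of length 3.\<close>

lemma cycle_plus:
  assumes "\<bar>\<tau>0\<bar> = 1" "F 1 z = z" "0 < z" "z < 2 * \<bar>d\<bar>"
  shows "cycle b c d \<phi> \<alpha> \<epsilon> \<mu> \<nu> U h h' 3 (\<lambda>_. \<tau>0) (\<lambda>_. 1) (\<lambda>_. z)"
  using assms by unfold_locales (auto dest: dvd_imp_le)

text \<open>With \<sigma> = -1 throughout, three transitions reverse the accumulated sign, so the
  two possible lifts join into a single orbit of length 6.\<close>

lemma cycle_minus:
  assumes "F (-1) z = z" "0 < z" "z < 2 * \<bar>d\<bar>"
  shows "cycle b c d \<phi> \<alpha> \<epsilon> \<mu> \<nu> U h h' 6 (\<lambda>n. (-1) ^ n) (\<lambda>_. -1) (\<lambda>_. z)"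
proof unfold_locales
  fix k :: nat assume k: "0 < k" "k < 6" "3 dvd k" "(-1 :: real) ^ k = (-1) ^ 0"
  then have "k = 3" by presburger
  then show False using k(4) by simp
qed (use assms in auto)

text \<open>The product of (-1)^i for i from 1 to n, that is the accumulated sign when \<sigma>
  alternates. It has period 4, whence length 12 together with the order 3 of
  \<open>Z\<close>.\<close>

definition alternating_sign :: "nat \<Rightarrow> real" where
  "alternating_sign n = (if n mod 4 = 0 \<or> n mod 4 = 3 then 1 else -1)"

lemma alternating_sign_Suc: "alternating_sign (Suc n) = alternating_sign n * (-1) ^ Suc n"
proof -
  have "even n \<longleftrightarrow> n mod 4 = 0 \<or> n mod 4 = 2" by presburger
  moreover have "n mod 4 = 0 \<or> n mod 4 = 1 \<or> n mod 4 = 2 \<or> n mod 4 = 3" by linarith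
  ultimately show ?thesis by (auto simp: alternating_sign_def mod_Suc minus_one_power_iff)
qed

lemma cycle_alternating:
  assumes "\<And>\<sigma>. \<bar>\<sigma>\<bar> = 1 \<Longrightarrow> z (- \<sigma>) = F \<sigma> (z \<sigma>) \<and> z \<sigma> < 0 \<and> \<bar>z \<sigma>\<bar> < 2 * \<bar>d\<bar>"
  shows "cycle b c d \<phi> \<alpha> \<epsilon> \<mu> \<nu> U h h' 12 alternating_sign (\<lambda>n. (-1) ^ n) (\<lambda>n. z ((-1) ^ n))"
proof -
  have z: "z (- ((-1) ^ n)) = F ((-1) ^ n) (z ((-1) ^ n))" "z ((-1) ^ n) < 0" "\<bar>z ((-1) ^ n)\<bar> < 2 * \<bar>d\<bar>" for n :: nat
    using assms[of "(-1) ^ n"] by (auto simp: power_abs)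
  show ?thesis
  proof unfold_locales
    fix k :: nat assume k: "0 < k" "k < 12" "3 dvd k" "alternating_sign k = alternating_sign 0" "(-1 :: real) ^ k = (-1) ^ 0"
    then have "even k" by (cases "even k") auto
    then have "k = 6" using k(1-3) by presburger
    then show False using k(4) by (simp add: alternating_sign_def)
  next
    fix n :: nat
    show "z ((-1) ^ n) \<noteq> 0" using z(2)[of n] by simp
    show "\<bar>z ((-1) ^ n)\<bar> < 2 * \<bar>d\<bar>" by (rule z(3))
    show "(-1) ^ Suc n = (-1) ^ n * sgn (z ((-1) ^ n))" using z(2)[of n] by simp
    show "alternating_sign (Suc n) = alternating_sign n * (-1) ^ Suc n" by (rule alternating_sign_Suc)
    show "z ((-1) ^ Suc n) = F ((-1) ^ n) (z ((-1) ^ n))" using z(1)[of n] by simp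
    show "\<bar>alternating_sign n\<bar> = 1" by (simp add: alternating_sign_def)
    show "\<bar>(-1 :: real) ^ n\<bar> = 1" by (simp add: power_abs)
  qed (simp_all add: alternating_sign_def)
qed

lemma sign_cases: "\<bar>\<sigma>\<bar> = 1 \<Longrightarrow> \<sigma> = 1 \<or> \<sigma> = -1" for \<sigma> :: real
  by linarith

text \<open>Parity and residue modulo 3 can be prescribed independently: adding 3 changes only the
  parity.\<close>

lemma minus_one_power_mod_3:
  assumes "\<bar>\<tau>\<bar> = 1"
  shows "\<exists>n. n mod 3 = k mod 3 \<and> (-1) ^ n = (\<tau> :: real)"
proof (cases "(-1) ^ k = \<tau>")
  case False
  have "(-1) ^ (k + 3) = - ((-1 :: real) ^ k)" by (simp add: power_add)
  also have "\<dots> = \<tau>" using False sign_cases[OF assms] by (cases "even k") auto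
  finally show ?thesis by (intro exI[of _ "k + 3"]) simp
qed auto

context
  fixes \<eta> :: real
  assumes eta: "2 * \<epsilon> < \<eta>" "\<eta> \<le> 1/2"
begin

text \<open>A state on a periodic orbit comes with \<sigma> and one of six group elements. For
  \<sigma> = 1 these fall into two cycles of length 3, according to \<tau>; for \<sigma> = -1 all
  six lie on one cycle. The itineraries show that the three orbits differ.\<close>

lemma orbits_attracting_pos:
  assumes a: "1 < \<alpha>" "\<mu> powr (\<alpha> - 1) \<le> 1 / (4 * \<alpha>)" and d: "0 < d"
  shows "periodic_orbits_are \<phi> (saturate U) \<eta> attracting
    [[e 1, e 3, e 2, e 1], [- e 1, - e 3, - e 2, - e 1], [e 1, - e 3, e 2, - e 1, e 3, - e 2, e 1]]"
proof -
  have d0: "d \<noteq> 0" using d by simp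
  obtain z where z: "\<And>\<sigma>. \<bar>\<sigma>\<bar> = 1 \<Longrightarrow> z (\<sigma> * sgn d) = F \<sigma> (z \<sigma>) \<and> sgn (z \<sigma>) = sgn d \<and> \<bar>z \<sigma>\<bar> < 2 * \<bar>d\<bar>"
    using attractor_exists[OF a d0] by blast
  have z': "F \<sigma> (z \<sigma>) = z \<sigma>" "0 < z \<sigma>" "z \<sigma> < 2 * \<bar>d\<bar>" if "\<bar>\<sigma>\<bar> = 1" for \<sigma>
    using z[OF that] d by (auto simp: sgn_1_pos)
  have A: "cycle b c d \<phi> \<alpha> \<epsilon> \<mu> \<nu> U h h' 3 (\<lambda>_. 1) (\<lambda>_. 1) (\<lambda>_. z 1)"
    by (rule cycle_plus[of 1 "z 1"]) (use z'[of 1] in simp_all)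
  have B: "cycle b c d \<phi> \<alpha> \<epsilon> \<mu> \<nu> U h h' 3 (\<lambda>_. -1) (\<lambda>_. 1) (\<lambda>_. z 1)"
    using z'[of 1] by (intro cycle_plus) simp_all
  have D: "cycle b c d \<phi> \<alpha> \<epsilon> \<mu> \<nu> U h h' 6 (\<lambda>n. (-1) ^ n) (\<lambda>_. -1) (\<lambda>_. z (-1))"
    using z'[of "-1"] by (intro cycle_minus) simp_all
  let ?A = "cycle_orbit (\<lambda>_. 1) (\<lambda>_. 1) (\<lambda>_. z 1)" and ?B = "cycle_orbit (\<lambda>_. -1) (\<lambda>_. 1) (\<lambda>_. z 1)" and ?D = "cycle_orbit (\<lambda>n. (-1) ^ n) (\<lambda>_. -1) (\<lambda>_. z (-1))"
  have pA: "passes_nearby \<phi> \<eta> [e 1, e 3, e 2, e 1] ?A"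
    using cycle.cycle_orbit_passes[OF A eta] by (simp add: act_pole upt_rec)
  have pB: "passes_nearby \<phi> \<eta> [- e 1, - e 3, - e 2, - e 1] ?B"
    using cycle.cycle_orbit_passes[OF B eta] by (simp add: act_pole upt_rec)
  have pD: "passes_nearby \<phi> \<eta> [e 1, - e 3, e 2, - e 1, e 3, - e 2, e 1] ?D"
    using cycle.cycle_orbit_passes[OF D eta] by (simp add: act_pole upt_rec)
  have "?A \<noteq> ?B" by (rule passes_nearby_distinct[OF pA pB, of "e 1"]) auto
  moreover have "?D \<noteq> ?A" by (rule passes_nearby_distinct[OF pD pA, of "- e 1"]) auto
  moreover have "?D \<noteq> ?B" by (rule passes_nearby_distinct[OF pD pB, of "e 1"]) auto
  ultimately have "distinct [?A, ?B, ?D]" by auto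
  moreover have "set [?A, ?B, ?D] = {\<gamma>. periodic_orbit \<phi> \<gamma> \<and> \<gamma> \<subseteq> saturate U \<and> attracting \<phi> \<gamma>}"
  proof (intro equalityI subsetI)
    fix \<gamma> assume "\<gamma> \<in> set [?A, ?B, ?D]"
    then show "\<gamma> \<in> {\<gamma>. periodic_orbit \<phi> \<gamma> \<and> \<gamma> \<subseteq> saturate U \<and> attracting \<phi> \<gamma>}"
      using cycle.cycle_orbit_facts[OF A] cycle.attracting_orbit[OF A a]
        cycle.cycle_orbit_facts[OF B] cycle.attracting_orbit[OF B a]
        cycle.cycle_orbit_facts[OF D] cycle.attracting_orbit[OF D a] by auto
  next
    fix \<gamma> assume "\<gamma> \<in> {\<gamma>. periodic_orbit \<phi> \<gamma> \<and> \<gamma> \<subseteq> saturate U \<and> attracting \<phi> \<gamma>}"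
    then have \<gamma>: "periodic_orbit \<phi> \<gamma>" "\<gamma> \<subseteq> saturate U" by auto
    obtain \<sigma> \<tau> k where s: "\<bar>\<sigma>\<bar> = 1" "\<bar>\<tau>\<bar> = 1" "act \<tau> k (entry \<sigma> (z \<sigma>)) \<in> \<gamma>"
      using states_converge[OF a d0 \<gamma> z] unfolding state_in_def by blast
    show "\<gamma> \<in> set [?A, ?B, ?D]"
      using sign_cases[OF s(1)]
    proof
      assume "\<sigma> = 1"
      then show ?thesis using sign_cases[OF s(2)] cycle.cycle_orbit_unique[OF A \<gamma>(1), of k k] cycle.cycle_orbit_unique[OF B \<gamma>(1), of k k] s(3) by auto
    next
      assume \<sigma>: "\<sigma> = -1"
      obtain n where "n mod 3 = k mod 3" "(-1) ^ n = \<tau>" using minus_one_power_mod_3[OF s(2)] by blast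
      then show ?thesis using cycle.cycle_orbit_unique[OF D \<gamma>(1), of n k] s(3) \<sigma> by auto
    qed
  qed
  ultimately show ?thesis
    unfolding periodic_orbits_are_def using pA pB pD by (intro exI[of _ "[?A, ?B, ?D]"]) auto
qed

lemma orbits_attracting_neg:
  assumes a: "1 < \<alpha>" "\<mu> powr (\<alpha> - 1) \<le> 1 / (4 * \<alpha>)" and d: "d < 0"
  shows "periodic_orbits_are \<phi> (saturate U) \<eta> attracting
    [[e 1, - e 3, - e 2, e 1, e 3, - e 2, - e 1, e 3, e 2, - e 1, - e 3, e 2, e 1]]"
proof -
  have d0: "d \<noteq> 0" using d by simp
  obtain z where z: "\<And>\<sigma>. \<bar>\<sigma>\<bar> = 1 \<Longrightarrow> z (\<sigma> * sgn d) = F \<sigma> (z \<sigma>) \<and> sgn (z \<sigma>) = sgn d \<and> \<bar>z \<sigma>\<bar> < 2 * \<bar>d\<bar>"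
    using attractor_exists[OF a d0] by blast
  have A: "cycle b c d \<phi> \<alpha> \<epsilon> \<mu> \<nu> U h h' 12 alternating_sign (\<lambda>n. (-1) ^ n) (\<lambda>n. z ((-1) ^ n))"
    using z d by (intro cycle_alternating) (auto simp: sgn_1_neg)
  let ?A = "cycle_orbit alternating_sign (\<lambda>n. (-1) ^ n) (\<lambda>n. z ((-1) ^ n))"
  have pA: "passes_nearby \<phi> \<eta> [e 1, - e 3, - e 2, e 1, e 3, - e 2, - e 1, e 3, e 2, - e 1, - e 3, e 2, e 1] ?A"
    using cycle.cycle_orbit_passes[OF A eta] by (simp add: act_pole alternating_sign_def upt_rec)
  have "{?A} = {\<gamma>. periodic_orbit \<phi> \<gamma> \<and> \<gamma> \<subseteq> saturate U \<and> attracting \<phi> \<gamma>}"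
  proof (intro equalityI subsetI)
    fix \<gamma> assume "\<gamma> \<in> {?A}"
    then show "\<gamma> \<in> {\<gamma>. periodic_orbit \<phi> \<gamma> \<and> \<gamma> \<subseteq> saturate U \<and> attracting \<phi> \<gamma>}"
      using cycle.cycle_orbit_facts[OF A] cycle.attracting_orbit[OF A a] by auto
  next
    fix \<gamma> assume "\<gamma> \<in> {\<gamma>. periodic_orbit \<phi> \<gamma> \<and> \<gamma> \<subseteq> saturate U \<and> attracting \<phi> \<gamma>}"
    then have \<gamma>: "periodic_orbit \<phi> \<gamma>" "\<gamma> \<subseteq> saturate U" by auto
    obtain \<sigma> \<tau> k where s: "\<bar>\<sigma>\<bar> = 1" "\<bar>\<tau>\<bar> = 1" "act \<tau> k (entry \<sigma> (z \<sigma>)) \<in> \<gamma>"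
      using states_converge[OF a d0 \<gamma> z] unfolding state_in_def by blast
    \<comment> \<open>The four residues modulo 4 realise all pairs of signs, so a single cycle
      accounts for every state.\<close>
    have "\<exists>r<4. alternating_sign r = \<tau> \<and> (-1) ^ r = \<sigma>"
    proof -
      have "alternating_sign 0 = 1 \<and> (-1 :: real) ^ 0 = 1" "alternating_sign 1 = -1 \<and> (-1 :: real) ^ 1 = -1"
        "alternating_sign 2 = -1 \<and> (-1 :: real) ^ 2 = 1" "alternating_sign 3 = 1 \<and> (-1 :: real) ^ 3 = -1"
        by (simp_all add: alternating_sign_def)
      moreover have "(0::nat) < 4" "(1::nat) < 4" "(2::nat) < 4" "(3::nat) < 4" by simp_all
      ultimately show ?thesis using sign_cases[OF s(1)] sign_cases[OF s(2)] by metis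
    qed
    then obtain r where r: "r < 4" "alternating_sign r = \<tau>" "(-1) ^ r = \<sigma>" by blast
    \<comment> \<open>Chinese remainders: n is r modulo 4 and k modulo 3.\<close>
    define n where "n = 4 * k + 9 * r"
    have "n = r + 4 * (k + 2 * r)" "n = k + 3 * (k + 3 * r)" by (simp_all add: n_def)
    then have "n mod 4 = r" "k mod 3 = n mod 3" using r(1) by (metis mod_mult_self2 mod_less)+
    moreover have "even n \<longleftrightarrow> even r" by (simp add: n_def)
    ultimately have "alternating_sign n = \<tau>" "(-1) ^ n = \<sigma>" "k mod 3 = n mod 3"
      using r by (auto simp: alternating_sign_def minus_one_power_iff)
    then show "\<gamma> \<in> {?A}" using cycle.cycle_orbit_unique[OF A \<gamma>(1), of n k] s(3) by auto
  qed
  then show ?thesis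
    unfolding periodic_orbits_are_def using pA by (intro exI[of _ "[?A]"]) auto
qed

lemma orbits_repelling_pos:
  assumes a: "\<alpha> < 1" "4 / (K_min * \<alpha>) \<le> \<mu> powr (\<alpha> - 1)" and d: "0 < d"
  shows "periodic_orbits_are \<phi> (saturate U) \<eta> repelling [[e 1, - e 3, e 2, - e 1, e 3, - e 2, e 1]]"
proof -
  have d0: "d \<noteq> 0" using d by simp
  obtain z where z: "0 < z" "z < \<bar>d\<bar>" "F (- sgn d) z = z" using repeller_exists[OF a d0] by blast
  have D: "cycle b c d \<phi> \<alpha> \<epsilon> \<mu> \<nu> U h h' 6 (\<lambda>n. (-1) ^ n) (\<lambda>_. -1) (\<lambda>_. z)"
    using z d by (intro cycle_minus) auto
  let ?D = "cycle_orbit (\<lambda>n. (-1) ^ n) (\<lambda>_. -1) (\<lambda>_. z)"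
  have pD: "passes_nearby \<phi> \<eta> [e 1, - e 3, e 2, - e 1, e 3, - e 2, e 1] ?D"
    using cycle.cycle_orbit_passes[OF D eta] by (simp add: act_pole upt_rec)
  have "{?D} = {\<gamma>. periodic_orbit \<phi> \<gamma> \<and> \<gamma> \<subseteq> saturate U \<and> repelling \<phi> \<gamma>}"
  proof (intro equalityI subsetI)
    fix \<gamma> assume "\<gamma> \<in> {?D}"
    then show "\<gamma> \<in> {\<gamma>. periodic_orbit \<phi> \<gamma> \<and> \<gamma> \<subseteq> saturate U \<and> repelling \<phi> \<gamma>}"
      using cycle.cycle_orbit_facts[OF D] cycle.repelling_orbit[OF D a z(1)] by auto
  next
    fix \<gamma> assume "\<gamma> \<in> {\<gamma>. periodic_orbit \<phi> \<gamma> \<and> \<gamma> \<subseteq> saturate U \<and> repelling \<phi> \<gamma>}"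
    then have \<gamma>: "periodic_orbit \<phi> \<gamma>" "\<gamma> \<subseteq> saturate U" by auto
    obtain \<tau> k where s: "\<bar>\<tau>\<bar> = 1" "act \<tau> k (entry (- 1) z) \<in> \<gamma>"
      using states_repelled[OF a d0 \<gamma> z] d unfolding state_in_def by auto
    obtain n where "n mod 3 = k mod 3" "(-1) ^ n = \<tau>" using minus_one_power_mod_3[OF s(1)] by blast
    then show "\<gamma> \<in> {?D}" using cycle.cycle_orbit_unique[OF D \<gamma>(1), of n k] s(2) by auto
  qed
  then show ?thesis
    unfolding periodic_orbits_are_def using pD by (intro exI[of _ "[?D]"]) auto
qed

lemma orbits_repelling_neg:
  assumes a: "\<alpha> < 1" "4 / (K_min * \<alpha>) \<le> \<mu> powr (\<alpha> - 1)" and d: "d < 0"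
  shows "periodic_orbits_are \<phi> (saturate U) \<eta> repelling
    [[e 1, e 3, e 2, e 1], [- e 1, - e 3, - e 2, - e 1]]"
proof -
  have d0: "d \<noteq> 0" using d by simp
  obtain z where z: "0 < z" "z < \<bar>d\<bar>" "F (- sgn d) z = z" using repeller_exists[OF a d0] by blast
  have A: "cycle b c d \<phi> \<alpha> \<epsilon> \<mu> \<nu> U h h' 3 (\<lambda>_. 1) (\<lambda>_. 1) (\<lambda>_. z)"
    using z d by (intro cycle_plus) auto
  have B: "cycle b c d \<phi> \<alpha> \<epsilon> \<mu> \<nu> U h h' 3 (\<lambda>_. -1) (\<lambda>_. 1) (\<lambda>_. z)"
    using z d by (intro cycle_plus) auto
  let ?A = "cycle_orbit (\<lambda>_. 1) (\<lambda>_. 1) (\<lambda>_. z)" and ?B = "cycle_orbit (\<lambda>_. -1) (\<lambda>_. 1) (\<lambda>_. z)"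
  have pA: "passes_nearby \<phi> \<eta> [e 1, e 3, e 2, e 1] ?A"
    using cycle.cycle_orbit_passes[OF A eta] by (simp add: act_pole upt_rec)
  have pB: "passes_nearby \<phi> \<eta> [- e 1, - e 3, - e 2, - e 1] ?B"
    using cycle.cycle_orbit_passes[OF B eta] by (simp add: act_pole upt_rec)
  have "?A \<noteq> ?B" by (rule passes_nearby_distinct[OF pA pB, of "e 1"]) auto
  moreover have "set [?A, ?B] = {\<gamma>. periodic_orbit \<phi> \<gamma> \<and> \<gamma> \<subseteq> saturate U \<and> repelling \<phi> \<gamma>}"
  proof (intro equalityI subsetI)
    fix \<gamma> assume "\<gamma> \<in> set [?A, ?B]"
    then show "\<gamma> \<in> {\<gamma>. periodic_orbit \<phi> \<gamma> \<and> \<gamma> \<subseteq> saturate U \<and> repelling \<phi> \<gamma>}"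
      using cycle.cycle_orbit_facts[OF A] cycle.repelling_orbit[OF A a z(1)]
        cycle.cycle_orbit_facts[OF B] cycle.repelling_orbit[OF B a z(1)] by auto
  next
    fix \<gamma> assume "\<gamma> \<in> {\<gamma>. periodic_orbit \<phi> \<gamma> \<and> \<gamma> \<subseteq> saturate U \<and> repelling \<phi> \<gamma>}"
    then have \<gamma>: "periodic_orbit \<phi> \<gamma>" "\<gamma> \<subseteq> saturate U" by auto
    obtain \<tau> k where s: "\<bar>\<tau>\<bar> = 1" "act \<tau> k (entry 1 z) \<in> \<gamma>"
      using states_repelled[OF a d0 \<gamma> z] d unfolding state_in_def by auto
    show "\<gamma> \<in> set [?A, ?B]"
      using sign_cases[OF s(1)] cycle.cycle_orbit_unique[OF A \<gamma>(1), of k k] cycle.cycle_orbit_unique[OF B \<gamma>(1), of k k] s(2) by auto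
  qed
  ultimately show ?thesis
    unfolding periodic_orbits_are_def using pA pB by (intro exI[of _ "[?A, ?B]"]) auto
qed

end
end

section \<open>Choice of the constants\<close>

text \<open>The radial term drops out and the expression becomes a positive power of v1 times r^2 M
  plus a term linear in d. The bound on \<mu> gives M \<ge> 1/2, so the main part is at least
  \<nu>^2 / 2, while |d| < \<nu> / 8 keeps the perturbation below half of that.\<close>

lemma field_turns_away:
  assumes nu: "0 < \<nu>" "\<nu> < \<mu>" and mu: "8 * (1 + \<bar>b\<bar> + \<bar>c\<bar>) * \<mu> \<le> 1" and d: "\<bar>d\<bar> < \<nu> / 8"
    and v: "0 < v$1" "\<bar>fst (chart v)\<bar> < \<mu>" "\<bar>snd (chart v)\<bar> = \<nu>"
  shows "0 < (PN b c d v $ 3 * v$1 - v$3 * PN b c d v $ 1) * v$3"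
proof -
  define p r where "p = v$2 / v$1" and "r = v$3 / v$1"
  have pr: "v$2 = p * v$1" "v$3 = r * v$1" using v(1) by (simp_all add: p_def r_def)
  have p: "\<bar>p\<bar> < \<mu>" and r: "\<bar>r\<bar> = \<nu>" using v by (simp_all add: chart_def p_def r_def)
  define M where "M = 1 - r\<^sup>2 + b * r * p + c * p\<^sup>2 - b * r - c * r\<^sup>2"
  have "(PN b c d v $ 3 * v$1 - v$3 * PN b c d v $ 1) * v$3 = (q b c d (v$3) (v$2) * v$1 - v$3 * q b c d (v$1) (v$3)) * v$3"
    by (simp add: PN_component algebra_simps)
  also have "\<dots> = (v$1) ^ 5 * (r\<^sup>2 * M + d * (r * p ^ 3 - r ^ 5))"
    unfolding pr q_def M_def by (simp add: algebra_simps power2_eq_square power3_eq_cube eval_nat_numeral)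
  finally have eq: "(PN b c d v $ 3 * v$1 - v$3 * PN b c d v $ 1) * v$3 = (v$1) ^ 5 * (r\<^sup>2 * M + d * (r * p ^ 3 - r ^ 5))" .
  have mu0: "0 < \<mu>" using nu by simp
  have bm: "\<bar>b\<bar> * \<mu> + \<bar>c\<bar> * \<mu> + \<mu> \<le> 1/8" using mu by (simp add: algebra_simps)
  have "0 \<le> \<bar>b\<bar> * \<mu>" "0 \<le> \<bar>c\<bar> * \<mu>" using mu0 by auto
  then have mu1: "\<mu> \<le> 1/8" using bm by linarith
  have r1: "\<bar>r\<bar> \<le> \<mu>" "\<bar>r\<bar> \<le> 1" "\<bar>p\<bar> \<le> \<mu>" "\<bar>p\<bar> \<le> 1" using r p nu mu1 by linarith+
  have sq: "r\<^sup>2 \<le> \<mu>" "p\<^sup>2 \<le> \<mu>"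
  proof -
    have "\<bar>r\<bar> * \<bar>r\<bar> \<le> \<mu> * 1" "\<bar>p\<bar> * \<bar>p\<bar> \<le> \<mu> * 1" using r1 mu0 by (intro mult_mono; simp)+
    then show "r\<^sup>2 \<le> \<mu>" "p\<^sup>2 \<le> \<mu>" by (simp_all add: power2_eq_square abs_mult[symmetric])
  qed
  have "\<bar>b * r * p\<bar> \<le> \<bar>b\<bar> * \<mu>"
  proof -
    have "\<bar>r\<bar> * \<bar>p\<bar> \<le> \<mu> * 1" using r1 mu0 by (intro mult_mono) auto
    then have "\<bar>b\<bar> * (\<bar>r\<bar> * \<bar>p\<bar>) \<le> \<bar>b\<bar> * \<mu>" by (intro mult_left_mono) auto
    then show ?thesis by (simp add: abs_mult mult.assoc)
  qed
  moreover have "\<bar>c * p\<^sup>2\<bar> \<le> \<bar>c\<bar> * \<mu>" "\<bar>c * r\<^sup>2\<bar> \<le> \<bar>c\<bar> * \<mu>" "\<bar>b * r\<bar> \<le> \<bar>b\<bar> * \<mu>"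
    using sq r1 by (auto simp: abs_mult intro!: mult_left_mono)
  ultimately have "1/2 \<le> M" unfolding M_def using sq(1) bm mu0 by linarith
  then have "r\<^sup>2 * (1/2) \<le> r\<^sup>2 * M" by (intro mult_left_mono) auto
  moreover have "\<bar>d * (r * p ^ 3 - r ^ 5)\<bar> \<le> \<nu> / 8 * (2 * \<nu>)"
  proof -
    have "\<bar>p\<bar> ^ 3 \<le> 1" "\<bar>r\<bar> ^ 4 \<le> 1" by (rule power_le_one[OF abs_ge_zero r1(4)] power_le_one[OF abs_ge_zero r1(2)])+
    then have "\<bar>r\<bar> * \<bar>p\<bar> ^ 3 \<le> \<nu> * 1" "\<bar>r\<bar> * \<bar>r\<bar> ^ 4 \<le> \<nu> * 1"
      unfolding r using nu by (intro mult_left_mono; simp)+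
    then have "\<bar>r * p ^ 3\<bar> \<le> \<nu>" "\<bar>r ^ 5\<bar> \<le> \<nu>" by (simp_all add: abs_mult power_abs eval_nat_numeral)
    then have "\<bar>r * p ^ 3 - r ^ 5\<bar> \<le> 2 * \<nu>" by linarith
    then show ?thesis unfolding abs_mult using d nu by (intro mult_mono) auto
  qed
  moreover have "r\<^sup>2 = \<nu>\<^sup>2" using r by (metis power2_abs)
  moreover have "0 < \<nu>\<^sup>2" "\<nu> / 8 * (2 * \<nu>) = \<nu>\<^sup>2 / 4" using nu by (simp_all add: power2_eq_square)
  ultimately have "0 < r\<^sup>2 * M + d * (r * p ^ 3 - r ^ 5)" by linarith
  then show ?thesis unfolding eq using v(1) by simp
qed

text \<open>Each of the two bounds on d makes one summand smaller than \<mu> / 2; the second bound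
  inverts the power \<alpha>.\<close>

lemma small_perturbation:
  fixes \<alpha> \<epsilon> \<mu> d :: real
  assumes "0 < \<alpha>" "0 < \<epsilon>" "0 < \<mu>" and d: "\<bar>d\<bar> < \<mu> / 2" "\<bar>d\<bar> < \<mu> / 2 * (\<mu> / (4 * \<epsilon>)) powr (1 / \<alpha>)"
  shows "\<bar>d\<bar> + 2 * \<epsilon> * (2 * \<bar>d\<bar> / \<mu>) powr \<alpha> < \<mu>"
proof -
  have "2 * \<bar>d\<bar> / \<mu> < (\<mu> / (4 * \<epsilon>)) powr (1 / \<alpha>)" using d(2) assms by (simp add: field_simps)
  then have "(2 * \<bar>d\<bar> / \<mu>) powr \<alpha> < ((\<mu> / (4 * \<epsilon>)) powr (1 / \<alpha>)) powr \<alpha>"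
    using assms by (intro powr_less_mono2) auto
  also have "\<dots> = \<mu> / (4 * \<epsilon>)" using assms by (simp add: powr_powr)
  finally have "2 * \<epsilon> * (2 * \<bar>d\<bar> / \<mu>) powr \<alpha> < 2 * \<epsilon> * (\<mu> / (4 * \<epsilon>))" using assms by (intro mult_strict_left_mono) auto
  then show ?thesis using d(1) assms by simp
qed

text \<open>The quantifiers follow the dependence of the constants: \<epsilon> places entry points
  \<eta>-close to the poles, \<mu> is fitted to the slope of the exit map, whose coefficient depends
  on \<epsilon>, and d must be small relative to both so that passages turn the corner of the cross.
  The neighbourhood and the equivalence come last, since they belong to the individual
  field.\<close>

theorem theorem2:
  fixes lam b c \<alpha> :: real
    and \<Phi> :: "real \<Rightarrow> real \<Rightarrow> real^3 \<Rightarrow> real^3"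
  assumes "lam > 0"
    and "b\<^sup>2 + 4 * (c + 1) < 0"
    and "coefficient_condition (-1) b c 0"
    and "contracting (QN b c 0)"
    and "\<And>d. flow_of (PN b c d) S2 (\<Phi> d)"
    and "\<alpha> = - (c + 1)"
  shows
    "(\<forall>i. \<forall>s\<in>{1,-1}. \<forall>s'\<in>{1,-1}.
        heteroclinic_connection (\<Phi> 0) (s *\<^sub>R e (i + 1)) (s' *\<^sub>R e i)
          (quarter_circle (s *\<^sub>R e (i + 1)) (s' *\<^sub>R e i))) \<and>
     (\<forall>\<eta>. 0 < \<eta> \<and> \<eta> \<le> 1/2 \<longrightarrow>
       (\<exists>\<epsilon>0>0. \<forall>\<epsilon>. 0 < \<epsilon> \<and> \<epsilon> < \<epsilon>0 \<longrightarrow>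
       (\<exists>\<mu>0>0. \<forall>\<mu> \<nu>. 0 < \<mu> \<and> \<mu> < \<mu>0 \<and> \<nu> = \<epsilon> * \<mu> \<longrightarrow>
       (\<exists>d0>0. \<forall>d U h h'.
          \<bar>d\<bar> < d0 \<and> contracting (QN b c d) \<and> locally_linear (\<Phi> d) \<alpha> d \<epsilon> \<mu> \<nu> U h h' \<longrightarrow>
          network \<subseteq> (top_of_set S2) interior_of (saturate U) \<and>
          (\<alpha> > 1 \<and> d > 0 \<longrightarrow>
             periodic_orbits_are (\<Phi> d) (saturate U) \<eta> attracting
               [[e 1, e 3, e 2, e 1],
                [- e 1, - e 3, - e 2, - e 1],
                [e 1, - e 3, e 2, - e 1, e 3, - e 2, e 1]]) \<and>
          (\<alpha> > 1 \<and> d < 0 \<longrightarrow>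
             periodic_orbits_are (\<Phi> d) (saturate U) \<eta> attracting
               [[e 1, - e 3, - e 2, e 1, e 3, - e 2, - e 1, e 3, e 2, - e 1, - e 3, e 2, e 1]]) \<and>
          (\<alpha> < 1 \<and> d > 0 \<longrightarrow>
             periodic_orbits_are (\<Phi> d) (saturate U) \<eta> repelling
               [[e 1, - e 3, e 2, - e 1, e 3, - e 2, e 1]]) \<and>
          (\<alpha> < 1 \<and> d < 0 \<longrightarrow>
             periodic_orbits_are (\<Phi> d) (saturate U) \<eta> repelling
               [[e 1, e 3, e 2, e 1],
                [- e 1, - e 3, - e 2, - e 1]])))))"
proof (intro conjI allI impI ballI, goal_cases)
  case (1 i s s')
  interpret PN_flow_zero b c "\<Phi> 0"
    using assms by unfold_locales auto
  show ?case by (rule connections[OF 1])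
next
  case (2 \<eta>)
  have "c + 1 < 0" using assms(2) by (smt (verit) zero_le_power2)
  then have alpha: "0 < \<alpha>" using assms(6) by simp
  show ?case
  proof (rule exI[of _ "min (\<eta> / 2) (1/4)"], rule conjI, goal_cases)
    case 1
    show ?case using 2 by simp
  next
    case 2
    show ?case
    proof (intro allI impI, goal_cases)
      case (1 \<epsilon>)
      then have eps: "0 < \<epsilon>" "\<epsilon> < 1/4" and eta: "2 * \<epsilon> < \<eta>" "\<eta> \<le> 1/2"
        using \<open>0 < \<eta> \<and> \<eta> \<le> 1/2\<close> by auto
      \<comment> \<open>This is \<open>K_min\<close>, written out because d and the equivalence are
        not yet fixed.\<close>
      define \<kappa> where "\<kappa> = \<epsilon> / 2 * (\<epsilon>\<^sup>2) powr \<alpha>"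
      have kappa: "0 < \<kappa>" using eps by (simp add: \<kappa>_def)
      define \<mu>1 where "\<mu>1 = min (\<epsilon>\<^sup>2) (1 / (8 * (1 + \<bar>b\<bar> + \<bar>c\<bar>)))"
      \<comment> \<open>The value of \<mu> at which the slope condition becomes an equality. For
        \<alpha> < 1 the exponent is negative, and the power \<alpha> - 1 is decreasing in \<mu>, so
        smaller \<mu> is again better. For \<alpha> = 1 division by zero gives exponent 0 and the
        harmless positive value 1.\<close>
      define \<mu>2 where "\<mu>2 = (if \<alpha> > 1 then (1 / (4 * \<alpha>)) powr (1 / (\<alpha> - 1)) else (4 / (\<kappa> * \<alpha>)) powr (1 / (\<alpha> - 1)))"
      show ?case
      proof (rule exI[of _ "min \<mu>1 \<mu>2"], rule conjI, goal_cases)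
        case 1
        have "0 < \<mu>1" using eps by (simp add: \<mu>1_def add_pos_nonneg)
        moreover have "0 < \<mu>2" using alpha kappa by (simp add: \<mu>2_def)
        ultimately show ?case by simp
      next
        case 2
        show ?case
        proof (intro allI impI, goal_cases)
          case (1 \<mu> \<nu>)
          then have mu: "0 < \<mu>" "\<mu> < \<epsilon>\<^sup>2" "\<mu> < 1 / (8 * (1 + \<bar>b\<bar> + \<bar>c\<bar>))" "\<mu> < \<mu>2" and nu: "\<nu> = \<epsilon> * \<mu>"
            by (auto simp: \<mu>1_def)
          have mu8: "8 * (1 + \<bar>b\<bar> + \<bar>c\<bar>) * \<mu> \<le> 1" using mu(3) by (simp add: pos_less_divide_eq add_pos_nonneg mult.commute)
          have nu': "0 < \<nu>" "\<nu> < \<mu>" using eps mu(1) by (simp_all add: nu)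
          have a1: "\<mu> powr (\<alpha> - 1) \<le> 1 / (4 * \<alpha>)" if "\<alpha> > 1"
          proof -
            have "\<mu> powr (\<alpha> - 1) \<le> ((1 / (4 * \<alpha>)) powr (1 / (\<alpha> - 1))) powr (\<alpha> - 1)"
              using mu that by (intro powr_mono2) (auto simp: \<mu>2_def)
            then show ?thesis using that by (simp add: powr_powr)
          qed
          have a2: "4 / (\<kappa> * \<alpha>) \<le> \<mu> powr (\<alpha> - 1)" if "\<alpha> < 1"
          proof -
            have "((4 / (\<kappa> * \<alpha>)) powr (1 / (\<alpha> - 1))) powr (\<alpha> - 1) \<le> \<mu> powr (\<alpha> - 1)"
              using mu that by (intro powr_mono2') (auto simp: \<mu>2_def)
            then show ?thesis using that alpha kappa by (simp add: powr_powr)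
          qed
          \<comment> \<open>The first entry serves \<open>field_turns_away\<close> and also gives
            |d| < \<mu> / 2; the second serves \<open>small_perturbation\<close>.\<close>
          define d1 where "d1 = min (\<nu> / 8) (\<mu> / 2 * (\<mu> / (4 * \<epsilon>)) powr (1 / \<alpha>))"
          show ?case
          proof (rule exI[of _ d1], rule conjI, goal_cases)
            case 1
            show ?case using nu' mu eps by (simp add: d1_def)
          next
            case 2
            show ?case
            proof (intro allI impI, goal_cases)
              case (1 d U h h')
              then have d: "\<bar>d\<bar> < \<nu> / 8" "\<bar>d\<bar> < \<mu> / 2 * (\<mu> / (4 * \<epsilon>)) powr (1 / \<alpha>)"
                and lin: "locally_linear (\<Phi> d) \<alpha> d \<epsilon> \<mu> \<nu> U h h'" by (auto simp: d1_def)
              interpret turning b c d "\<Phi> d" \<alpha> \<epsilon> \<mu> \<nu> U h h'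
              proof unfold_locales
                show "flow_of (PN b c d) S2 (\<Phi> d)" by (rule assms(5))
                show "\<bar>d\<bar> + 2 * \<epsilon> * (2 * \<bar>d\<bar> / \<mu>) powr \<alpha> < \<mu>"
                  using d nu' mu eps alpha by (intro small_perturbation) auto
                show "0 < (PN b c d v $ 3 * v$1 - v$3 * PN b c d v $ 1) * v$3"
                  if "v \<in> S2" "0 < v$1" "\<bar>fst (chart v)\<bar> < \<mu>" "\<bar>snd (chart v)\<bar> = \<nu>" for v
                  using field_turns_away[OF nu' mu8 d(1)] that by blast
              qed (fact alpha eps mu nu lin)+
              have K: "K_min = \<kappa>" by (simp add: K_min_def \<kappa>_def)
              show ?case
                using network_interior orbits_attracting_pos[OF eta _ a1] orbits_attracting_neg[OF eta _ a1]
                  orbits_repelling_pos[OF eta _ a2[folded K]] orbits_repelling_neg[OF eta _ a2[folded K]] by blast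
            qed
          qed
        qed
      qed
    qed
  qed
qed

end
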